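(* Let $\Gamma$ be a distance-regular graph with vertex set $X$ and diameter $d\geqslant 3$ having classical parameters $(d,q,\alpha,\beta)$, equipped with its standard $Q$-polynomial ordering. Let $\mathscr{P}$ be a nonempty family of descendents of $\Gamma$ such that (1) for every $i$ $(0\leqslant i\leqslant d)$, any two vertices $x,y\in X$ at distance $i$ are contained in a unique member of $\mathscr{P}$ with width $i$; (2) $Y_1\cap Y_2\in\mathscr{P}$ for all $Y_1,Y_2\in\mathscr{P}$ such that $Y_1\cap Y_2\neq\emptyset$. Define a partial order on $\mathscr{P}$ by reverse inclusion. Then $\mathscr{P}$ is a nontrivial regular quantum matroid with parameters $(d,q,\alpha,\beta)$.
   Context: All graphs are finite, simple and undirected. Let $\Gamma$ be a connected graph with vertex set $X$, path-length distance $\partial$ and diameter $d$; let $A_i\in\mathbb{C}^{X\times X}$ be the adjacency matrix of the distance-$i$ graph ($A_0=I$). $\Gamma$ is distance-regular if there are integers $b_i,c_i$ such that whenever $\partial(x,y)=i$, $y$ has exactly $b_i$ (resp. $c_i$) neighbours at distance $i+1$ (resp. $i-1$) from $x$. Then the Bose--Mesner algebra $\langle A_0,\dots,A_d\rangle$ (complex span) is a commutative semisimple algebra with a basis of primitive idempotents $E_0=|X|^{-1}J,E_1,\dots,E_d$. $\Gamma$ is $Q$-polynomial with respect to the ordering $\{E_i\}_{i=0}^d$ if there are scalars $a_i^*,b_i^*,c_i^*$ with $b_d^*=c_0^*=0$, $b_{i-1}^*c_i^*\neq 0$ $(1\leqslant i\leqslant d)$ and $E_1\circ E_i=|X|^{-1}(b_{i-1}^*E_{i-1}+a_i^*E_i+c_{i+1}^*E_{i+1})$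 $(0\leqslant i\leqslant d)$, where $\circ$ is the entrywise product, $E_{-1}=E_{d+1}=0$, $b_{-1}^*=c_{d+1}^*=0$. Write $|X|E_1=\sum_{i=0}^d\theta_i^*A_i$. For a nonempty $Y\subseteq X$ with characteristic vector $\hat Y$, the width is $w=\max\{i:\hat Y^{\mathsf T}A_i\hat Y\neq 0\}$ and the dual width is $w^*=\max\{i:\hat Y^{\mathsf T}E_i\hat Y\neq 0\}$. One always has $w+w^*\geqslant d$; $Y$ is a descendent of $\Gamma$ if $w+w^*=d$. Put $[i]_q=1+q+\dots+q^{i-1}$. $\Gamma$ has classical parameters $(d,q,\alpha,\beta)$ if $b_i=([d]_q-[i]_q)(\beta-\alpha[i]_q)$ and $c_i=[i]_q(1+\alpha[i-1]_q)$ for $0\leqslant i\leqslant d$. Then $\Gamma$ has a $Q$-polynomial ordering, called standard, for which $\theta_i^*=\xi^*[d-i]_q+\zeta^*$ for some scalars $\xi^*\neq 0$, $\zeta^*$. A finite nonempty poset $\mathscr{P}$ is a quantum matroid if: (QM1) $\mathscr{P}$ is ranked; (QM2) $\mathscr{P}$ is a (meet) semilattice; (QM3) for all $x\in\mathscr{P}$, the interval $[0,x]$ is a modular atomic lattice, where $0$ is the least element; (QM4) for all $x,y\in\mathscr{P}$ with $\mathrm{rank}(x)<\mathrm{rank}(y)$, there is an atom $a\in\mathscr{P}$ such that $a\leqslant y$, $a\not\leqslant x$ and $x\vee a$ exists in $\mathscr{P}$. It is nontrivial if it has rank $d\geqslant 2$ and is not a modular atomic lattice. A nontrivial quantum matroid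 of rank $d$ is $q$-line regular if each rank $2$ element covers exactly $q+1$ elements; $\beta$-dual-line regular if each element of rank $d-1$ is covered by exactly $\beta+1$ elements; $\alpha$-zig-zag regular if for all pairs $(x,y)$ such that $\mathrm{rank}(x)=d-1$, $\mathrm{rank}(y)=d$ and $x$ covers $x\wedge y$, there are exactly $\alpha+1$ pairs $(x_1,y_1)$ such that $y_1$ covers both $x$ and $x_1$, and $y$ covers $x_1$. It is regular with parameters $(d,q,\alpha,\beta)$ if it has rank $d$ and is $q$-line regular, $\beta$-dual-line regular and $\alpha$-zig-zag regular. *)

theory Defs
  imports "HOL-Analysis.Analysis" "HOL-Algebra.Lattice"
begin

section \<open>Distance-regular graphs\<close>

text \<open>The vertex set \<open>X\<close> of a graph is a finite type \<open>'x\<close>, so that matrices indexed by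
  \<open>X\<close> have type \<open>complex^'x^'x\<close>; the graph itself is given by its adjacency relation.\<close>

definition simple_graph :: "('x \<Rightarrow> 'x \<Rightarrow> bool) \<Rightarrow> bool" where
  "simple_graph adj \<longleftrightarrow> symp adj \<and> irreflp adj"

definition connected_graph :: "('x \<Rightarrow> 'x \<Rightarrow> bool) \<Rightarrow> bool" where
  "connected_graph adj \<longleftrightarrow> (\<forall>x y. adj\<^sup>*\<^sup>* x y)"

definition graph_dist :: "('x \<Rightarrow> 'x \<Rightarrow> bool) \<Rightarrow> 'x \<Rightarrow> 'x \<Rightarrow> nat" where
  "graph_dist adj x y = (LEAST n. (adj ^^ n) x y)"

definition graph_diameter :: "('x::finite \<Rightarrow> 'x \<Rightarrow> bool) \<Rightarrow> nat" where
  "graph_diameter adj = Max {graph_dist adj x y | x y. True}"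

definition intersection_numbers ::
    "('x::finite \<Rightarrow> 'x \<Rightarrow> bool) \<Rightarrow> (nat \<Rightarrow> nat) \<Rightarrow> (nat \<Rightarrow> nat) \<Rightarrow> bool" where
  "intersection_numbers adj b c \<longleftrightarrow>
     (\<forall>i x y. graph_dist adj x y = i \<longrightarrow>
        card {z. adj y z \<and> graph_dist adj x z = i + 1} = b i \<and>
        card {z. adj y z \<and> graph_dist adj x z + 1 = i} = c i)"

definition distance_regular :: "('x::finite \<Rightarrow> 'x \<Rightarrow> bool) \<Rightarrow> bool" where
  "distance_regular adj \<longleftrightarrow>
     simple_graph adj \<and> connected_graph adj \<and> (\<exists>b c. intersection_numbers adj b c)"

definition qint :: "real \<Rightarrow> nat \<Rightarrow> real" where
  "qint q i = (\<Sum>j<i. q ^ j)"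

definition classical_parameters ::
    "('x::finite \<Rightarrow> 'x \<Rightarrow> bool) \<Rightarrow> nat \<Rightarrow> real \<Rightarrow> real \<Rightarrow> real \<Rightarrow> bool" where
  "classical_parameters adj d q \<alpha> \<beta> \<longleftrightarrow>
     graph_diameter adj = d \<and>
     (\<exists>b c. intersection_numbers adj b c \<and>
        (\<forall>i\<le>d. real (b i) = (qint q d - qint q i) * (\<beta> - \<alpha> * qint q i) \<and>
               real (c i) = qint q i * (1 + \<alpha> * qint q (i - 1))))"
  \<comment> \<open>At \<open>i = 0\<close> the truncated index \<open>i - 1\<close> is harmless, since \<open>qint q 0 = 0\<close>.\<close>


section \<open>The Bose--Mesner algebra and \<open>Q\<close>-polynomial orderings\<close>

definition dist_matrix :: "('x::finite \<Rightarrow> 'x \<Rightarrow> bool) \<Rightarrow> nat \<Rightarrow> complex^'x^'x" where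
  "dist_matrix adj i = (\<chi> x y. if graph_dist adj x y = i then 1 else 0)"

definition all_ones :: "complex^'x^'x::finite" where
  "all_ones = (\<chi> x y. 1)"

definition cscale :: "complex \<Rightarrow> complex^'x^'x \<Rightarrow> complex^'x^'x::finite" where
  "cscale c M = map_matrix ((*) c) M"

definition bose_mesner :: "('x::finite \<Rightarrow> 'x \<Rightarrow> bool) \<Rightarrow> (complex^'x^'x) set" where
  "bose_mesner adj =
     {\<Sum>i\<le>graph_diameter adj. cscale (s i) (dist_matrix adj i) | s. True}"

definition primitive_idempotent ::
    "(complex^'x^'x) set \<Rightarrow> complex^'x^'x::finite \<Rightarrow> bool" where
  "primitive_idempotent \<A> e \<longleftrightarrow>
     e \<in> \<A> \<and> e \<noteq> 0 \<and> e ** e = e \<and>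
     \<not> (\<exists>f\<in>\<A>. \<exists>g\<in>\<A>. f \<noteq> 0 \<and> g \<noteq> 0 \<and> f ** f = f \<and> g ** g = g \<and>
          f ** g = 0 \<and> g ** f = 0 \<and> e = f + g)"

definition idempotent_ordering ::
    "('x::finite \<Rightarrow> 'x \<Rightarrow> bool) \<Rightarrow> (nat \<Rightarrow> complex^'x^'x) \<Rightarrow> bool" where
  "idempotent_ordering adj E \<longleftrightarrow>
     bij_betw E {..graph_diameter adj} {e. primitive_idempotent (bose_mesner adj) e} \<and>
     E 0 = cscale (1 / of_nat CARD('x)) all_ones"

text \<open>The product \<open>*\<close> on \<open>complex^'x^'x\<close> is the entrywise product; the matrix product is
  \<open>**\<close>.  The terms with \<open>E\<^sub>-\<^sub>1\<close> and \<open>E\<^sub>d\<^sub>+\<^sub>1\<close>, which are zero by convention, are left out.\<close>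

definition Q_polynomial ::
    "('x::finite \<Rightarrow> 'x \<Rightarrow> bool) \<Rightarrow> (nat \<Rightarrow> complex^'x^'x) \<Rightarrow> bool" where
  "Q_polynomial adj E \<longleftrightarrow>
     idempotent_ordering adj E \<and>
     (let d = graph_diameter adj in
      \<exists>a b c :: nat \<Rightarrow> complex.
        b d = 0 \<and> c 0 = 0 \<and> (\<forall>i. 1 \<le> i \<and> i \<le> d \<longrightarrow> b (i - 1) * c i \<noteq> 0) \<and>
        (\<forall>i\<le>d. E 1 * E i = cscale (1 / of_nat CARD('x))
           ((if i = 0 then 0 else cscale (b (i - 1)) (E (i - 1))) +
            cscale (a i) (E i) +
            (if i = d then 0 else cscale (c (i + 1)) (E (i + 1))))))"

definition dual_eigenvalues ::
    "('x::finite \<Rightarrow> 'x \<Rightarrow> bool) \<Rightarrow> (nat \<Rightarrow> complex^'x^'x) \<Rightarrow> (nat \<Rightarrow> complex) \<Rightarrow> bool" where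
  "dual_eigenvalues adj E \<theta> \<longleftrightarrow>
     cscale (of_nat CARD('x)) (E 1) =
       (\<Sum>i\<le>graph_diameter adj. cscale (\<theta> i) (dist_matrix adj i))"

definition standard_ordering ::
    "('x::finite \<Rightarrow> 'x \<Rightarrow> bool) \<Rightarrow> real \<Rightarrow> (nat \<Rightarrow> complex^'x^'x) \<Rightarrow> bool" where
  "standard_ordering adj q E \<longleftrightarrow>
     Q_polynomial adj E \<and>
     (\<exists>\<theta> \<xi> \<zeta>. dual_eigenvalues adj E \<theta> \<and> \<xi> \<noteq> 0 \<and>
        (\<forall>i\<le>graph_diameter adj.
           \<theta> i = \<xi> * complex_of_real (qint q (graph_diameter adj - i)) + \<zeta>))"


section \<open>Width, dual width and descendents\<close>

definition char_vec :: "'x set \<Rightarrow> complex^'x::finite" where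
  "char_vec Y = (\<chi> x. if x \<in> Y then 1 else 0)"

text \<open>\<open>v\<^sup>T M v\<close>, without complex conjugation.\<close>

definition quad_form :: "complex^'x^'x \<Rightarrow> complex^'x::finite \<Rightarrow> complex" where
  "quad_form M v = (\<Sum>x\<in>UNIV. v $ x * (M *v v) $ x)"

definition width :: "('x::finite \<Rightarrow> 'x \<Rightarrow> bool) \<Rightarrow> 'x set \<Rightarrow> nat" where
  "width adj Y =
     Max {i. i \<le> graph_diameter adj \<and> quad_form (dist_matrix adj i) (char_vec Y) \<noteq> 0}"

definition dual_width ::
    "('x::finite \<Rightarrow> 'x \<Rightarrow> bool) \<Rightarrow> (nat \<Rightarrow> complex^'x^'x) \<Rightarrow> 'x set \<Rightarrow> nat" where
  "dual_width adj E Y =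
     Max {i. i \<le> graph_diameter adj \<and> quad_form (E i) (char_vec Y) \<noteq> 0}"

definition descendent ::
    "('x::finite \<Rightarrow> 'x \<Rightarrow> bool) \<Rightarrow> (nat \<Rightarrow> complex^'x^'x) \<Rightarrow> 'x set \<Rightarrow> bool" where
  "descendent adj E Y \<longleftrightarrow>
     Y \<noteq> {} \<and> width adj Y + dual_width adj E Y = graph_diameter adj"


section \<open>Quantum matroids\<close>

definition covers :: "'a gorder \<Rightarrow> 'a \<Rightarrow> 'a \<Rightarrow> bool" where
  "covers L y x \<longleftrightarrow>
     x \<in> carrier L \<and> y \<in> carrier L \<and> x \<sqsubset>\<^bsub>L\<^esub> y \<and>
     \<not> (\<exists>z\<in>carrier L. x \<sqsubset>\<^bsub>L\<^esub> z \<and> z \<sqsubset>\<^bsub>L\<^esub> y)"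

definition rank_function :: "'a gorder \<Rightarrow> ('a \<Rightarrow> nat) \<Rightarrow> bool" where
  "rank_function L r \<longleftrightarrow>
     (\<forall>x\<in>carrier L. (\<forall>y\<in>carrier L. y \<sqsubseteq>\<^bsub>L\<^esub> x \<longrightarrow> y = x) \<longrightarrow> r x = 0) \<and>
     (\<forall>x y. covers L y x \<longrightarrow> r y = r x + 1)"

definition ranked :: "'a gorder \<Rightarrow> bool" where
  "ranked L \<longleftrightarrow> (\<exists>r. rank_function L r)"

text \<open>On the carrier of a finite ranked poset the rank function is unique.\<close>

definition rank_of :: "'a gorder \<Rightarrow> 'a \<Rightarrow> nat" where
  "rank_of L = (SOME r. rank_function L r)"

definition poset_rank :: "'a gorder \<Rightarrow> nat" where
  "poset_rank L = Max (rank_of L ` carrier L)"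

definition atom :: "'a gorder \<Rightarrow> 'a \<Rightarrow> bool" where
  "atom L a \<longleftrightarrow> covers L a \<bottom>\<^bsub>L\<^esub>"

text \<open>As usual for matroid lattices, atomic means that every element is a join of atoms
  (\<open>least L x (Upper L S)\<close> says that \<open>x\<close> is the supremum of \<open>S\<close>; \<open>S = {}\<close> gives the least
  element).\<close>

definition modular_atomic_lattice :: "'a gorder \<Rightarrow> bool" where
  "modular_atomic_lattice L \<longleftrightarrow>
     lattice L \<and>
     (\<forall>x\<in>carrier L. \<forall>y\<in>carrier L. \<forall>z\<in>carrier L.
        x \<sqsubseteq>\<^bsub>L\<^esub> z \<longrightarrow> x \<squnion>\<^bsub>L\<^esub> (y \<sqinter>\<^bsub>L\<^esub> z) = (x \<squnion>\<^bsub>L\<^esub> y) \<sqinter>\<^bsub>L\<^esub> z) \<and>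
     (\<forall>x\<in>carrier L. \<exists>S. S \<subseteq> {a. atom L a} \<and> least L x (Upper L S))"

definition quantum_matroid :: "'a gorder \<Rightarrow> bool" where
  "quantum_matroid L \<longleftrightarrow>
     partial_order L \<and> finite (carrier L) \<and> carrier L \<noteq> {} \<and>
     ranked L \<and>
     lower_semilattice L \<and>
     (\<forall>x\<in>carrier L. modular_atomic_lattice (L\<lparr>carrier := \<lbrace>\<bottom>\<^bsub>L\<^esub>..x\<rbrace>\<^bsub>L\<^esub>\<rparr>)) \<and>
     (\<forall>x\<in>carrier L. \<forall>y\<in>carrier L. rank_of L x < rank_of L y \<longrightarrow>
        (\<exists>a. atom L a \<and> a \<sqsubseteq>\<^bsub>L\<^esub> y \<and> \<not> a \<sqsubseteq>\<^bsub>L\<^esub> x \<and> (\<exists>s. least L s (Upper L {x, a}))))"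

definition nontrivial_quantum_matroid :: "'a gorder \<Rightarrow> bool" where
  "nontrivial_quantum_matroid L \<longleftrightarrow>
     quantum_matroid L \<and> poset_rank L \<ge> 2 \<and> \<not> modular_atomic_lattice L"

definition line_regular :: "'a gorder \<Rightarrow> real \<Rightarrow> bool" where
  "line_regular L q \<longleftrightarrow>
     (\<forall>x\<in>carrier L. rank_of L x = 2 \<longrightarrow> real (card {y. covers L x y}) = q + 1)"

definition dual_line_regular :: "'a gorder \<Rightarrow> real \<Rightarrow> bool" where
  "dual_line_regular L \<beta> \<longleftrightarrow>
     (\<forall>x\<in>carrier L. rank_of L x = poset_rank L - 1 \<longrightarrow>
        real (card {y. covers L y x}) = \<beta> + 1)"

definition zig_zag_regular :: "'a gorder \<Rightarrow> real \<Rightarrow> bool" where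
  "zig_zag_regular L \<alpha> \<longleftrightarrow>
     (\<forall>x\<in>carrier L. \<forall>y\<in>carrier L.
        rank_of L x = poset_rank L - 1 \<and> rank_of L y = poset_rank L \<and>
        covers L x (x \<sqinter>\<^bsub>L\<^esub> y) \<longrightarrow>
        real (card {(x1, y1). covers L y1 x \<and> covers L y1 x1 \<and> covers L y x1}) = \<alpha> + 1)"

definition regular_with_parameters ::
    "'a gorder \<Rightarrow> nat \<Rightarrow> real \<Rightarrow> real \<Rightarrow> real \<Rightarrow> bool" where
  "regular_with_parameters L d q \<alpha> \<beta> \<longleftrightarrow>
     poset_rank L = d \<and> line_regular L q \<and> dual_line_regular L \<beta> \<and> zig_zag_regular L \<alpha>"

definition reverse_inclusion :: "'x set set \<Rightarrow> 'x set gorder" where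
  "reverse_inclusion P = \<lparr>carrier = P, eq = (=), le = (\<lambda>Y Z. Z \<subseteq> Y)\<rparr>"

end

(* In the Q-polynomial structure, multiplication by z -> [d - dist(x,z)]_q raises the eigenspace
   index by at most one, and a descendent Y of width w has a characteristic vector supported on the
   eigenspaces of index at most d - w.  Hence, on Y, the last idempotent E_d is orthogonal to every
   product of fewer than w such functions.  Choosing the product so that it vanishes on all but two
   spheres around a vertex determines the sphere sizes of Y, shows that no vertex sees Y at w or
   fewer distances only, and, after summing over spheres, that Y is geodetically closed.

   The members of the family are then the convex hulls of pairs of vertices; joining a vertex at
   distance i to a member raises the width by i.  The members through a vertex form a projective
   geometry with [w]_q points in rank w, which gives modularity by counting, and the remaining
   axioms and parameters follow by separating a member from a vertex by a member of width d - 1. *)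

theory Submission imports Defs begin

section \<open>Graph distance\<close>

text \<open>The entries of the last idempotent are never computed. They occur with the same factors
  in two relations at a time and cancel; \<open>tight\<close> is defined so that the whole vertex
  set, with w = d, can supply one of the two. What survives involves only b_i, c_i and differences
  of [d - i]_q, and the sphere sizes of a descendent of width w come out as those of classical
  parameters (w, q, \<alpha>, \<beta>).

  The order of the argument is dictated by q, which at the start is just a real number. The nonzero
  coefficient of E_2 in E_1 \<circ> E_1 excludes q = 0 and q = -1; this makes the dual eigenvalues
  distinct, which is all that the sphere sizes require. Those sizes then show that 1 + q counts
  lines in a member of width 2, whence q >= 1. Only at that point is the sign available that the
  convexity argument needs, and convexity in turn opens the way to hulls.

  Since the order is reversed, joins of the poset are intersections, meets are hulls, rank is d
  minus width, and atoms are members of width d - 1.\<close>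

locale connected_simple_graph =
  fixes adj :: "'x::finite \<Rightarrow> 'x \<Rightarrow> bool"
  assumes simple: "simple_graph adj" and conn: "connected_graph adj"
begin

abbreviation gd :: "'x \<Rightarrow> 'x \<Rightarrow> nat" where "gd \<equiv> graph_dist adj"

lemma adj_sym: "adj x y \<Longrightarrow> adj y x"
  using simple by (auto simp: simple_graph_def dest: sympD)

lemma adj_irrefl: "\<not> adj x x"
  using simple by (auto simp: simple_graph_def irreflp_def)

lemma gd_walk: "(adj ^^ gd x y) x y"
proof -
  have "adj\<^sup>*\<^sup>* x y" using conn by (auto simp: connected_graph_def)
  then obtain n where "(adj ^^ n) x y" by (meson rtranclp_imp_relpowp)
  then show ?thesis unfolding graph_dist_def by (rule LeastI)
qed

lemma gd_le: "(adj ^^ n) x y \<Longrightarrow> gd x y \<le> n"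
  unfolding graph_dist_def by (rule Least_le)

lemma relpowp_adj_sym: "(adj ^^ n) x y \<Longrightarrow> (adj ^^ n) y x"
proof (induction n arbitrary: y)
  case (Suc n)
  then obtain z where "(adj ^^ n) x z" "adj z y" by auto
  then have "(adj ^^ n) z x" "adj y z" using Suc adj_sym by auto
  then show ?case by (metis relpowp_Suc_I2)
qed auto

lemma gd_sym: "gd x y = gd y x"
  by (meson gd_le gd_walk relpowp_adj_sym order_antisym)

lemma gd_eq_0 [simp]: "gd x y = 0 \<longleftrightarrow> x = y"
proof
  assume "gd x y = 0" then show "x = y" using gd_walk[of x y] by simp
next
  assume "x = y" then show "gd x y = 0" using gd_le[of 0 x y] by simp
qed

lemma gd_self [simp]: "gd x x = 0" by simp

lemma gd_pos [simp]: "gd x y > 0 \<longleftrightarrow> x \<noteq> y"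
  using gd_eq_0 by (metis not_gr_zero)

lemma gd_triangle: "gd x z \<le> gd x y + gd y z"
proof (rule gd_le)
  show "(adj ^^ (gd x y + gd y z)) x z"
    unfolding relpowp_add using gd_walk[of x y] gd_walk[of y z] by (rule relcomppI)
qed

lemma gd_eq_1: "gd x y = 1 \<longleftrightarrow> adj x y"
proof
  assume "gd x y = 1" then show "adj x y" using gd_walk[of x y] by (auto simp: OO_eq)
next
  assume a: "adj x y"
  then have "gd x y \<le> 1" using gd_le[of 1 x y] by (auto simp: OO_eq)
  moreover have "x \<noteq> y" using a adj_irrefl by auto
  ultimately show "gd x y = 1" by (simp add: le_Suc_eq)
qed

lemma gd_adj:
  assumes "adj y z" shows "gd x z \<le> gd x y + 1" "gd x y \<le> gd x z + 1"
  using gd_triangle[of x z y] gd_triangle[of x y z] gd_eq_1[of y z] gd_eq_1[of z y] assms adj_sym[OF assms]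
  by linarith+

lemma gd_geodesic:
  assumes "gd x y = m + n" obtains z where "gd x z = m" "gd z y = n"
proof -
  obtain z where z: "(adj ^^ m) x z" "(adj ^^ n) z y"
    using gd_walk[of x y] unfolding assms relpowp_add by (rule relcomppE)
  then have "gd x z \<le> m" "gd z y \<le> n" by (auto intro: gd_le)
  with gd_triangle[of x y z] assms show ?thesis by (intro that[of z]) auto
qed

lemma finite_gd: "finite {gd x y |x y. True}"
proof -
  have "{gd x y |x y. True} = range (\<lambda>p. gd (fst p) (snd p))" by (auto simp: image_iff) blast
  then show ?thesis by simp
qed

lemma gd_le_diam: "gd x y \<le> graph_diameter adj"
  unfolding graph_diameter_def by (rule Max_ge[OF finite_gd]) auto

lemma ex_gd_diam: obtains x y where "gd x y = graph_diameter adj"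
proof -
  have "graph_diameter adj \<in> {gd x y |x y. True}"
    unfolding graph_diameter_def using finite_gd by (rule Max_in) auto
  then show ?thesis using that by auto
qed

lemma ex_gd_eq: assumes "i \<le> graph_diameter adj" obtains x y where "gd x y = i"
proof -
  obtain x y where "gd x y = i + (graph_diameter adj - i)" using ex_gd_diam assms by auto
  then show ?thesis by (metis gd_geodesic that)
qed

end

section \<open>The Bose--Mesner algebra\<close>

lemma cscale_nth [simp]: "cscale c M $ x $ y = c * M $ x $ y"
  by (simp add: cscale_def map_matrix_def)

lemma matrix_mult_nth: "(M ** N) $ x $ y = (\<Sum>z\<in>UNIV. M $ x $ z * N $ z $ y)"
  by (simp add: matrix_matrix_mult_def)

lemma matrix_mult_diff_left: "(A - B) ** C = A ** C - B ** (C :: 'a::comm_ring_1^'p^'n)"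
  by (simp add: vec_eq_iff matrix_mult_nth left_diff_distrib sum_subtractf)

lemma matrix_mult_diff_right: "C ** (A - B) = C ** A - C ** (B :: 'a::comm_ring_1^'p^'n)"
  by (simp add: vec_eq_iff matrix_mult_nth right_diff_distrib sum_subtractf)

lemma sum_Collect_eq:
  fixes f :: "'b::finite \<Rightarrow> 'a::semiring_1"
  shows "(\<Sum>z | P z. f z) = (\<Sum>z\<in>UNIV. (if P z then 1 else 0) * f z)"
  by (simp add: if_distrib[of "\<lambda>t. t * _"] sum.If_cases cong: if_cong)

locale intersection_graph = connected_simple_graph adj for adj :: "'x::finite \<Rightarrow> 'x \<Rightarrow> bool" +
  fixes b c :: "nat \<Rightarrow> nat"
  assumes inter: "intersection_numbers adj b c"
begin

abbreviation diam :: nat where "diam \<equiv> graph_diameter adj"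

lemma card_next: "card {z. adj y z \<and> gd x z = gd x y + 1} = b (gd x y)"
  and card_prev: "card {z. adj y z \<and> gd x z + 1 = gd x y} = c (gd x y)"
  using inter by (auto simp: intersection_numbers_def)

lemma degree: "card {z. adj x z} = b 0"
proof -
  have "{z. adj x z \<and> gd x z = gd x x + 1} = {z. adj x z}"
    using gd_eq_1 by auto
  then show ?thesis using card_next[of x x] by simp
qed

lemma c_0 [simp]: "c 0 = 0"
  using card_prev[of undefined undefined] by simp

lemma c_pos: assumes "1 \<le> i" "i \<le> diam" shows "c i > 0"
proof -
  obtain x y where xy: "gd x y = (i - 1) + 1"
    using ex_gd_eq[OF assms(2)] assms(1) by (metis le_add_diff_inverse2)
  then obtain z where "gd x z = i - 1" "gd z y = 1" by (rule gd_geodesic)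
  then have "z \<in> {z. adj y z \<and> gd x z + 1 = gd x y}"
    using gd_eq_1 adj_sym xy by auto
  then show ?thesis
    using card_prev[of y x] xy assms by (metis card_gt_0_iff empty_iff finite le_add_diff_inverse2)
qed

lemma sum_neighbours:
  fixes t :: "nat \<Rightarrow> 'a::comm_ring_1"
  shows "(\<Sum>z | adj x z. t (gd y z)) =
    of_nat (c (gd y x)) * t (gd y x - 1)
    + (of_nat (b 0) - of_nat (b (gd y x)) - of_nat (c (gd y x))) * t (gd y x)
    + of_nat (b (gd y x)) * t (gd y x + 1)"
proof -
  let ?i = "gd y x"
  let ?N = "{z. adj x z \<and> gd y z = ?i + 1}" and ?C = "{z. adj x z \<and> gd y z + 1 = ?i}"
    and ?A = "{z. adj x z \<and> gd y z = ?i}"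
  have split: "{z. adj x z} = ?C \<union> ?A \<union> ?N"
  proof -
    have "gd y z + 1 = ?i \<or> gd y z = ?i \<or> gd y z = ?i + 1" if "adj x z" for z
      using gd_adj[OF that, of y] by linarith
    then show ?thesis by blast
  qed
  have d: "?C \<inter> ?A = {}" "(?C \<union> ?A) \<inter> ?N = {}" by auto
  have "card {z. adj x z} = card ?C + card ?A + card ?N"
    unfolding split
    by (simp only: card_Un_disjoint[OF finite finite d(1)] card_Un_disjoint[OF finite finite d(2)])
  then have A: "of_nat (card ?A) = (of_nat (b 0) - of_nat (b ?i) - of_nat (c ?i) :: 'a)"
    unfolding degree card_next card_prev by simp
  have "(\<Sum>z | adj x z. t (gd y z)) = (\<Sum>z\<in>?C. t (gd y z)) + (\<Sum>z\<in>?A. t (gd y z)) + (\<Sum>z\<in>?N. t (gd y z))"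
    unfolding split
    by (simp only: sum.union_disjoint[OF finite finite d(1)] sum.union_disjoint[OF finite finite d(2)])
  also have "(\<Sum>z\<in>?C. t (gd y z)) = (\<Sum>z\<in>?C. t (?i - 1))"
    by (intro sum.cong refl arg_cong[of _ _ t]) auto
  also have "(\<Sum>z\<in>?N. t (gd y z)) = (\<Sum>z\<in>?N. t (?i + 1))"
    by (rule sum.cong) auto
  also have "(\<Sum>z\<in>?A. t (gd y z)) = (\<Sum>z\<in>?A. t ?i)"
    by (rule sum.cong) auto
  finally show ?thesis using A by (simp only: sum_constant card_next card_prev)
qed

definition radial :: "('x \<Rightarrow> 'x \<Rightarrow> 'a) \<Rightarrow> bool" where
  "radial F \<longleftrightarrow> (\<exists>r. \<forall>x y. F x y = r (gd x y))"

lemma radialI: "(\<And>x y. F x y = r (gd x y)) \<Longrightarrow> radial F"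
  unfolding radial_def by blast

lemma radial_sym: "radial F \<Longrightarrow> F x y = F y x"
  unfolding radial_def using gd_sym by metis

text \<open>Only \<open>b\<close> and \<open>c\<close> are given, so closure of the Bose--Mesner
  algebra under products has to come from the recurrence c_i A_i = A_1 A_(i-1) - a_(i-1) A_(i-1) -
  b_(i-2) A_(i-2), applied to \<open>F\<close>. Multiplication by A_1 keeps a kernel radial by
  \<open>sum_neighbours\<close>, and c_i is nonzero up to the diameter.\<close>

lemma radial_sphere_sum:
  fixes F :: "'x \<Rightarrow> 'x \<Rightarrow> 'a::field_char_0"
  assumes F: "radial F"
  shows "radial (\<lambda>x y. \<Sum>z | gd x z = i. F z y)"
proof (induction i rule: less_induct)
  case (less i)
  let ?S = "\<lambda>j x y. \<Sum>z | gd x z = j. F z y"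
  show ?case
  proof (cases i)
    case 0
    then have "?S i x y = F x y" for x y by simp
    then show ?thesis using F by simp
  next
    case (Suc j)
    show ?thesis
    proof (cases "i \<le> diam")
      case False
      then have "{z. gd x z = i} = {}" for x using gd_le_diam[of x] by (metis (lifting) Collect_empty_eq)
      then show ?thesis by (intro radialI[of _ "\<lambda>_. 0"]) simp
    next
      case True
      obtain r where r: "\<And>x y. ?S j x y = r (gd x y)"
        using less[of j] Suc by (auto simp: radial_def)
      have "radial (?S (j - 1))" using less[of "j - 1"] Suc by simp
      then obtain r' where r': "\<And>x y. ?S (j - 1) x y = r' (gd x y)"
        unfolding radial_def by blast
      let ?a = "of_nat (b 0) - of_nat (b j) - of_nat (c j) :: 'a"
      have rec: "(\<Sum>u | adj x u. ?S j u y) =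
          of_nat (c i) * ?S i x y + ?a * ?S j x y
          + (if j \<ge> 1 then of_nat (b (j - 1)) * ?S (j - 1) x y else 0)" for x y
      proof -
        have "(\<Sum>u | adj x u. ?S j u y) = (\<Sum>u | adj x u. \<Sum>z\<in>UNIV. (if gd z u = j then 1 else 0) * F z y)"
          unfolding sum_Collect_eq by (intro sum.cong refl) (simp add: gd_sym)
        also have "\<dots> = (\<Sum>z\<in>UNIV. (\<Sum>u | adj x u. (if gd z u = j then 1 else 0)) * F z y)"
          by (subst sum.swap) (simp add: sum_distrib_right)
        also have "\<dots> = (\<Sum>z\<in>UNIV. (of_nat (c i) * (if gd x z = i then 1 else 0) + ?a * (if gd x z = j then 1 else 0)
              + (if j \<ge> 1 then of_nat (b (j - 1)) * (if gd x z = j - 1 then 1 else 0) else 0)) * F z y)"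
        proof (intro sum.cong refl arg_cong2[of _ _ _ _ "(*)"])
          fix z
          \<comment> \<open>Truncated subtraction allows gd z x = 0 together with j = 0; that
            spurious case is harmless because it is weighted by \<open>c 0 = 0\<close>.\<close>
          have "gd z x - 1 = j \<Longrightarrow> gd z x \<noteq> i \<Longrightarrow> gd z x = 0" using Suc by linarith
          then show "(\<Sum>u | adj x u. (if gd z u = j then 1 else 0)) = 
              of_nat (c i) * (if gd x z = i then 1 else 0) + ?a * (if gd x z = j then 1 else 0)
              + (if j \<ge> 1 then of_nat (b (j - 1)) * (if gd x z = j - 1 then 1 else 0) else 0)"
            using sum_neighbours[where t = "\<lambda>m. if m = j then 1 else 0 :: 'a" and x = x and y = z] Suc
            by (auto simp: gd_sym[of x z])
        qed
        also have "\<dots> = of_nat (c i) * ?S i x y + ?a * ?S j x y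
          + (if j \<ge> 1 then of_nat (b (j - 1)) * ?S (j - 1) x y else 0)"
          by (simp add: distrib_right sum.distrib mult.assoc sum_distrib_left[symmetric]
              if_distrib[of "\<lambda>t. t * _"] sum.If_cases cong: if_cong)
        finally show ?thesis .
      qed
      let ?r = "\<lambda>m. (of_nat (c m) * r (m - 1) + (of_nat (b 0) - of_nat (b m) - of_nat (c m)) * r m
          + of_nat (b m) * r (m + 1) - ?a * r m - (if j \<ge> 1 then of_nat (b (j - 1)) * r' m else 0)) / of_nat (c i)"
      have "?S i x y = ?r (gd x y)" for x y
      proof -
        have X: "(\<Sum>u | adj x u. r (gd u y)) = (\<Sum>u | adj x u. r (gd y u))"
          by (simp add: gd_sym)
        have "of_nat (c i) \<noteq> (0::'a)" using c_pos[of i] True Suc by simp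
        then show ?thesis
          unfolding nonzero_eq_divide_eq[OF \<open>of_nat (c i) \<noteq> (0::'a)\<close>]
          using X rec[of y x, unfolded r r'] sum_neighbours[of r y x, unfolded gd_sym[of y x]]
          by (cases "Suc 0 \<le> j") (simp_all add: eq_diff_eq mult.commute[of _ "of_nat (c i)"] ac_simps)
      qed
      then show ?thesis by (rule radialI)
    qed
  qed
qed

lemma radial_mult:
  fixes F G :: "'x \<Rightarrow> 'x \<Rightarrow> 'a::field_char_0"
  assumes "radial F" "radial G"
  shows "radial (\<lambda>x y. \<Sum>z\<in>UNIV. F x z * G z y)"
proof -
  obtain s where s: "\<And>x y. F x y = s (gd x y)" using assms by (auto simp: radial_def)
  obtain r where r: "\<And>i x y. (\<Sum>z | gd x z = i. G z y) = r i (gd x y)"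
    using radial_sphere_sum[OF assms(2)] unfolding radial_def by metis
  have "(\<Sum>z\<in>UNIV. F x z * G z y) = (\<Sum>i\<le>diam. s i * r i (gd x y))" for x y
  proof -
    have "(\<Sum>z\<in>UNIV. F x z * G z y) = (\<Sum>i\<le>diam. \<Sum>z | z \<in> UNIV \<and> gd x z = i. F x z * G z y)"
      by (rule sum.group[symmetric]) (auto simp: gd_le_diam)
    also have "\<dots> = (\<Sum>i\<le>diam. s i * r i (gd x y))"
      unfolding r[symmetric] by (intro sum.cong refl) (auto simp: s sum_distrib_left intro!: sum.cong)
    finally show ?thesis .
  qed
  then show ?thesis by (rule radialI)
qed

lemma bose_mesner_iff: "M \<in> bose_mesner adj \<longleftrightarrow> radial (\<lambda>x y. M $ x $ y)"
proof
  assume "M \<in> bose_mesner adj"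
  then obtain s where M: "M = (\<Sum>i\<le>diam. cscale (s i) (dist_matrix adj i))"
    by (auto simp: bose_mesner_def)
  have "M $ x $ y = s (gd x y)" for x y
    using gd_le_diam[of x y] by (simp add: M dist_matrix_def if_distrib cong: if_cong)
  then show "radial (\<lambda>x y. M $ x $ y)" by (rule radialI)
next
  assume "radial (\<lambda>x y. M $ x $ y)"
  then obtain s where s: "\<And>x y. M $ x $ y = s (gd x y)" by (auto simp: radial_def)
  have "M = (\<Sum>i\<le>diam. cscale (s i) (dist_matrix adj i))"
    using gd_le_diam by (simp add: vec_eq_iff s dist_matrix_def if_distrib cong: if_cong)
  then show "M \<in> bose_mesner adj" by (auto simp: bose_mesner_def)
qed

lemma bose_mesner_sym: "M \<in> bose_mesner adj \<Longrightarrow> M $ x $ y = M $ y $ x"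
  unfolding bose_mesner_iff by (rule radial_sym)

lemma bose_mesner_mult:
  "M \<in> bose_mesner adj \<Longrightarrow> N \<in> bose_mesner adj \<Longrightarrow> M ** N \<in> bose_mesner adj"
  unfolding bose_mesner_iff matrix_mult_nth by (rule radial_mult)

lemma bose_mesner_commute:
  assumes "M \<in> bose_mesner adj" "N \<in> bose_mesner adj" shows "M ** N = N ** M"
proof -
  have "(M ** N) $ y $ x = (N ** M) $ x $ y" for x y
    unfolding matrix_mult_nth
  proof (intro sum.cong refl)
    fix z show "M $ y $ z * N $ z $ x = N $ x $ z * M $ z $ y"
      using bose_mesner_sym[OF assms(1), of y z] bose_mesner_sym[OF assms(2), of z x] by simp
  qed
  then have "(M ** N) $ x $ y = (N ** M) $ x $ y" for x y
    using bose_mesner_sym[OF bose_mesner_mult[OF assms], of x y] by simp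
  then show ?thesis by (simp add: vec_eq_iff)
qed

lemma bose_mesner_diff:
  assumes "M \<in> bose_mesner adj" "N \<in> bose_mesner adj" shows "M - N \<in> bose_mesner adj"
proof -
  obtain s t where "\<And>x y. M $ x $ y = s (gd x y)" "\<And>x y. N $ x $ y = t (gd x y)"
    using assms unfolding bose_mesner_iff radial_def by metis
  then show ?thesis unfolding bose_mesner_iff by (intro radialI[of _ "\<lambda>m. s m - t m"]) simp
qed

text \<open>An idempotent of a commutative *-closed algebra is normal, hence Hermitian; being symmetric
  as well, it is real.\<close>

lemma bose_mesner_idempotent_real:
  assumes e: "e \<in> bose_mesner adj" and id: "e ** e = e"
  shows "cnj (e $ x $ y) = e $ x $ y"
proof -
  define f :: "complex^'x^'x" where "f = (\<chi> x y. cnj (e $ x $ y))"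
  have f: "f \<in> bose_mesner adj"
    using e unfolding bose_mesner_iff f_def by (auto simp: radial_def intro: exI[of _ "\<lambda>m. cnj (_ m)"])
  have ff: "f ** f = f"
  proof -
    have "(f ** f) $ x $ y = cnj ((e ** e) $ x $ y)" for x y
      by (simp add: matrix_mult_nth f_def)
    then show ?thesis by (simp add: vec_eq_iff id) (simp add: f_def)
  qed
  have ef: "e ** f = f ** e" by (rule bose_mesner_commute[OF e f])
  \<comment> \<open>\<open>n\<close> times its entrywise conjugate is (e - e f)(f - f e) = 0. Since
    \<open>n\<close> is symmetric, the diagonal entries of this product are the squared norms of the
    rows of \<open>n\<close>, so n = 0.\<close>
  define n where "n = e - e ** f"
  have n: "n \<in> bose_mesner adj" unfolding n_def by (intro bose_mesner_diff bose_mesner_mult e f)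
  have cn: "(\<chi> x y. cnj (n $ x $ y)) = f - f ** e"
    by (simp add: vec_eq_iff n_def matrix_mult_nth f_def)
  have efe: "(e ** f) ** e = e ** f" by (metis ef id matrix_mul_assoc)
  have fe: "(e ** f) ** f = e ** f" by (metis ff matrix_mul_assoc)
  have "n ** (f - f ** e) = 0"
    by (simp add: n_def matrix_mult_diff_left matrix_mult_diff_right matrix_mul_assoc efe fe)
  then have "(n ** (\<chi> x y. cnj (n $ x $ y))) $ x $ x = 0" for x by (simp add: cn)
  moreover have "(n ** (\<chi> x y. cnj (n $ x $ y))) $ x $ x = (\<Sum>z\<in>UNIV. n $ x $ z * cnj (n $ x $ z))" for x
    unfolding matrix_mult_nth
  proof (intro sum.cong refl)
    fix z show "n $ x $ z * (\<chi> x y. cnj (n $ x $ y)) $ z $ x = n $ x $ z * cnj (n $ x $ z)"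
      using bose_mesner_sym[OF n, of z x] by simp
  qed
  ultimately have "(\<Sum>z\<in>UNIV. n $ x $ z * cnj (n $ x $ z)) = 0" for x by metis
  then have "(\<Sum>z\<in>UNIV. (norm (n $ x $ z))\<^sup>2) = 0" for x
    by (simp only: complex_norm_square[symmetric] of_real_sum[symmetric] of_real_eq_0_iff)
  then have "n = 0" by (simp add: vec_eq_iff sum_nonneg_eq_0_iff)
  then have 1: "e = e ** f" by (simp add: n_def)
  have "f = f ** e"
  proof -
    have "(\<chi> x y. cnj (n $ x $ y)) = 0" using \<open>n = 0\<close> by (simp add: vec_eq_iff)
    then show ?thesis using cn by simp
  qed
  then have "e = f" using 1 ef by simp
  then show ?thesis by (metis f_def vec_lambda_beta)
qed

text \<open>If g h is neither 0 nor g, then g = g h + (g - g h) splits g into two orthogonal nonzero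
  idempotents. So a nonzero product e f equals e and, by symmetry, also f.\<close>

lemma primitive_idempotents_orthogonal:
  assumes e: "primitive_idempotent (bose_mesner adj) e"
    and f: "primitive_idempotent (bose_mesner adj) f" and ne: "e \<noteq> f"
  shows "e ** f = 0"
proof (rule ccontr)
  assume nz: "e ** f \<noteq> 0"
  have *: "g ** h = g" if g: "primitive_idempotent (bose_mesner adj) g"
    and h: "primitive_idempotent (bose_mesner adj) h" and nz: "g ** h \<noteq> 0" for g h
  proof (rule ccontr)
    assume ngh: "g ** h \<noteq> g"
    have gb: "g \<in> bose_mesner adj" "g ** g = g" and hb: "h \<in> bose_mesner adj" "h ** h = h"
      using g h by (auto simp: primitive_idempotent_def)
    have c: "g ** h = h ** g" by (rule bose_mesner_commute[OF gb(1) hb(1)])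
    have ghg: "(g ** h) ** g = g ** h" by (metis c gb(2) matrix_mul_assoc)
    have ghh: "(g ** h) ** h = g ** h" by (metis hb(2) matrix_mul_assoc)
    have gg: "g ** (g ** h) = g ** h" by (metis gb(2) matrix_mul_assoc)
    have ghgh: "(g ** h) ** (g ** h) = g ** h" by (metis ghg ghh matrix_mul_assoc)
    have "g ** h \<in> bose_mesner adj" "g - g ** h \<in> bose_mesner adj"
      using gb hb by (auto intro: bose_mesner_mult bose_mesner_diff)
    moreover have "(g - g ** h) ** (g - g ** h) = g - g ** h"
      "(g ** h) ** (g - g ** h) = 0" "(g - g ** h) ** (g ** h) = 0"
      by (simp_all only: matrix_mult_diff_left matrix_mult_diff_right ghg gg ghgh gb(2)) simp_all
    ultimately show False
      using g nz ngh ghgh unfolding primitive_idempotent_def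
      by (metis add.commute diff_add_cancel right_minus_eq)
  qed
  have c: "e ** f = f ** e"
    using e f by (intro bose_mesner_commute) (auto simp: primitive_idempotent_def)
  have "e ** f = e" "f ** e = f" using *[OF e f nz] *[OF f e] nz c by auto
  then show False using ne c by simp
qed

end

section \<open>Dual eigenvalues and products of eigenvectors\<close>

lemma qint_0 [simp]: "qint q 0 = 0"
  and qint_1 [simp]: "qint q (Suc 0) = 1"
  by (simp_all add: qint_def)

lemma qint_Suc: "qint q (Suc n) = qint q n + q ^ n"
  by (simp add: qint_def)

lemma qint_add: "qint q (m + n) = qint q m + q ^ m * qint q n"
  by (induction n) (simp_all add: qint_Suc algebra_simps power_add)

lemma qint_geometric: "(q - 1) * qint q n = q ^ n - 1"
  by (induction n) (simp_all add: qint_Suc algebra_simps)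

text \<open>A real zero of [n]_q is a real n-th root of unity other than 1.\<close>

lemma qint_eq_0:
  assumes "qint q n = 0" "n > 0" shows "q = - 1"
proof -
  have "q ^ n = 1" using qint_geometric[of q n] assms by simp
  then have "\<bar>q\<bar> = 1"
    using assms by (metis abs_ge_zero less_irrefl power_abs power_eq_1_iff abs_one real_norm_def linorder_neqE_nat not_gr_zero)
  moreover have "q \<noteq> 1" using assms by (auto simp: qint_def)
  ultimately show ?thesis by linarith
qed

lemma qint_zero_base: "qint 0 n = (if n = 0 then 0 else 1)"
  by (induction n) (simp_all add: qint_Suc)

lemma qint_minus_one: "qint (- 1) n = (if even n then 0 else 1)"
  by (induction n) (simp_all add: qint_Suc)

lemma sum_rotate3: "(\<Sum>a\<in>A. \<Sum>z\<in>B. \<Sum>u\<in>C. f a z u) = (\<Sum>z\<in>B. \<Sum>u\<in>C. \<Sum>a\<in>A. f a z u)"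
  by (subst sum.swap) (intro sum.cong refl sum.swap)

locale classical_scheme =
  intersection_graph adj b c for adj :: "'x::finite \<Rightarrow> 'x \<Rightarrow> bool" and b c +
  fixes d :: nat and q \<alpha> \<beta> :: real and E :: "nat \<Rightarrow> complex^'x^'x"
  assumes diam_eq: "diam = d" and d_ge_2: "d \<ge> 2"
    and b_eq: "i \<le> d \<Longrightarrow> real (b i) = (qint q d - qint q i) * (\<beta> - \<alpha> * qint q i)"
    and c_eq: "i \<le> d \<Longrightarrow> real (c i) = qint q i * (1 + \<alpha> * qint q (i - 1))"
    and standard: "standard_ordering adj q E"
begin

lemma gd_le_d [simp]: "gd x y \<le> d"
  using gd_le_diam diam_eq by simp

lemma ordering: "bij_betw E {..d} {e. primitive_idempotent (bose_mesner adj) e}"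
  "E 0 = cscale (1 / of_nat CARD('x)) all_ones"
  using standard by (auto simp: standard_ordering_def Q_polynomial_def idempotent_ordering_def diam_eq)

lemma E_primitive: "i \<le> d \<Longrightarrow> primitive_idempotent (bose_mesner adj) (E i)"
  using ordering(1) by (auto simp: bij_betw_def)

lemma E_idem: "i \<le> d \<Longrightarrow> E i ** E i = E i" and E_nonzero: "i \<le> d \<Longrightarrow> E i \<noteq> 0"
  and E_bm: "i \<le> d \<Longrightarrow> E i \<in> bose_mesner adj"
  using E_primitive by (auto simp: primitive_idempotent_def)

lemma E_orthogonal: "i \<le> d \<Longrightarrow> j \<le> d \<Longrightarrow> i \<noteq> j \<Longrightarrow> E i ** E j = 0"
  using ordering(1) by (intro primitive_idempotents_orthogonal E_primitive) (auto simp: bij_betw_def inj_on_def)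

text \<open>\<open>\<epsilon> i m\<close> is the entry of \<open>E i\<close> at vertices at distance \<open>m\<close>.\<close>

definition \<epsilon> :: "nat \<Rightarrow> nat \<Rightarrow> real" where
  "\<epsilon> i m = (let p = SOME p. gd (fst p) (snd p) = m in Re (E i $ fst p $ snd p))"

lemma E_nth: assumes "i \<le> d" shows "E i $ x $ y = of_real (\<epsilon> i (gd x y))"
proof -
  define p where "p = (SOME p. gd (fst p) (snd p) = gd x y)"
  have p: "gd (fst p) (snd p) = gd x y"
    unfolding p_def by (rule someI[of _ "(x, y)"]) simp
  obtain r where r: "\<And>x y. E i $ x $ y = r (gd x y)"
    using E_bm[OF assms] unfolding bose_mesner_iff radial_def by blast
  have "cnj (E i $ x $ y) = E i $ x $ y"
    by (rule bose_mesner_idempotent_real[OF E_bm[OF assms] E_idem[OF assms]])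
  then have "E i $ x $ y = of_real (Re (E i $ x $ y))"
    by (simp add: complex_eq_iff)
  also have "E i $ x $ y = E i $ fst p $ snd p" using p r by metis
  finally show ?thesis using p r unfolding \<epsilon>_def p_def Let_def by metis
qed

lemma \<epsilon>_mult:
  assumes "i \<le> d" "j \<le> d"
  shows "(\<Sum>z\<in>UNIV. \<epsilon> i (gd x z) * \<epsilon> j (gd z y)) = (if i = j then \<epsilon> i (gd x y) else 0)"
proof -
  have "(E i ** E j) $ x $ y = (if i = j then E i $ x $ y else 0)"
    using E_idem E_orthogonal assms by auto
  then have "complex_of_real (\<Sum>z\<in>UNIV. \<epsilon> i (gd x z) * \<epsilon> j (gd z y)) = of_real (if i = j then \<epsilon> i (gd x y) else 0)"
    unfolding matrix_mult_nth E_nth[OF assms(1)] E_nth[OF assms(2)] by simp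
  then show ?thesis unfolding of_real_eq_iff .
qed

lemma \<epsilon>_0: "\<epsilon> 0 (gd x y) = 1 / CARD('x)"
proof -
  have "complex_of_real (\<epsilon> 0 (gd x y)) = of_real (1 / CARD('x))"
    unfolding E_nth[symmetric, OF le0] by (simp add: ordering(2) all_ones_def)
  then show ?thesis unfolding of_real_eq_iff .
qed

text \<open>As E_i is a real symmetric idempotent, its diagonal entry is the squared length of a
  row; if it were zero, E_i would vanish.\<close>

lemma \<epsilon>_diag: assumes "i \<le> d" shows "\<epsilon> i 0 \<noteq> 0"
proof
  assume "\<epsilon> i 0 = 0"
  then have "(\<Sum>z\<in>UNIV. \<epsilon> i (gd x z) * \<epsilon> i (gd z x)) = 0" for x
    by (simp add: \<epsilon>_mult assms)
  moreover have "\<epsilon> i (gd x z) * \<epsilon> i (gd z x) = (\<epsilon> i (gd x z))\<^sup>2" for x z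
    by (simp add: power2_eq_square gd_sym[of z x])
  ultimately have "(\<Sum>z\<in>UNIV. (\<epsilon> i (gd x z))\<^sup>2) = 0" for x by simp
  then have "\<epsilon> i (gd x z) = 0" for x z
    by (simp add: sum_nonneg_eq_0_iff)
  then have "E i = 0" by (simp add: vec_eq_iff E_nth[OF assms])
  then show False using E_nonzero assms by simp
qed

lemma three_term:
  assumes "i \<le> d"
  shows "\<exists>u v w. \<forall>x y. \<epsilon> 1 (gd x y) * \<epsilon> i (gd x y) =
    (if i = 0 then 0 else u * \<epsilon> (i - 1) (gd x y)) + v * \<epsilon> i (gd x y)
    + (if i = d then 0 else w * \<epsilon> (i + 1) (gd x y))"
proof -
  obtain a' b' c' where *: "E 1 * E i = cscale (1 / of_nat CARD('x))
           ((if i = 0 then 0 else cscale (b' (i - 1)) (E (i - 1))) +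
            cscale (a' i) (E i) +
            (if i = d then 0 else cscale (c' (i + 1)) (E (i + 1))))"
    using standard assms unfolding standard_ordering_def Q_polynomial_def Let_def diam_eq by blast
  \<comment> \<open>The scalars of \<open>Q_polynomial\<close> may be complex. All matrix entries
    being real, the relation persists with the real parts of the scalars.\<close>
  let ?n = "1 / real CARD('x)"
  have "\<epsilon> 1 (gd x y) * \<epsilon> i (gd x y) =
     (if i = 0 then 0 else ?n * Re (b' (i - 1)) * \<epsilon> (i - 1) (gd x y)) + ?n * Re (a' i) * \<epsilon> i (gd x y)
    + (if i = d then 0 else ?n * Re (c' (i + 1)) * \<epsilon> (i + 1) (gd x y))" for x y
  proof -
    have n: "1 / of_nat CARD('x) = complex_of_real ?n" by simp
    have 1: "E 1 $ x $ y = of_real (\<epsilon> 1 (gd x y))" "E i $ x $ y = of_real (\<epsilon> i (gd x y))"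
      "E (i - 1) $ x $ y = of_real (\<epsilon> (i - 1) (gd x y))"
      using assms d_ge_2 by (auto intro!: E_nth)
    have 2: "E (i + 1) $ x $ y = of_real (\<epsilon> (i + 1) (gd x y))" if "i \<noteq> d"
      using assms that by (auto intro!: E_nth)
    have "complex_of_real (\<epsilon> 1 (gd x y) * \<epsilon> i (gd x y)) = (E 1 * E i) $ x $ y"
      by (simp only: 1 times_vec_def vec_lambda_beta of_real_mult)
    also have "Re \<dots> = Re (of_real ?n * (
           ((if i = 0 then 0 else b' (i - 1) * of_real (\<epsilon> (i - 1) (gd x y))) +
            a' i * of_real (\<epsilon> i (gd x y)) +
            (if i = d then 0 else c' (i + 1) * of_real (\<epsilon> (i + 1) (gd x y))))))"
      unfolding * n using 1 2 by (cases "i = 0"; cases "i = d") (simp_all del: of_real_divide)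
    finally show ?thesis
      by (cases "i = 0"; cases "i = d") (simp_all add: distrib_left del: of_real_divide)
  qed
  then show ?thesis by blast
qed

text \<open>Unlike \<open>three_term\<close>, this keeps track of a nonzero leading coefficient,
  which is what excludes the degenerate values of q below.\<close>

lemma three_term_one:
  "\<exists>u v w. w \<noteq> 0 \<and> (\<forall>x y. E 1 $ x $ y * E 1 $ x $ y = u * E 0 $ x $ y + v * E 1 $ x $ y + w * E 2 $ x $ y)"
proof -
  obtain a' b' c' where c': "\<forall>i. 1 \<le> i \<and> i \<le> d \<longrightarrow> b' (i - 1) * c' i \<noteq> 0"
    and *: "\<forall>i\<le>d. E 1 * E i = cscale (1 / of_nat CARD('x))
           ((if i = 0 then 0 else cscale (b' (i - 1)) (E (i - 1))) +
            cscale (a' i) (E i) +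
            (if i = d then 0 else cscale (c' (i + 1)) (E (i + 1))))"
    using standard unfolding standard_ordering_def Q_polynomial_def Let_def diam_eq by blast
  let ?n = "1 / of_nat CARD('x) :: complex"
  have "E 1 $ x $ y * E 1 $ x $ y = (?n * b' 0) * E 0 $ x $ y + (?n * a' 1) * E 1 $ x $ y + (?n * c' 2) * E 2 $ x $ y" for x y
  proof -
    have "1 \<le> d" using d_ge_2 by simp
    note eq = *[rule_format, OF this]
    have "E 1 $ x $ y * E 1 $ x $ y = (E 1 * E 1) $ x $ y" by (simp add: times_vec_def)
    also have "\<dots> = (?n * b' 0) * E 0 $ x $ y + (?n * a' 1) * E 1 $ x $ y + (?n * c' 2) * E 2 $ x $ y"
      unfolding eq using d_ge_2 by (simp add: distrib_left numeral_2_eq_2)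
    finally show ?thesis .
  qed
  moreover have "?n * c' 2 \<noteq> 0" using c'[rule_format, of 2] d_ge_2 by simp
  ultimately show ?thesis by blast
qed

section \<open>The dual eigenvalues, normalised by an affine map\<close>

abbreviation s :: "nat \<Rightarrow> real" where "s m \<equiv> qint q (d - m)"

lemma \<epsilon>_1_affine: "\<exists>\<xi> \<zeta>. \<xi> \<noteq> 0 \<and> (\<forall>x y. \<epsilon> 1 (gd x y) = \<xi> * s (gd x y) + \<zeta>)"
proof -
  let ?n = "of_nat CARD('x) :: complex"
  obtain \<theta> \<xi> \<zeta> where \<theta>: "cscale ?n (E 1) = (\<Sum>i\<le>d. cscale (\<theta> i) (dist_matrix adj i))" and \<xi>: "\<xi> \<noteq> 0"
    and \<theta>_eq: "\<And>i. i \<le> d \<Longrightarrow> \<theta> i = \<xi> * of_real (s i) + \<zeta>"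
    using standard unfolding standard_ordering_def dual_eigenvalues_def diam_eq by blast
  have *: "of_real (\<epsilon> 1 (gd x y)) = (\<xi> / ?n) * of_real (s (gd x y)) + \<zeta> / ?n" for x y
  proof -
    have "?n * E 1 $ x $ y = cscale ?n (E 1) $ x $ y" by simp
    also have "\<dots> = \<theta> (gd x y)"
      unfolding \<theta> by (simp add: dist_matrix_def if_distrib cong: if_cong)
    also have "E 1 $ x $ y = of_real (\<epsilon> 1 (gd x y))" using d_ge_2 by (simp add: E_nth)
    finally show ?thesis using \<theta>_eq[of "gd x y"] by (simp add: field_simps)
  qed
  \<comment> \<open>\<open>s\<close> is 0 at distance d and 1 at distance d - 1, so these two
    distances express both complex constants through real entries of E_1.\<close>
  obtain x y where 0: "gd x y = d" using ex_gd_eq[of d] diam_eq by auto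
  obtain x' y' where 1: "gd x' y' = d - 1" using ex_gd_eq[of "d - 1"] diam_eq by auto
  have z: "\<zeta> / ?n = of_real (\<epsilon> 1 d)" using *[of x y] 0 by simp
  have "\<xi> / ?n = of_real (\<epsilon> 1 (d - 1) - \<epsilon> 1 d)" using *[of x' y'] 1 z d_ge_2 by (simp add: algebra_simps)
  then obtain \<xi>' \<zeta>' where r: "\<xi> / ?n = complex_of_real \<xi>'" "\<zeta> / ?n = of_real \<zeta>'" using z by blast
  have "complex_of_real (\<epsilon> 1 (gd x y)) = of_real (\<xi>' * s (gd x y) + \<zeta>')" for x y
    unfolding * r by simp
  then have "\<epsilon> 1 (gd x y) = \<xi>' * s (gd x y) + \<zeta>'" for x y unfolding of_real_eq_iff .
  moreover have "\<xi>' \<noteq> 0" using r(1) \<xi> by auto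
  ultimately show ?thesis by blast
qed

text \<open>If \<open>s\<close> took only the values 0 and 1, the square of an entry of E_1 would be
  affine in that entry. Then E_2, whose coefficient in E_1 \<circ> E_1 is nonzero, would be a
  combination of E_0 and E_1, and orthogonality would force E_2 = 0. For q = 0 and q = -1 every
  [n]_q is 0 or 1, so both values are ruled out.\<close>

lemma s_not_idempotent: "\<not> (\<forall>x y. s (gd x y) * s (gd x y) = s (gd x y))"
proof
  assume ss: "\<forall>x y. s (gd x y) * s (gd x y) = s (gd x y)"
  obtain \<xi> \<zeta> where \<xi>: "\<xi> \<noteq> 0" and e: "\<And>x y. \<epsilon> 1 (gd x y) = \<xi> * s (gd x y) + \<zeta>"
    using \<epsilon>_1_affine by blast
  \<comment> \<open>The possible entries of E_1 are \<zeta> and \<xi> + \<zeta>; these are the roots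
    of t^2 - p t - r.\<close>
  let ?p = "\<xi> + 2 * \<zeta>" and ?r = "- \<zeta> * (\<xi> + \<zeta>)"
  have quad: "\<epsilon> 1 (gd x y) * \<epsilon> 1 (gd x y) = ?p * \<epsilon> 1 (gd x y) + ?r" for x y
  proof -
    have "\<epsilon> 1 (gd x y) * \<epsilon> 1 (gd x y) - (?p * \<epsilon> 1 (gd x y) + ?r) = \<xi> * \<xi> * (s (gd x y) * s (gd x y) - s (gd x y))"
      unfolding e by algebra
    then show ?thesis using ss by simp
  qed
  obtain u v w where w: "w \<noteq> 0"
    and uvw: "\<And>x y. E 1 $ x $ y * E 1 $ x $ y = u * E 0 $ x $ y + v * E 1 $ x $ y + w * E 2 $ x $ y"
    using three_term_one by blast
  have le: "(0::nat) \<le> d" "1 \<le> d" "2 \<le> d" using d_ge_2 by auto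
  have const: "E 0 $ x $ y * of_nat CARD('x) = 1" for x y
    by (simp add: E_nth \<epsilon>_0)
  have E2: "w * E 2 $ x $ y = (of_real ?p - v) * E 1 $ x $ y + (of_real ?r * of_nat CARD('x) - u) * E 0 $ x $ y" for x y
  proof -
    have "E 1 $ x $ y * E 1 $ x $ y = of_real (?p * \<epsilon> 1 (gd x y) + ?r)"
      unfolding E_nth[OF le(2)] quad[symmetric] by simp
    also have "\<dots> = of_real ?p * E 1 $ x $ y + of_real ?r * (E 0 $ x $ y * of_nat CARD('x))"
      unfolding E_nth[OF le(2)] const by simp
    finally show ?thesis using uvw[of x y] by (simp add: algebra_simps)
  qed
  have "w * E 2 $ x $ y = 0" for x y
  proof -
    have "w * E 2 $ x $ y = (\<Sum>z\<in>UNIV. (w * E 2 $ x $ z) * E 2 $ z $ y)"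
      using arg_cong[OF E_idem[OF le(3)], of "\<lambda>M. M $ x $ y"]
      by (simp add: matrix_mult_nth sum_distrib_left[symmetric] mult.assoc)
    also have "\<dots> = (of_real ?p - v) * (E 1 ** E 2) $ x $ y + (of_real ?r * of_nat CARD('x) - u) * (E 0 ** E 2) $ x $ y"
      unfolding E2 matrix_mult_nth by (simp add: distrib_right sum.distrib sum_distrib_left mult.assoc)
    also have "\<dots> = 0" using E_orthogonal[OF le(2,3)] E_orthogonal[OF le(1,3)] by simp
    finally show ?thesis .
  qed
  then have "E 2 = 0" using w by (simp add: vec_eq_iff)
  then show False using E_nonzero le by auto
qed

lemma q_nonzero: "q \<noteq> 0" and q_not_minus_one: "q \<noteq> - 1"
  using s_not_idempotent by (auto simp: qint_zero_base qint_minus_one split: if_splits)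

lemma qint_nonzero: "n > 0 \<Longrightarrow> qint q n \<noteq> 0"
  using qint_eq_0 q_not_minus_one by blast

lemma s_diff: assumes "i \<le> j" "j \<le> d" shows "s i - s j = q ^ (d - j) * qint q (j - i)"
  using qint_add[of q "d - j" "j - i"] assms by simp

text \<open>Distinct values of \<open>s\<close> at distinct distances are what allows a polynomial
  in \<open>s\<close> to single out distances.\<close>

lemma s_inj: assumes "i \<le> d" "j \<le> d" "s i = s j" shows "i = j"
proof -
  have *: "False" if "i < j" "j \<le> d" "s i = s j" for i j
    using s_diff[of i j] that q_nonzero qint_nonzero[of "j - i"] by simp
  show ?thesis using *[of i j] *[of j i] assms by (metis linorder_neqE_nat)
qed

text \<open>Auxiliary to \<open>sum_\<epsilon>\<close>. The definition of primitive idempotents does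
  not say that they add up to the identity; this predicate serves to place the identity matrix in
  their span.\<close>

definition in_span :: "(nat \<Rightarrow> real) \<Rightarrow> bool" where
  "in_span f \<longleftrightarrow> (\<exists>a. \<forall>x y. f (gd x y) = (\<Sum>i\<le>d. a i * \<epsilon> i (gd x y)))"

lemma in_span_\<epsilon>: assumes "i \<le> d" shows "in_span (\<epsilon> i)"
  unfolding in_span_def
  using assms by (intro exI[of _ "\<lambda>j. if j = i then 1 else 0"]) (simp add: if_distrib[of "\<lambda>t. t * _"] cong: if_cong)

lemma in_span_add: assumes "in_span f" "in_span g" shows "in_span (\<lambda>m. f m + g m)"
proof -
  obtain a a' where "\<And>x y. f (gd x y) = (\<Sum>i\<le>d. a i * \<epsilon> i (gd x y))"
    "\<And>x y. g (gd x y) = (\<Sum>i\<le>d. a' i * \<epsilon> i (gd x y))"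
    using assms unfolding in_span_def by blast
  then show ?thesis unfolding in_span_def
    by (intro exI[of _ "\<lambda>i. a i + a' i"]) (simp add: distrib_right sum.distrib)
qed

lemma in_span_scale: assumes "in_span f" shows "in_span (\<lambda>m. t * f m)"
proof -
  obtain a where "\<And>x y. f (gd x y) = (\<Sum>i\<le>d. a i * \<epsilon> i (gd x y))"
    using assms unfolding in_span_def by blast
  then show ?thesis unfolding in_span_def
    by (intro exI[of _ "\<lambda>i. t * a i"]) (simp add: sum_distrib_left mult.assoc)
qed

lemma in_span_cong: assumes "in_span f" "\<And>x y. f (gd x y) = g (gd x y)" shows "in_span g"
  using assms unfolding in_span_def by simp

lemma in_span_zero: "in_span (\<lambda>_. 0)"
  unfolding in_span_def by (intro exI[of _ "\<lambda>_. 0"]) simp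

lemma in_span_sum: "(\<And>i. i \<in> A \<Longrightarrow> in_span (f i)) \<Longrightarrow> in_span (\<lambda>m. \<Sum>i\<in>A. f i m)"
  by (induction A rule: infinite_finite_induct) (auto intro: in_span_zero in_span_add)

lemma in_span_\<epsilon>_1_mult: assumes "in_span f" shows "in_span (\<lambda>m. \<epsilon> 1 m * f m)"
proof -
  obtain a where a: "\<And>x y. f (gd x y) = (\<Sum>i\<le>d. a i * \<epsilon> i (gd x y))"
    using assms unfolding in_span_def by blast
  have "in_span (\<lambda>m. \<epsilon> 1 m * \<epsilon> i m)" if i: "i \<le> d" for i
  proof -
    obtain u v w where *: "\<forall>x y. \<epsilon> 1 (gd x y) * \<epsilon> i (gd x y) =
      (if i = 0 then 0 else u * \<epsilon> (i - 1) (gd x y)) + v * \<epsilon> i (gd x y)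
      + (if i = d then 0 else w * \<epsilon> (i + 1) (gd x y))" using three_term[OF i] by blast
    have "in_span (\<lambda>m. (if i = 0 then 0 else u * \<epsilon> (i - 1) m) + v * \<epsilon> i m
      + (if i = d then 0 else w * \<epsilon> (i + 1) m))"
      using i d_ge_2 by (cases "i = 0"; cases "i = d")
        (auto intro!: in_span_add in_span_scale in_span_\<epsilon> in_span_zero)
    then show ?thesis by (rule in_span_cong) (simp only: *[rule_format])
  qed
  then have "in_span (\<lambda>m. \<Sum>i\<le>d. a i * (\<epsilon> 1 m * \<epsilon> i m))"
    by (intro in_span_sum in_span_scale) auto
  then show ?thesis
    by (rule in_span_cong) (simp add: a sum_distrib_left mult.left_commute)
qed

lemma in_span_const: "in_span (\<lambda>_. t)"
  using in_span_scale[OF in_span_\<epsilon>[of 0], of "t * CARD('x)"]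
  by (rule in_span_cong) (simp_all add: \<epsilon>_0)

lemma in_span_s_mult: assumes "in_span f" shows "in_span (\<lambda>m. (s m - t) * f m)"
proof -
  obtain \<xi> \<zeta> where \<xi>: "\<xi> \<noteq> 0" and e: "\<And>x y. \<epsilon> 1 (gd x y) = \<xi> * s (gd x y) + \<zeta>"
    using \<epsilon>_1_affine by blast
  have "in_span (\<lambda>m. (1 / \<xi>) * (\<epsilon> 1 m * f m) + (- (\<zeta> / \<xi>) - t) * f m)"
    by (intro in_span_add in_span_scale in_span_\<epsilon>_1_mult assms)
  then show ?thesis
    by (rule in_span_cong) (use \<xi> in \<open>simp add: e field_simps del: One_nat_def\<close>)
qed

text \<open>The span contains the constants and is closed under multiplication by s - t, hence
  contains the Lagrange polynomial in \<open>s\<close> that is 1 at distance 0 and 0 at all other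
  distances, that is, the identity matrix. Multiplying the resulting expansion by E_j shows that
  each coefficient is 1.\<close>

lemma sum_\<epsilon>: "(\<Sum>i\<le>d. \<epsilon> i (gd x y)) = (if x = y then 1 else 0)"
proof -
  have "in_span (\<lambda>m. \<Prod>j\<in>K. (s m - s j))" if "finite K" for K
    using that by induction (simp_all add: in_span_const in_span_s_mult)
  from in_span_scale[OF this[of "{1..d}"], of "1 / (\<Prod>j\<in>{1..d}. (s 0 - s j))"]
  have "in_span (\<lambda>m. if m = 0 then 1 else 0)"
  proof (rule in_span_cong)
    fix x y
    have "(\<Prod>j\<in>{1..d}. (s 0 - s j)) \<noteq> 0" using s_inj[of 0] by fastforce
    moreover have "(\<Prod>j\<in>{1..d}. (s (gd x y) - s j)) = 0" if "gd x y \<noteq> 0"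
      using that gd_le_d[of x y] by (intro prod_zero bexI[of _ "gd x y"]) (auto simp: Suc_le_eq)
    ultimately show "1 / (\<Prod>j\<in>{1..d}. (s 0 - s j)) * (\<Prod>j\<in>{1..d}. (s (gd x y) - s j)) = (if gd x y = 0 then 1 else 0)"
      by auto
  qed simp
  then obtain a where a: "\<And>x y. (if x = y then 1 else 0) = (\<Sum>i\<le>d. a i * \<epsilon> i (gd x y))"
    unfolding in_span_def by auto
  have "a j = 1" if j: "j \<le> d" for j
  proof -
    let ?x = "undefined :: 'x"
    have "\<epsilon> j 0 = (\<Sum>z\<in>UNIV. (if ?x = z then 1 else 0) * \<epsilon> j (gd z ?x))"
      by (simp add: if_distrib[of "\<lambda>t. t * _"] cong: if_cong)
    also have "\<dots> = (\<Sum>i\<le>d. a i * (\<Sum>z\<in>UNIV. \<epsilon> i (gd ?x z) * \<epsilon> j (gd z ?x)))"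
      unfolding a sum_distrib_right sum_distrib_left by (subst sum.swap) (simp add: mult.assoc)
    also have "\<dots> = a j * \<epsilon> j 0"
      using j by (simp add: \<epsilon>_mult if_distrib cong: if_cong)
    finally show ?thesis using \<epsilon>_diag[OF j] by simp
  qed
  then show ?thesis using a[of x y] by simp
qed

text \<open>The Cameron--Goethals--Seidel theorem for the ordering at hand: the squares of the left-hand
  sides, summed over \<open>a\<close>, \<open>x\<close>, \<open>y\<close>, add up to the sum of the entries of \<open>E k \<circ> E 1 \<circ> E i\<close>.\<close>

lemma triple_product_vanishes:
  assumes "i + 1 < k" "k \<le> d"
  shows "(\<Sum>z\<in>UNIV. \<epsilon> k (gd a z) * (\<epsilon> 1 (gd x z) * \<epsilon> i (gd z y))) = 0"
proof -
  have le: "i \<le> d" "1 \<le> d" using assms d_ge_2 by auto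
  \<comment> \<open>Symmetry and idempotence of E_j turn a sum of squares over the free vertex into
    a quadratic form; \<open>pull\<close> is the same contraction with an extra weight that does not
    involve the summed vertex.\<close>
  have gram: "(\<Sum>y\<in>UNIV. (\<Sum>z\<in>UNIV. f z * \<epsilon> j (gd y z))\<^sup>2) = (\<Sum>z\<in>UNIV. \<Sum>u\<in>UNIV. f z * f u * \<epsilon> j (gd z u))"
    if "j \<le> d" for f j
  proof -
    have "(\<Sum>y\<in>UNIV. (\<Sum>z\<in>UNIV. f z * \<epsilon> j (gd y z))\<^sup>2)
        = (\<Sum>y\<in>UNIV. \<Sum>z\<in>UNIV. \<Sum>u\<in>UNIV. f z * f u * (\<epsilon> j (gd z y) * \<epsilon> j (gd y u)))"
      unfolding power2_eq_square sum_product by (simp add: gd_sym mult_ac)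
    also have "\<dots> = (\<Sum>z\<in>UNIV. \<Sum>u\<in>UNIV. f z * f u * \<epsilon> j (gd z u))"
      unfolding sum_rotate3 sum_distrib_left[symmetric] by (simp add: \<epsilon>_mult that)
    finally show ?thesis .
  qed
  have pull: "(\<Sum>y\<in>UNIV. \<Sum>z\<in>UNIV. \<Sum>u\<in>UNIV. (\<epsilon> j (gd y z) * \<epsilon> j (gd y u)) * h z u) = (\<Sum>z\<in>UNIV. \<Sum>u\<in>UNIV. \<epsilon> j (gd z u) * h z u)"
    if "j \<le> d" for h j
  proof -
    have "(\<Sum>y\<in>UNIV. \<epsilon> j (gd y z) * \<epsilon> j (gd y u)) = \<epsilon> j (gd z u)" for z u
      using \<epsilon>_mult[OF that that, of z u] by (simp add: gd_sym)
    then show ?thesis unfolding sum_rotate3 sum_distrib_right[symmetric] by simp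
  qed
  have "(\<Sum>a\<in>UNIV. \<Sum>x\<in>UNIV. \<Sum>y\<in>UNIV. (\<Sum>z\<in>UNIV. \<epsilon> k (gd a z) * (\<epsilon> 1 (gd x z) * \<epsilon> i (gd z y)))\<^sup>2)
     = (\<Sum>a\<in>UNIV. \<Sum>x\<in>UNIV. \<Sum>y\<in>UNIV. (\<Sum>z\<in>UNIV. (\<epsilon> k (gd a z) * \<epsilon> 1 (gd x z)) * \<epsilon> i (gd y z))\<^sup>2)"
    by (simp add: gd_sym mult.assoc)
  also have "\<dots> = (\<Sum>a\<in>UNIV. \<Sum>x\<in>UNIV. \<Sum>z\<in>UNIV. \<Sum>u\<in>UNIV.
      (\<epsilon> 1 (gd x z) * \<epsilon> 1 (gd x u)) * ((\<epsilon> k (gd a z) * \<epsilon> k (gd a u)) * \<epsilon> i (gd z u)))"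
    unfolding gram[OF le(1)] by (simp add: mult_ac)
  also have "\<dots> = (\<Sum>a\<in>UNIV. \<Sum>z\<in>UNIV. \<Sum>u\<in>UNIV. (\<epsilon> k (gd a z) * \<epsilon> k (gd a u)) * (\<epsilon> 1 (gd z u) * \<epsilon> i (gd z u)))"
    unfolding pull[OF le(2)] by (simp add: mult_ac)
  also have "\<dots> = (\<Sum>z\<in>UNIV. \<Sum>u\<in>UNIV. \<epsilon> k (gd z u) * (\<epsilon> 1 (gd z u) * \<epsilon> i (gd z u)))"
    unfolding pull[OF assms(2)] ..
  also have "\<dots> = 0"
  proof -
    obtain u v w where uvw: "\<And>x y. \<epsilon> 1 (gd x y) * \<epsilon> i (gd x y) =
      (if i = 0 then 0 else u * \<epsilon> (i - 1) (gd x y)) + v * \<epsilon> i (gd x y)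
      + (if i = d then 0 else w * \<epsilon> (i + 1) (gd x y))" using three_term[OF le(1)] by blast
    have 0: "(\<Sum>t\<in>UNIV. \<epsilon> k (gd z t) * \<epsilon> j (gd z t)) = 0" if "j \<le> d" "j \<noteq> k" for z j
      using \<epsilon>_mult[of k j z z] that assms(2) by (simp add: gd_sym[of _ z])
    have "(\<Sum>t\<in>UNIV. \<epsilon> k (gd z t) * (\<epsilon> 1 (gd z t) * \<epsilon> i (gd z t))) = 0" for z
    proof -
      have "(\<Sum>t\<in>UNIV. \<epsilon> k (gd z t) * (\<epsilon> 1 (gd z t) * \<epsilon> i (gd z t))) =
        (if i = 0 then 0 else u * (\<Sum>t\<in>UNIV. \<epsilon> k (gd z t) * \<epsilon> (i - 1) (gd z t)))
        + v * (\<Sum>t\<in>UNIV. \<epsilon> k (gd z t) * \<epsilon> i (gd z t))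
        + (if i = d then 0 else w * (\<Sum>t\<in>UNIV. \<epsilon> k (gd z t) * \<epsilon> (i + 1) (gd z t)))"
        unfolding uvw by (simp add: distrib_left sum.distrib sum_distrib_left mult_ac)
      then show ?thesis using 0[of "i - 1"] 0[of i] 0[of "i + 1"] assms by simp
    qed
    then show ?thesis by simp
  qed
  finally have "(\<Sum>a\<in>UNIV. \<Sum>x\<in>UNIV. \<Sum>y\<in>UNIV. (\<Sum>z\<in>UNIV. \<epsilon> k (gd a z) * (\<epsilon> 1 (gd x z) * \<epsilon> i (gd z y)))\<^sup>2) = 0" .
  then show ?thesis by (simp add: sum_nonneg_eq_0_iff sum_nonneg)
qed

text \<open>\<open>below a v\<close>: the vector \<open>v\<close> lies in the sum of the first \<open>a + 1\<close> eigenspaces.\<close>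

definition below :: "nat \<Rightarrow> ('x \<Rightarrow> real) \<Rightarrow> bool" where
  "below a v \<longleftrightarrow> (\<forall>k x. a < k \<longrightarrow> k \<le> d \<longrightarrow> (\<Sum>z\<in>UNIV. \<epsilon> k (gd x z) * v z) = 0)"

text \<open>Expand v as the sum of its components E_i v, using \<open>sum_\<epsilon>\<close>.
  Components with i > a vanish, and \<open>triple_product_vanishes\<close> says that multiplying a
  component with i at most a by a row of E_1 leaves nothing above a + 1. Since \<open>s\<close> is
  an affine function of the entries of E_1, the same holds for s - t.\<close>

lemma below_s_mult:
  assumes v: "below a v" shows "below (a + 1) (\<lambda>z. (s (gd x z) - t) * v z)"
proof -
  obtain \<xi> \<zeta> where \<xi>: "\<xi> \<noteq> 0" and e: "\<And>x y. \<epsilon> 1 (gd x y) = \<xi> * s (gd x y) + \<zeta>"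
    using \<epsilon>_1_affine by blast
  show ?thesis unfolding below_def
  proof (intro allI impI)
    fix k y assume k: "a + 1 < k" "k \<le> d"
    have v_eq: "v z = (\<Sum>i\<le>d. \<Sum>u\<in>UNIV. \<epsilon> i (gd z u) * v u)" for z
      by (subst sum.swap) (simp add: sum_distrib_right[symmetric] sum_\<epsilon> if_distrib[of "\<lambda>t. t * _"] cong: if_cong)
    have i: "(\<Sum>z\<in>UNIV. \<epsilon> k (gd y z) * \<epsilon> 1 (gd x z) * (\<Sum>u\<in>UNIV. \<epsilon> i (gd z u) * v u)) = 0" if "i \<le> d" for i
    proof (cases "i \<le> a")
      case False
      then show ?thesis using v that unfolding below_def by simp
    next
      case True
      have "(\<Sum>z\<in>UNIV. \<epsilon> k (gd y z) * \<epsilon> 1 (gd x z) * (\<Sum>u\<in>UNIV. \<epsilon> i (gd z u) * v u))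
        = (\<Sum>u\<in>UNIV. (\<Sum>z\<in>UNIV. \<epsilon> k (gd y z) * (\<epsilon> 1 (gd x z) * \<epsilon> i (gd z u))) * v u)"
        unfolding sum_distrib_left sum_distrib_right by (subst sum.swap) (simp add: mult_ac)
      then show ?thesis using triple_product_vanishes[of i k] True k by simp
    qed
    have "(\<Sum>z\<in>UNIV. \<epsilon> k (gd y z) * \<epsilon> 1 (gd x z) * v z) = 
        (\<Sum>i\<le>d. \<Sum>z\<in>UNIV. \<epsilon> k (gd y z) * \<epsilon> 1 (gd x z) * (\<Sum>u\<in>UNIV. \<epsilon> i (gd z u) * v u))"
      by (subst v_eq) (simp only: sum_distrib_left sum.swap[of _ _ "{..d}"])
    then have 1: "(\<Sum>z\<in>UNIV. \<epsilon> k (gd y z) * \<epsilon> 1 (gd x z) * v z) = 0" using i by simp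
    have 2: "(\<Sum>z\<in>UNIV. \<epsilon> k (gd y z) * v z) = 0" using v k unfolding below_def by simp
    have "\<epsilon> k (gd y z) * ((s (gd x z) - t) * v z) =
       (1 / \<xi>) * (\<epsilon> k (gd y z) * \<epsilon> 1 (gd x z) * v z) + (- (\<zeta> / \<xi>) - t) * (\<epsilon> k (gd y z) * v z)" for z
      using \<xi> by (simp add: e field_simps del: One_nat_def)
    then have "(\<Sum>z\<in>UNIV. \<epsilon> k (gd y z) * ((s (gd x z) - t) * v z)) =
       (1 / \<xi>) * (\<Sum>z\<in>UNIV. \<epsilon> k (gd y z) * \<epsilon> 1 (gd x z) * v z) + (- (\<zeta> / \<xi>) - t) * (\<Sum>z\<in>UNIV. \<epsilon> k (gd y z) * v z)"
      by (simp only: sum.distrib sum_distrib_left)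
    then show "(\<Sum>z\<in>UNIV. \<epsilon> k (gd y z) * ((s (gd x z) - t) * v z)) = 0" using 1 2 by simp
  qed
qed

lemma below_prod:
  assumes "finite J" "below a v"
  shows "below (a + card J) (\<lambda>z. (\<Prod>j\<in>J. (s (gd (g j) z) - t j)) * v z)"
  using assms
proof induction
  case (insert j J)
  then show ?case using below_s_mult[of "a + card J" _ "g j" "t j"] by (simp add: mult.assoc)
qed simp

end

section \<open>Sphere sizes and convexity of descendents\<close>

lemma sum_two_point:
  fixes W :: "'b \<Rightarrow> 'a::comm_ring_1"
  assumes "finite M" "i \<in> M" "i' \<in> M" "i \<noteq> i'"
  shows "(\<Sum>m\<in>M. W m * (\<Prod>j\<in>M - {i, i'}. (f m - f j))) =
    W i * (\<Prod>j\<in>M - {i, i'}. (f i - f j)) + W i' * (\<Prod>j\<in>M - {i, i'}. (f i' - f j))"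
proof -
  have 0: "W m * (\<Prod>j\<in>M - {i, i'}. (f m - f j)) = 0" if "m \<in> M - {i, i'}" for m
  proof -
    have "(\<Prod>j\<in>M - {i, i'}. (f m - f j)) = 0"
      using that assms(1) by (intro prod_zero bexI[of _ m]) auto
    then show ?thesis by simp
  qed
  have "(\<Sum>m\<in>M. W m * (\<Prod>j\<in>M - {i, i'}. (f m - f j))) = (\<Sum>m\<in>{i, i'}. W m * (\<Prod>j\<in>M - {i, i'}. (f m - f j)))"
    by (rule sum.mono_neutral_right) (use assms 0 in auto)
  then show ?thesis using assms(4) by simp
qed

text \<open>Removes the entries of E_d: \<open>A\<close> and \<open>B\<close> will be such entries
  times interpolation products, common to two relations between sphere quantities.\<close>

lemma proportional:
  fixes A B :: "'a::idom"
  assumes "A * a + B * b = 0" "A * a' + B * b' = 0" "A \<noteq> 0" "B \<noteq> 0"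
  shows "a * b' = a' * b"
proof -
  have "A * (a * b' - a' * b) = (A * a + B * b) * b' - (A * a' + B * b') * b" by (simp add: algebra_simps)
  then have "A * (a * b' - a' * b) = 0" using assms by simp
  then show ?thesis using assms by simp
qed

lemma prod_shift:
  fixes f :: "nat \<Rightarrow> 'a::comm_monoid_mult"
  assumes "w \<le> n" shows "(\<Prod>j\<in>{w<..n}. f (j - 1)) * f n = f w * (\<Prod>j\<in>{w<..n}. f j)"
  using assms
proof (induction n rule: dec_induct)
  case (step n)
  have "{w<..Suc n} = insert (Suc n) {w<..n}" using step by auto
  then show ?case using step by (simp add: mult_ac)
qed simp

lemma quad_form_char_vec:
  "quad_form M (char_vec Y) = (\<Sum>x\<in>Y. \<Sum>z\<in>Y. M $ x $ z)" for Y :: "'x::finite set"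
  by (simp add: quad_form_def char_vec_def matrix_vector_mult_def
      if_distrib[of "\<lambda>t. t * _"] if_distrib[of "\<lambda>t. _ * t"] sum.If_cases cong: if_cong)

context connected_simple_graph
begin

lemma width_max_dist:
  assumes "Y \<noteq> {}"
  shows "\<forall>x\<in>Y. \<forall>y\<in>Y. gd x y \<le> width adj Y" "\<exists>x\<in>Y. \<exists>y\<in>Y. gd x y = width adj Y"
proof -
  have *: "quad_form (dist_matrix adj i) (char_vec Y) \<noteq> 0 \<longleftrightarrow> (\<exists>x\<in>Y. \<exists>y\<in>Y. gd x y = i)" for i
  proof -
    have "quad_form (dist_matrix adj i) (char_vec Y) = of_nat (\<Sum>x\<in>Y. \<Sum>z\<in>Y. if gd x z = i then 1 else 0)"
      by (simp add: quad_form_char_vec dist_matrix_def if_distrib cong: if_cong)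
    then show ?thesis by (simp only: of_nat_eq_0_iff) auto
  qed
  let ?S = "{i. i \<le> graph_diameter adj \<and> quad_form (dist_matrix adj i) (char_vec Y) \<noteq> 0}"
  have S: "finite ?S" by simp
  have in_S: "gd x y \<in> ?S" if "x \<in> Y" "y \<in> Y" for x y using that gd_le_diam * by auto
  then show "\<forall>x\<in>Y. \<forall>y\<in>Y. gd x y \<le> width adj Y" unfolding width_def using S by (auto intro: Max_ge)
  have "width adj Y \<in> ?S" unfolding width_def using S by (rule Max_in) (use in_S assms in blast)
  then show "\<exists>x\<in>Y. \<exists>y\<in>Y. gd x y = width adj Y" using * by auto
qed

definition sphere :: "'x set \<Rightarrow> 'x \<Rightarrow> nat \<Rightarrow> 'x set" where
  "sphere Y x m = {z \<in> Y. gd x z = m}"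

lemma sphere_0: "x \<in> Y \<Longrightarrow> sphere Y x 0 = {x}"
  by (auto simp: sphere_def)

lemma sum_spheres:
  fixes f :: "'x \<Rightarrow> 'a::comm_monoid_add"
  assumes "finite M" "\<And>z. z \<in> Y \<Longrightarrow> gd y z \<in> M"
  shows "(\<Sum>m\<in>M. \<Sum>z\<in>sphere Y y m. f z) = (\<Sum>z\<in>Y. f z)"
  unfolding sphere_def using assms by (intro sum.group) auto

lemma double_count_edges:
  "(\<Sum>y\<in>sphere Y x i. card {z \<in> Y. adj y z \<and> gd x z = i + 1}) =
   (\<Sum>z\<in>sphere Y x (i + 1). card {y \<in> Y. adj z y \<and> gd x y + 1 = i + 1})"
proof -
  have "(\<Sum>y\<in>sphere Y x i. card {z \<in> sphere Y x (i + 1). adj y z}) =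
   (\<Sum>z\<in>sphere Y x (i + 1). card {y \<in> sphere Y x i. adj y z})"
    by (rule sum_multicount_gen) auto
  moreover have "{z \<in> sphere Y x (i + 1). adj y z} = {z \<in> Y. adj y z \<and> gd x z = i + 1}"
    "{z \<in> sphere Y x i. adj z y} = {z \<in> Y. adj y z \<and> gd x z + 1 = i + 1}" for y
    by (auto simp: sphere_def adj_sym)
  ultimately show ?thesis by simp
qed

end

context classical_scheme
begin

text \<open>A nonempty \<open>Y\<close> of width at most \<open>w\<close> and dual width at most \<open>d - w\<close>; the whole vertex set is
  an instance with \<open>w = d\<close>.\<close>

definition tight :: "'x set \<Rightarrow> nat \<Rightarrow> bool" where
  "tight Y w \<longleftrightarrow> Y \<noteq> {} \<and> w \<le> d \<and> (\<forall>x\<in>Y. \<forall>y\<in>Y. gd x y \<le> w) \<and> below (d - w) (indicator Y)"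

lemma tight_UNIV: "tight UNIV d"
proof -
  have "(\<Sum>z\<in>UNIV. \<epsilon> k (gd x z)) = 0" if "0 < k" "k \<le> d" for k x
  proof -
    have "(\<Sum>z\<in>UNIV. \<epsilon> k (gd x z) * \<epsilon> 0 (gd z x)) = 0" using that by (simp add: \<epsilon>_mult)
    then show ?thesis by (simp add: \<epsilon>_0 sum_divide_distrib[symmetric])
  qed
  then show ?thesis by (simp add: tight_def below_def)
qed

text \<open>The dual width speaks about the quadratic form of E_k on Y. Since E_k is a real
  symmetric idempotent, that form is the squared length of E_k applied to the characteristic vector,
  so its vanishing annihilates the whole vector.\<close>

lemma tight_descendent:
  assumes "descendent adj E Y" shows "tight Y (width adj Y)"
proof -
  have Y: "Y \<noteq> {}" "width adj Y + dual_width adj E Y = d"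
    using assms by (auto simp: descendent_def diam_eq)
  have "(\<Sum>z\<in>UNIV. \<epsilon> k (gd x z) * indicator Y z) = 0" if k: "dual_width adj E Y < k" "k \<le> d" for k x
  proof -
    have "quad_form (E k) (char_vec Y) = 0"
    proof (rule ccontr)
      assume "quad_form (E k) (char_vec Y) \<noteq> 0"
      then have "k \<le> dual_width adj E Y"
        unfolding dual_width_def using k by (intro Max_ge) (auto simp: diam_eq)
      then show False using k by simp
    qed
    then have "complex_of_real (\<Sum>x\<in>Y. \<Sum>z\<in>Y. \<epsilon> k (gd x z)) = 0"
      by (simp add: quad_form_char_vec E_nth k)
    then have "(\<Sum>x\<in>Y. \<Sum>z\<in>Y. \<epsilon> k (gd x z)) = 0" unfolding of_real_eq_0_iff .
    then have "0 = (\<Sum>x\<in>Y. \<Sum>z\<in>Y. \<epsilon> k (gd x z))" by (rule sym)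
    also have "\<dots> = (\<Sum>x\<in>Y. \<Sum>z\<in>Y. \<Sum>u\<in>UNIV. \<epsilon> k (gd u x) * \<epsilon> k (gd u z))"
    proof (intro sum.cong refl)
      fix x z
      show "\<epsilon> k (gd x z) = (\<Sum>u\<in>UNIV. \<epsilon> k (gd u x) * \<epsilon> k (gd u z))"
        using \<epsilon>_mult[of k k x z] k by (simp add: gd_sym)
    qed
    also have "\<dots> = (\<Sum>u\<in>UNIV. \<Sum>x\<in>Y. \<Sum>z\<in>Y. \<epsilon> k (gd u x) * \<epsilon> k (gd u z))"
      by (rule sum_rotate3[symmetric])
    also have "\<dots> = (\<Sum>u\<in>UNIV. (\<Sum>z\<in>Y. \<epsilon> k (gd u z))\<^sup>2)"
      by (simp only: power2_eq_square sum_product)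
    finally have "(\<Sum>u\<in>UNIV. (\<Sum>z\<in>Y. \<epsilon> k (gd u z))\<^sup>2) = 0" by (rule sym)
    then have "(\<Sum>z\<in>Y. \<epsilon> k (gd x z)) = 0" by (simp add: sum_nonneg_eq_0_iff)
    then show ?thesis by (simp add: indicator_def if_distrib[of "\<lambda>t. _ * t"] sum.If_cases cong: if_cong)
  qed
  then have "below (d - width adj Y) (indicator Y)"
    unfolding below_def using Y(2) by (metis add_diff_cancel_left')
  then show ?thesis using Y width_max_dist(1)[OF Y(1)] by (simp add: tight_def)
qed

section \<open>Orthogonality to the last idempotent, sorted by spheres\<close>

abbreviation \<Phi> :: "nat \<Rightarrow> real" where "\<Phi> \<equiv> \<epsilon> d"

text \<open>The row of E_d and all factors s - s_j are centred at the same vertex \<open>y\<close>,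
  so the inner product depends on each z only through its distance from \<open>y\<close> and can be
  collected over spheres. The centre is an arbitrary vertex, inside or outside \<open>Y\<close>;
  \<open>tight_distances\<close> exploits this.\<close>

lemma below_spheres:
  assumes v: "below a v" and K: "finite K" "a + card K < d"
    and M: "finite M" "\<And>z. z \<in> Y \<Longrightarrow> gd y z \<in> M" and Y: "\<And>z. z \<notin> Y \<Longrightarrow> v z = 0"
  shows "(\<Sum>m\<in>M. \<Phi> m * (\<Sum>z\<in>sphere Y y m. v z) * (\<Prod>j\<in>K. (s m - s j))) = 0"
proof -
  have "0 = (\<Sum>z\<in>UNIV. \<Phi> (gd y z) * ((\<Prod>j\<in>K. (s (gd y z) - s j)) * v z))"
    using below_prod[OF K(1) v, of "\<lambda>_. y" s] K(2) by (simp add: below_def)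
  also have "\<dots> = (\<Sum>z\<in>Y. \<Phi> (gd y z) * ((\<Prod>j\<in>K. (s (gd y z) - s j)) * v z))"
    by (rule sum.mono_neutral_right) (use Y in auto)
  also have "\<dots> = (\<Sum>m\<in>M. \<Sum>z\<in>sphere Y y m. \<Phi> (gd y z) * ((\<Prod>j\<in>K. (s (gd y z) - s j)) * v z))"
    by (rule sum_spheres[symmetric]) (use M in auto)
  also have "\<dots> = (\<Sum>m\<in>M. \<Phi> m * (\<Sum>z\<in>sphere Y y m. v z) * (\<Prod>j\<in>K. (s m - s j)))"
    by (intro sum.cong refl) (simp add: sphere_def sum_distrib_left mult_ac)
  finally show ?thesis by simp
qed

lemma tight_spheres:
  assumes Y: "tight Y w" and K: "finite K" "card K < w"
    and M: "finite M" "\<And>z. z \<in> Y \<Longrightarrow> gd y z \<in> M"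
  shows "(\<Sum>m\<in>M. \<Phi> m * card (sphere Y y m) * (\<Prod>j\<in>K. (s m - s j))) = 0"
proof -
  have "(\<Sum>z\<in>sphere Y y m. indicator Y z) = real (card (sphere Y y m))" for m
    by (simp add: sphere_def)
  moreover have "d - w + card K < d" using Y K(2) unfolding tight_def by linarith
  ultimately show ?thesis
    using below_spheres[of "d - w" "indicator Y" K M Y y] assms by (simp add: tight_def)
qed

lemma prod_s_nonzero:
  assumes "finite K" "K \<subseteq> {..d}" "i \<le> d" "i \<notin> K" shows "(\<Prod>j\<in>K. (s i - s j)) \<noteq> 0"
  using assms s_inj[of i] by auto

lemma tight_two_point:
  assumes Y: "tight Y w" and x: "x \<in> Y" and ij: "i \<le> w" "j \<le> w" "i \<noteq> j"
  shows "\<Phi> i * (\<Prod>l\<in>{..w} - {i, j}. (s i - s l)) * card (sphere Y x i)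
    + \<Phi> j * (\<Prod>l\<in>{..w} - {i, j}. (s j - s l)) * card (sphere Y x j) = 0"
proof -
  \<comment> \<open>Dropping two of the w + 1 distances leaves w - 1 factors, the largest number
    permitted by \<open>card K < w\<close>.\<close>
  have "(\<Sum>m\<in>{..w}. \<Phi> m * card (sphere Y x m) * (\<Prod>l\<in>{..w} - {i, j}. (s m - s l))) = 0"
    by (rule tight_spheres[OF Y]) (use ij Y x in \<open>auto simp: tight_def\<close>)
  then show ?thesis
    by (subst (asm) sum_two_point) (use ij in \<open>auto simp: mult_ac\<close>)
qed

text \<open>In the two-point relation of the whole vertex set at distances 0 and m, the term at 0 is
  nonzero, since that sphere is a single vertex and the diagonal of E_d does not vanish. So the term
  at m is nonzero as well.\<close>

lemma \<Phi>_nonzero: assumes "m \<le> d" shows "\<Phi> m \<noteq> 0"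
proof (cases "m = 0")
  case False
  have "(\<Prod>l\<in>{..d} - {0, m}. (s 0 - s l)) \<noteq> 0" by (rule prod_s_nonzero) auto
  then show ?thesis
    using tight_two_point[OF tight_UNIV UNIV_I, of 0 m undefined] False assms \<epsilon>_diag[of d]
    by (auto simp: sphere_0)
qed (simp add: \<epsilon>_diag)

lemma tight_sphere_nonempty:
  assumes Y: "tight Y w" and x: "x \<in> Y" and m: "m \<le> w" shows "card (sphere Y x m) > 0"
proof (cases "m = 0")
  case False
  have "w \<le> d" using Y by (simp add: tight_def)
  then have "(\<Prod>l\<in>{..w} - {0, m}. (s 0 - s l)) \<noteq> 0" by (intro prod_s_nonzero) auto
  then show ?thesis
    using tight_two_point[OF Y x, of 0 m] False m \<epsilon>_diag[of d] x
    by (auto simp: sphere_0 intro!: gr0I)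
qed (simp add: sphere_0 x)

text \<open>If all distances from y to Y lay in M, the product over M without one distance that
  occurs would have fewer than w factors and vanish on every other sphere. The relation would then
  say that the one remaining sphere is empty.\<close>

lemma tight_distances:
  assumes Y: "tight Y w" and M: "M \<subseteq> {..d}" "card M \<le> w"
  obtains z where "z \<in> Y" "gd y z \<notin> M"
proof (rule ccontr)
  assume "\<not> thesis"
  then have *: "\<And>z. z \<in> Y \<Longrightarrow> gd y z \<in> M" using that by blast
  have fin: "finite M" using M(1) finite_subset by auto
  obtain z where z: "z \<in> Y" using Y by (auto simp: tight_def)
  let ?i = "gd y z"
  have i: "?i \<in> M" using * z by simp
  have "card (M - {?i}) < w" using i fin M(2) by (metis card_Diff1_less order_less_le_trans)
  then have "0 = (\<Sum>m\<in>M. \<Phi> m * card (sphere Y y m) * (\<Prod>l\<in>M - {?i}. (s m - s l)))"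
    using tight_spheres[OF Y _ _ fin *, of "M - {?i}"] fin by simp
  also have "\<dots> = (\<Sum>m\<in>{?i}. \<Phi> m * card (sphere Y y m) * (\<Prod>l\<in>M - {?i}. (s m - s l)))"
    by (rule sum.mono_neutral_right) (use i fin in \<open>auto intro!: prod_zero\<close>)
  finally have "card (sphere Y y ?i) = 0"
    using \<Phi>_nonzero[of ?i] prod_s_nonzero[of "M - {?i}" ?i] fin M(1) by auto
  then show False using z by (auto simp: sphere_def)
qed

text \<open>With x nearest to y, the distances from y to Y lie among the w + 1 values from gd y x to
  gd y x + w. By \<open>tight_distances\<close> the first w of them do not suffice, so the last one
  occurs.\<close>

lemma tight_farthest:
  assumes Y: "tight Y w" and x: "x \<in> Y" and near: "\<And>u. u \<in> Y \<Longrightarrow> gd y x \<le> gd y u"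
  obtains z where "z \<in> Y" "gd y z = gd y x + w"
proof -
  let ?M = "{gd y x..<gd y x + w} \<inter> {..d}"
  have "card ?M \<le> card {gd y x..<gd y x + w}" by (rule card_mono) auto
  then obtain z where z: "z \<in> Y" "gd y z \<notin> ?M"
    using tight_distances[OF Y, of ?M y] by auto
  have "gd x z \<le> w" using Y x z by (auto simp: tight_def)
  then have "gd y z = gd y x + w" using z near[of z] gd_triangle[of y z x] by auto
  then show ?thesis using that z by blast
qed

section \<open>Sphere sizes of a tight set\<close>

lemma b_eq': "i \<le> d \<Longrightarrow> real (b i) = q ^ i * qint q (d - i) * (\<beta> - \<alpha> * qint q i)"
  using qint_add[of q i "d - i"] by (simp add: b_eq)

text \<open>This is k_(i+1) c_(i+1) = k_i b_i for classical parameters (w, q, \<alpha>, \<beta>). It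
  results from dividing the two-point relation of Y at distances i, i + 1 by that of the whole
  vertex set: the entries of E_d cancel, and the surplus factors replace [d - i]_q in b_i by
  [w - i]_q.\<close>

lemma tight_sphere_ratio:
  assumes Y: "tight Y w" and x: "x \<in> Y" and i: "i < w"
  shows "card (sphere Y x (i + 1)) * real (c (i + 1)) =
    card (sphere Y x i) * (q ^ i * qint q (w - i) * (\<beta> - \<alpha> * qint q i))"
proof -
  have w: "w \<le> d" using Y by (simp add: tight_def)
  define N where "N m = real (card (sphere Y x m))" for m
  define k where "k m = real (card (sphere UNIV x m))" for m
  define Pw where "Pw m = (\<Prod>l\<in>{..w} - {i, i + 1}. (s m - s l))" for m
  \<comment> \<open>\<open>R\<close> collects the factors with l > w, which appear for the whole
    vertex set but not for \<open>Y\<close>. Each factor is a power of q times [l - m]_q, so R (i +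
    1) and R i differ by a shift of index and their ratio telescopes.\<close>
  define R where "R m = (\<Prod>l\<in>{w<..d}. (s m - s l))" for m
  have eY: "\<Phi> i * Pw i * N i + \<Phi> (i + 1) * Pw (i + 1) * N (i + 1) = 0"
    using tight_two_point[OF Y x, of i "i + 1"] i by (simp add: N_def Pw_def)
  have split: "{..d} - {i, i + 1} = ({..w} - {i, i + 1}) \<union> {w<..d}" using w i by auto
  have "(\<Prod>l\<in>{..d} - {i, i + 1}. (s m - s l)) = Pw m * R m" for m
    unfolding split Pw_def R_def by (rule prod.union_disjoint) auto
  then have eX: "\<Phi> i * Pw i * (k i * R i) + \<Phi> (i + 1) * Pw (i + 1) * (k (i + 1) * R (i + 1)) = 0"
    using tight_two_point[OF tight_UNIV UNIV_I, of i "i + 1" x] i w by (simp add: k_def mult_ac)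
  have nz: "Pw i \<noteq> 0" "Pw (i + 1) \<noteq> 0" "R i \<noteq> 0"
    unfolding Pw_def R_def by (rule prod_s_nonzero; use i w in auto)+
  have "\<Phi> i \<noteq> 0" "\<Phi> (i + 1) \<noteq> 0" using i w by (auto intro!: \<Phi>_nonzero)
  then have 1: "N i * (k (i + 1) * R (i + 1)) = k i * R i * N (i + 1)"
    using proportional[OF eY eX] nz by simp
  have R: "R m = (\<Prod>l\<in>{w<..d}. q ^ (d - l)) * (\<Prod>l\<in>{w<..d}. qint q (l - m))" if "m \<le> w" for m
    unfolding R_def prod.distrib[symmetric] using that w by (intro prod.cong refl) (auto intro!: s_diff)
  have "(\<Prod>l\<in>{w<..d}. qint q (l - (i + 1))) * qint q (d - i) = qint q (w - i) * (\<Prod>l\<in>{w<..d}. qint q (l - i))"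
    using prod_shift[OF w, of "\<lambda>l. qint q (l - i)"] by (simp add: diff_diff_add)
  then have 2: "R (i + 1) * qint q (d - i) = qint q (w - i) * R i"
    using R[of i] R[of "i + 1"] i by (simp add: mult_ac)
  have "R i * (N i * k (i + 1) * qint q (w - i)) = R i * (N (i + 1) * k i * qint q (d - i))"
  proof -
    have "R i * (N i * k (i + 1) * qint q (w - i)) = N i * k (i + 1) * (qint q (w - i) * R i)" by simp
    also have "\<dots> = (N i * (k (i + 1) * R (i + 1))) * qint q (d - i)" unfolding 2[symmetric] by simp
    also have "\<dots> = R i * (N (i + 1) * k i * qint q (d - i))" unfolding 1 by simp
    finally show ?thesis .
  qed
  then have 3: "N i * k (i + 1) * qint q (w - i) = N (i + 1) * k i * qint q (d - i)" using nz by simp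
  \<comment> \<open>Edges between consecutive spheres of the whole graph, counted from both
    ends.\<close>
  have 4: "k (i + 1) * c (i + 1) = k i * b i"
  proof -
    have "(\<Sum>y\<in>sphere UNIV x i. card {z \<in> UNIV. adj y z \<and> gd x z = i + 1}) = (\<Sum>y\<in>sphere UNIV x i. b i)"
    proof (intro sum.cong refl)
      fix y assume "y \<in> sphere UNIV x i"
      then show "card {z \<in> UNIV. adj y z \<and> gd x z = i + 1} = b i"
        using card_next[of y x] by (simp add: sphere_def)
    qed
    moreover have "(\<Sum>z\<in>sphere UNIV x (i + 1). card {y \<in> UNIV. adj z y \<and> gd x y + 1 = i + 1}) = (\<Sum>y\<in>sphere UNIV x (i + 1). c (i + 1))"
    proof (intro sum.cong refl)
      fix z assume "z \<in> sphere UNIV x (i + 1)"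
      then show "card {y \<in> UNIV. adj z y \<and> gd x y + 1 = i + 1} = c (i + 1)"
        using card_prev[of z x] by (simp add: sphere_def)
    qed
    ultimately have "card (sphere UNIV x (i + 1)) * c (i + 1) = card (sphere UNIV x i) * b i"
      using double_count_edges[of UNIV x i] by simp
    then show ?thesis unfolding k_def by (metis of_nat_mult)
  qed
  have "0 < card (sphere UNIV x i)" using tight_sphere_nonempty[OF tight_UNIV UNIV_I] i w by simp
  then have ki: "k i \<noteq> 0" unfolding k_def by linarith
  have "N i * (k i * b i) * qint q (w - i) = N (i + 1) * c (i + 1) * k i * qint q (d - i)"
    using arg_cong[OF 3, of "\<lambda>t. t * c (i + 1)"] unfolding 4[symmetric] by (simp add: mult_ac)
  then have "N i * b i * qint q (w - i) = N (i + 1) * c (i + 1) * qint q (d - i)" using ki by simp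
  then have "qint q (d - i) * (N i * (q ^ i * qint q (w - i) * (\<beta> - \<alpha> * qint q i)))
    = qint q (d - i) * (N (i + 1) * c (i + 1))"
    using b_eq'[of i] i w by (simp add: mult_ac)
  then show ?thesis using qint_nonzero[of "d - i"] i w by (simp add: N_def)
qed

lemma tight_sphere_card_const:
  assumes Y: "tight Y w" and xy: "x \<in> Y" "y \<in> Y"
  shows "card (sphere Y x m) = card (sphere Y y m)"
proof (induction m)
  case 0
  then show ?case using xy by (simp add: sphere_0)
next
  case (Suc m)
  show ?case
  proof (cases "m < w")
    case True
    then have "c (m + 1) > 0" using Y by (intro c_pos) (auto simp: tight_def diam_eq)
    moreover have "real (card (sphere Y x (m + 1))) * real (c (m + 1)) = real (card (sphere Y y (m + 1))) * real (c (m + 1))"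
      by (simp only: tight_sphere_ratio[OF Y xy(1) True] tight_sphere_ratio[OF Y xy(2) True] Suc)
    ultimately show ?thesis by simp
  next
    case False
    then have "sphere Y u (Suc m) = {}" if "u \<in> Y" for u
      using Y that by (fastforce simp: sphere_def tight_def)
    then show ?thesis using xy by simp
  qed
qed

lemma tight_valency:
  assumes Y: "tight Y w" and x: "x \<in> Y" shows "real (card (sphere Y x 1)) = qint q w * \<beta>"
proof (cases "w = 0")
  case True
  then have "sphere Y x 1 = {}" using Y x by (fastforce simp: sphere_def tight_def)
  then show ?thesis using True by simp
next
  case False
  then show ?thesis
    using tight_sphere_ratio[OF Y x, of 0] c_eq[of 1] d_ge_2 x by (simp add: sphere_0)
qed

lemma \<beta>_nonzero: "\<beta> \<noteq> 0"
  using tight_valency[OF tight_UNIV UNIV_I] tight_sphere_nonempty[OF tight_UNIV UNIV_I, of 1] d_ge_2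
  by fastforce

text \<open>\<open>tight_sphere_ratio\<close> determines all sphere sizes from w alone; for w = d
  they agree with those of the whole vertex set, so each sphere is full.\<close>

lemma tight_UNIV_unique: assumes "tight Y d" shows "Y = UNIV"
proof -
  obtain x where x: "x \<in> Y" using assms by (auto simp: tight_def)
  have "card (sphere Y x m) = card (sphere UNIV x m)" if "m \<le> d" for m
    using that
  proof (induction m)
    case 0
    then show ?case using x by (simp add: sphere_0)
  next
    case (Suc m)
    then have "c (m + 1) > 0" by (intro c_pos) (auto simp: diam_eq)
    moreover have "m < d" "card (sphere Y x m) = card (sphere UNIV x m)" using Suc by auto
    then have "real (card (sphere Y x (m + 1))) * real (c (m + 1)) = real (card (sphere UNIV x (m + 1))) * real (c (m + 1))"
      by (simp only: tight_sphere_ratio[OF assms x] tight_sphere_ratio[OF tight_UNIV UNIV_I])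
    ultimately show ?case by simp
  qed
  then have "sphere Y x m = sphere UNIV x m" if "m \<le> d" for m
    using that by (intro card_subset_eq) (auto simp: sphere_def)
  then have "sphere Y x (gd x z) = sphere UNIV x (gd x z)" for z by simp
  then have "z \<in> Y" for z by (auto simp: sphere_def)
  then show ?thesis by blast
qed

text \<open>The sums D m of s (gd x z) - s (gd x y) over the spheres around y satisfy the same
  two-point relations as N m * (s m - s 0), hence are proportional to them. Summing the
  proportionality over all m replaces the unknown D m by a sum over all of Y, which gives a
  first-moment equation for the neighbours of y.\<close>

lemma tight_weighted_neighbours:
  assumes Y: "tight Y w" and w: "1 \<le> w" and x: "x \<in> Y" and y: "y \<in> Y"
  shows "(\<Sum>z\<in>sphere Y y 1. (s (gd x z) - s (gd x y))) * (\<Sum>z\<in>Y. (s (gd y z) - s 0)) =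
    card (sphere Y y 1) * (s 1 - s 0) * (\<Sum>z\<in>Y. (s (gd x z) - s (gd x y)))"
proof -
  have wd: "w \<le> d" using Y by (simp add: tight_def)
  define D where "D m = (\<Sum>z\<in>sphere Y y m. (s (gd x z) - s (gd x y)))" for m
  define N where "N m = real (card (sphere Y y m))" for m
  have ran: "gd y z \<in> {..w}" if "z \<in> Y" for z using that Y y by (auto simp: tight_def)
  have D_prop: "D 1 * (N m * (s m - s 0)) = D m * (N 1 * (s 1 - s 0))" if m: "m \<le> w" for m
  proof -
    consider "m = 0" | "m = 1" | "2 \<le> m" by linarith
    then show ?thesis
    proof cases
      case 3
      \<comment> \<open>The weight based at x uses up one multiplication, so one factor fewer is
        available here: w - 2 instead of w - 1. This is still enough, because the weight vanishes at
        z = y and the sphere of radius 0 drops out without a factor of its own.\<close>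
      define K where "K = {1..w} - {1, m}"
      define v where "v z = (s (gd x z) - s (gd x y)) * indicator Y z" for z
      have K: "finite K" "card K + 2 = w"
        using 3 m by (auto simp: K_def card_Diff_subset)
      have "below (d - w + 1) v"
        unfolding v_def by (rule below_s_mult) (use Y in \<open>simp add: tight_def\<close>)
      moreover have v: "(\<Sum>z\<in>sphere Y y m. v z) = D m" for m
        unfolding D_def v_def by (intro sum.cong refl) (simp add: sphere_def)
      ultimately have "(\<Sum>m\<in>{..w}. \<Phi> m * D m * (\<Prod>l\<in>K. (s m - s l))) = 0"
        using below_spheres[of "d - w + 1" v K "{..w}" Y y] K wd ran by (simp add: v_def)
      moreover have "D 0 = 0" using y by (simp add: D_def sphere_0)
      moreover have "{..w} = insert 0 {1..w}" by auto
      ultimately have "(\<Sum>m\<in>{1..w}. \<Phi> m * D m * (\<Prod>l\<in>K. (s m - s l))) = 0" by simp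
      then have D: "\<Phi> 1 * (\<Prod>l\<in>K. (s 1 - s l)) * D 1 + \<Phi> m * (\<Prod>l\<in>K. (s m - s l)) * D m = 0"
        unfolding K_def by (subst (asm) sum_two_point) (use 3 m in \<open>auto simp: mult_ac\<close>)
      have "{..w} - {1, m} = insert 0 K" using 3 by (auto simp: K_def)
      moreover have "0 \<notin> K" by (simp add: K_def)
      ultimately have "(\<Prod>l\<in>{..w} - {1, m}. (s i - s l)) = (s i - s 0) * (\<Prod>l\<in>K. (s i - s l))" for i
        using K(1) by simp
      then have N: "\<Phi> 1 * (\<Prod>l\<in>K. (s 1 - s l)) * (N 1 * (s 1 - s 0)) + \<Phi> m * (\<Prod>l\<in>K. (s m - s l)) * (N m * (s m - s 0)) = 0"
        using tight_two_point[OF Y y w m] 3 by (simp add: N_def mult_ac)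
      have "(\<Prod>l\<in>K. (s 1 - s l)) \<noteq> 0" "(\<Prod>l\<in>K. (s m - s l)) \<noteq> 0"
        using K(1) by (rule prod_s_nonzero; use wd w m in \<open>auto simp: K_def\<close>)+
      moreover have "\<Phi> 1 \<noteq> 0" "\<Phi> m \<noteq> 0" using wd w m by (auto intro!: \<Phi>_nonzero)
      ultimately show ?thesis using proportional[OF D N] by (simp add: mult_ac)
    qed (auto simp: D_def sphere_0 y)
  qed
  have "D 1 * (\<Sum>z\<in>Y. (s (gd y z) - s 0)) = D 1 * (\<Sum>m\<in>{..w}. \<Sum>z\<in>sphere Y y m. (s (gd y z) - s 0))"
    by (subst sum_spheres) (use ran in auto)
  also have "\<dots> = D 1 * (\<Sum>m\<in>{..w}. N m * (s m - s 0))"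
    by (simp add: N_def sphere_def)
  also have "\<dots> = (\<Sum>m\<in>{..w}. D m) * (N 1 * (s 1 - s 0))"
    unfolding sum_distrib_left sum_distrib_right using D_prop by (intro sum.cong) auto
  also have "(\<Sum>m\<in>{..w}. D m) = (\<Sum>z\<in>Y. (s (gd x z) - s (gd x y)))"
    unfolding D_def by (rule sum_spheres) (use ran in auto)
  finally show ?thesis by (simp add: D_def N_def mult_ac)
qed

lemma tight_sum_const:
  assumes Y: "tight Y w" and xy: "x \<in> Y" "y \<in> Y"
  shows "(\<Sum>z\<in>Y. s (gd x z)) = (\<Sum>z\<in>Y. s (gd y z))"
proof -
  have "(\<Sum>z\<in>Y. s (gd u z)) = (\<Sum>m\<in>{..d}. card (sphere Y u m) * s m)" for u
  proof -
    have "(\<Sum>z\<in>Y. s (gd u z)) = (\<Sum>m\<in>{..d}. \<Sum>z\<in>sphere Y u m. s (gd u z))"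
      by (rule sum_spheres[symmetric]) auto
    then show ?thesis by (simp add: sphere_def)
  qed
  then show ?thesis using tight_sphere_card_const[OF Y xy] by simp
qed

text \<open>With \<open>C\<close> and \<open>B\<close> the numbers of neighbours of \<open>y\<close> in \<open>Y\<close> one step closer to and further
  from \<open>x\<close>, and \<open>c\<close> and \<open>b'\<close> the values for classical parameters \<open>(w, q, \<alpha>, \<beta>)\<close>, both
  \<open>q C - B\<close> and \<open>q c - b'\<close> are affine in \<open>[i]\<^sub>q\<close>, with the same value at \<open>i = 0\<close>.\<close>

lemma tight_neighbours_affine:
  assumes Y: "tight Y w" and w: "1 \<le> w" and q: "q > 0"
  shows "\<exists>\<tau>. \<forall>x\<in>Y. \<forall>y\<in>Y.
    q * (real (card {z \<in> Y. adj y z \<and> gd x z + 1 = gd x y}) - c (gd x y))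
    - (real (card {z \<in> Y. adj y z \<and> gd x z = gd x y + 1})
       - q ^ gd x y * qint q (w - gd x y) * (\<beta> - \<alpha> * qint q (gd x y)))
    = \<tau> * qint q (gd x y)"
proof -
  have wd: "w \<le> d" using Y by (simp add: tight_def)
  obtain x0 where x0: "x0 \<in> Y" using Y by (auto simp: tight_def)
  define n where "n = real (card Y)"
  define S where "S = (\<Sum>z\<in>Y. s (gd x0 z))"
  define k where "k = qint q w * \<beta>"
  \<comment> \<open>With i = gd x y, both \<open>q C - B\<close> and \<open>q c - b'\<close> will
    take the form - k q^i plus a multiple of [i]_q. The multiples are q * \<open>\<tau>1\<close>,
    found from \<open>tight_weighted_neighbours\<close>, and \<open>\<kappa>\<close>, found from the
    parameters.\<close>
  define \<kappa> where "\<kappa> = q - \<alpha> + \<alpha> * qint q w + \<beta> + k * (q - 1)"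
  define \<tau>1 where "\<tau>1 = k * (s 1 - s 0) * n / (S - n * s 0)"
  have S: "(\<Sum>z\<in>Y. (s (gd x z) - t)) = S - n * t" if "x \<in> Y" for x t
    using tight_sum_const[OF Y that x0] by (simp add: sum_subtractf S_def n_def)
  have s_pos: "s 0 - s m > 0" if "0 < m" "m \<le> d" for m
  proof -
    have "qint q m > 0"
      unfolding qint_def using q that by (intro sum_pos) auto
    then show ?thesis using s_diff[of 0 m] that q by simp
  qed
  have S_neg: "S - n * s 0 < 0"
  proof -
    have 0: "card (sphere Y x0 1) > 0" by (rule tight_sphere_nonempty[OF Y x0 w])
    then obtain z where "z \<in> sphere Y x0 1" by (metis card.empty equals0I less_irrefl)
    then have z: "z \<in> Y" "gd x0 z = 1" by (auto simp: sphere_def)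
    have "(\<Sum>z\<in>Y. s (gd x0 z)) < (\<Sum>z\<in>Y. s 0)"
    proof (rule sum_strict_mono_ex1)
      show "\<forall>u\<in>Y. s (gd x0 u) \<le> s 0"
        using s_pos gd_le_d by (metis diff_gt_0_iff_gt less_eq_real_def not_gr_zero)
      show "\<exists>u\<in>Y. s (gd x0 u) < s 0" using z s_pos[of 1] d_ge_2 by (intro bexI[of _ z]) auto
    qed simp
    then show ?thesis by (simp add: S_def n_def)
  qed
  have s01: "s 1 - s 0 = - (q ^ (d - 1))" using s_diff[of 0 1] d_ge_2 by simp
  have main: "q * (real (card {z \<in> Y. adj y z \<and> gd x z + 1 = gd x y}) - c (gd x y))
    - (real (card {z \<in> Y. adj y z \<and> gd x z = gd x y + 1})
       - q ^ gd x y * qint q (w - gd x y) * (\<beta> - \<alpha> * qint q (gd x y)))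
    = (q * \<tau>1 - \<kappa>) * qint q (gd x y)" if xy: "x \<in> Y" "y \<in> Y" for x y
  proof -
    define i where "i = gd x y"
    have iw: "i \<le> w" and id: "i \<le> d" using xy Y by (auto simp: tight_def i_def)
    define C where "C = {z \<in> Y. adj y z \<and> gd x z + 1 = i}"
    define B where "B = {z \<in> Y. adj y z \<and> gd x z = i + 1}"
    define D where "D = (\<Sum>z\<in>sphere Y y 1. (s (gd x z) - s i))"
    have k: "real (card (sphere Y y 1)) = k" unfolding k_def by (rule tight_valency[OF Y xy(2)])
    have "D * (S - n * s 0) = k * (s 1 - s 0) * (S - n * s i)"
      using tight_weighted_neighbours[OF Y w xy] unfolding S[OF xy(1)] S[OF xy(2)] k D_def i_def .
    then have D1: "D = k * (s 1 - s 0) + \<tau>1 * (s 0 - s i)"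
      using S_neg by (simp add: \<tau>1_def field_simps)
    \<comment> \<open>A neighbour closer to x changes \<open>s\<close> by q^(d - i), one further
      away by - q^(d - i - 1), the others not at all. The extra factor q avoids the exponent d - i -
      1, which would be truncated at i = d.\<close>
    have D2: "q * D = q ^ (d - i) * (q * card C - card B)"
    proof -
      have "D = (\<Sum>z\<in>C \<union> B. (s (gd x z) - s i))"
        unfolding D_def
      proof (rule sum.mono_neutral_right)
        show "C \<union> B \<subseteq> sphere Y y 1" using gd_eq_1 by (auto simp: C_def B_def sphere_def)
        show "\<forall>z\<in>sphere Y y 1 - (C \<union> B). s (gd x z) - s i = 0"
        proof
          fix z assume z: "z \<in> sphere Y y 1 - (C \<union> B)"
          then have a: "adj y z" "z \<in> Y" using gd_eq_1 by (auto simp: sphere_def)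
          then have "gd x z = i" using z gd_adj[OF a(1), of x] unfolding C_def B_def i_def[symmetric] by auto
          then show "s (gd x z) - s i = 0" by simp
        qed
      qed simp
      also have "\<dots> = (\<Sum>z\<in>C. (s (gd x z) - s i)) + (\<Sum>z\<in>B. (s (gd x z) - s i))"
        by (rule sum.union_disjoint) (auto simp: C_def B_def)
      finally have D: "D = (\<Sum>z\<in>C. (s (gd x z) - s i)) + (\<Sum>z\<in>B. (s (gd x z) - s i))" .
      have "(\<Sum>z\<in>C. (s (gd x z) - s i)) = (\<Sum>z\<in>C. q ^ (d - i))"
      proof (intro sum.cong refl)
        fix z assume "z \<in> C"
        then have "gd x z = i - 1" "i \<ge> 1" by (auto simp: C_def)
        then show "s (gd x z) - s i = q ^ (d - i)" using s_diff[of "i - 1" i] id by simp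
      qed
      then have 1: "(\<Sum>z\<in>C. (s (gd x z) - s i)) = card C * q ^ (d - i)" by simp
      have "q * (\<Sum>z\<in>B. (s (gd x z) - s i)) = (\<Sum>z\<in>B. - (q ^ (d - i)))"
        unfolding sum_distrib_left
      proof (intro sum.cong refl)
        fix z assume "z \<in> B"
        then have z: "gd x z = i + 1" by (auto simp: B_def)
        then have "i + 1 \<le> d" by (metis gd_le_d)
        then have "s (i + 1) - s i = - (q ^ (d - (i + 1)))" "q ^ (d - i) = q * q ^ (d - (i + 1))"
          using s_diff[of i "i + 1"] by (simp_all flip: power_Suc add: Suc_diff_Suc)
        then show "q * (s (gd x z) - s i) = - (q ^ (d - i))" using z by simp
      qed
      then have 2: "q * (\<Sum>z\<in>B. (s (gd x z) - s i)) = - (card B * q ^ (d - i))" by simp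
      show ?thesis unfolding D distrib_left 1 2 by (simp add: algebra_simps)
    qed
    have qd: "q ^ d = q ^ (d - i) * q ^ i" using id by (simp flip: power_add)
    have q_pred: "q * q ^ (d - 1) = q ^ d" using d_ge_2 by (simp flip: power_Suc)
    have "q * D = - k * q ^ d + q * \<tau>1 * (q ^ (d - i) * qint q i)"
      unfolding D1 s01 using s_diff[of 0 i] id by (simp add: q_pred[symmetric] algebra_simps)
    then have "q ^ (d - i) * (q * card C - card B) = q ^ (d - i) * (- k * q ^ i + q * \<tau>1 * qint q i)"
      unfolding D2 qd by (simp add: algebra_simps)
    then have 1: "q * card C - card B = - k * q ^ i + q * \<tau>1 * qint q i" using q by simp
    have qi: "q ^ i = 1 + (q - 1) * qint q i" using qint_geometric[of q i] by simp
    have c_i: "q * c i = qint q i * (q + \<alpha> * (qint q i - 1))"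
    proof (cases "i = 0")
      case False
      then have "q * qint q (i - 1) = qint q i - 1" using qint_add[of q 1 "i - 1"] by simp
      moreover have "q * c i = qint q i * (q + \<alpha> * (q * qint q (i - 1)))" using c_eq[OF id] by (simp add: algebra_simps)
      ultimately show ?thesis by simp
    qed simp
    have b_i: "q ^ i * qint q (w - i) = qint q w - qint q i"
      using qint_add[of q i "w - i"] iw by simp
    have 2: "q * c i - q ^ i * qint q (w - i) * (\<beta> - \<alpha> * qint q i) = - k * q ^ i + \<kappa> * qint q i"
      unfolding c_i b_i unfolding \<kappa>_def k_def qi by (simp add: algebra_simps)
    show ?thesis using 1 2 unfolding i_def[symmetric] C_def B_def by (simp add: algebra_simps)
  qed
  show ?thesis by (intro exI[of _ "q * \<tau>1 - \<kappa>"] ballI main)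
qed

text \<open>Summing the affine relation over the spheres of \<open>Y\<close> around \<open>x\<close> forces its slope to vanish, so
  that on average, and hence everywhere, \<open>Y\<close> contains all \<open>c i\<close> neighbours closer to \<open>x\<close>.\<close>

lemma tight_convex_step:
  assumes Y: "tight Y w" and q: "q > 0" and xy: "x \<in> Y" "y \<in> Y" and z: "adj y z" "gd x z + 1 = gd x y"
  shows "z \<in> Y"
proof -
  have w: "1 \<le> w" "w \<le> d" using Y xy z unfolding tight_def by fastforce+
  define C where "C u = card {z \<in> Y. adj u z \<and> gd x z + 1 = gd x u}" for u
  define B where "B u = card {z \<in> Y. adj u z \<and> gd x z = gd x u + 1}" for u
  define N where "N i = real (card (sphere Y x i))" for i
  define b' where "b' i = q ^ i * qint q (w - i) * (\<beta> - \<alpha> * qint q i)" for i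
  define \<delta> where "\<delta> i = (\<Sum>u\<in>sphere Y x i. (real (C u) - c i))" for i
  obtain \<tau> where \<tau>: "\<And>u. u \<in> Y \<Longrightarrow> q * (real (C u) - c (gd x u)) - (real (B u) - b' (gd x u)) = \<tau> * qint q (gd x u)"
    using tight_neighbours_affine[OF Y w(1) q] xy(1) unfolding C_def B_def b'_def by blast
  \<comment> \<open>The empty sphere of radius w + 1 supplies the second boundary value of the
    recursion for \<open>\<delta>\<close>; it also extends the size ratio to i = w, where both sides
    are 0.\<close>
  have N_end: "sphere Y x (w + 1) = {}" using Y xy(1) by (fastforce simp: sphere_def tight_def)
  have ratio: "N (i + 1) * c (i + 1) = N i * b' i" if "i \<le> w" for i
  proof (cases "i = w")
    case True
    then show ?thesis using N_end by (simp add: N_def b'_def)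
  next
    case False
    then show ?thesis using tight_sphere_ratio[OF Y xy(1), of i] that by (simp add: N_def b'_def)
  qed
  have rec: "q * \<delta> i - \<delta> (i + 1) = \<tau> * qint q i * N i" if i: "i \<le> w" for i
  proof -
    have "(\<Sum>u\<in>sphere Y x i. B u) = (\<Sum>u\<in>sphere Y x (i + 1). C u)"
    proof -
      have "(\<Sum>u\<in>sphere Y x i. B u) = (\<Sum>u\<in>sphere Y x i. card {z \<in> Y. adj u z \<and> gd x z = i + 1})"
        by (intro sum.cong refl) (auto simp: B_def sphere_def)
      moreover have "(\<Sum>u\<in>sphere Y x (i + 1). C u) =
          (\<Sum>u\<in>sphere Y x (i + 1). card {z \<in> Y. adj u z \<and> gd x z + 1 = i + 1})"
        by (intro sum.cong refl) (auto simp: C_def sphere_def)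
      ultimately show ?thesis using double_count_edges[of Y x i] by simp
    qed
    then have BC: "(\<Sum>u\<in>sphere Y x i. real (B u)) = (\<Sum>u\<in>sphere Y x (i + 1). real (C u))"
      by (metis of_nat_sum)
    have "\<tau> * qint q i * N i = (\<Sum>u\<in>sphere Y x i. \<tau> * qint q (gd x u))"
      by (simp add: sphere_def N_def)
    also have "\<dots> = (\<Sum>u\<in>sphere Y x i. q * (real (C u) - c i) - (real (B u) - b' i))"
      by (intro sum.cong refl) (use \<tau> in \<open>auto simp: sphere_def\<close>)
    also have "\<dots> = q * \<delta> i - ((\<Sum>u\<in>sphere Y x i. real (B u)) - N i * b' i)"
      by (simp add: \<delta>_def sum_subtractf sum_distrib_left[symmetric] N_def)
    also have "\<dots> = q * \<delta> i - \<delta> (i + 1)"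
      unfolding BC ratio[OF i, symmetric] by (simp add: \<delta>_def sum_subtractf N_def)
    finally show ?thesis by simp
  qed
  have \<delta>_0: "\<delta> 0 = 0" using xy(1) by (simp add: \<delta>_def sphere_0 C_def)
  have \<delta>_end: "\<delta> (w + 1) = 0" unfolding \<delta>_def N_end by simp
  have qint_pos: "i > 0 \<Longrightarrow> qint q i > 0" for i
    unfolding qint_def using q by (intro sum_pos) auto
  \<comment> \<open>Dividing by - \<tau> makes the sign of \<tau> irrelevant: the rescaled sequence
    starts at 0, stays nonnegative because q > 0, and would be positive at w + 1, against the
    boundary value 0.\<close>
  have "\<tau> = 0"
  proof (rule ccontr)
    assume nz: "\<tau> \<noteq> 0"
    define \<eta> where "\<eta> i = - (\<delta> i / \<tau>)" for i
    have \<eta>: "\<eta> (i + 1) = q * \<eta> i + qint q i * N i" if "i \<le> w" for i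
      using rec[OF that] nz by (simp add: \<eta>_def field_simps)
    have nonneg: "\<eta> i \<ge> 0" if "i \<le> w" for i
      using that
    proof (induction i)
      case (Suc i)
      have "qint q i \<ge> 0" using qint_pos[of i] by (cases "i = 0") auto
      then show ?case using \<eta>[of i] Suc q by (simp add: N_def)
    qed (simp add: \<eta>_def \<delta>_0)
    have "qint q w * N w > 0"
      using qint_pos[of w] w tight_sphere_nonempty[OF Y xy(1), of w] by (simp add: N_def)
    moreover have "q * \<eta> w \<ge> 0" using nonneg[of w] q by simp
    ultimately have "\<eta> (w + 1) > 0" unfolding \<eta>[OF order.refl] by (rule add_nonneg_pos[rotated])
    then show False using \<delta>_end by (simp add: \<eta>_def)
  qed
  have \<delta>: "\<delta> i = 0" if "i \<le> w" for i
    using that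
  proof (induction i)
    case (Suc i)
    then show ?case using rec[of i] \<open>\<tau> = 0\<close> by simp
  qed (simp add: \<delta>_0)
  \<comment> \<open>No vertex has more closer neighbours in \<open>Y\<close> than the c_i it has in
    the graph, so a total deficiency of 0 over a sphere means that no vertex of the sphere misses
    any.\<close>
  have C_le: "{z \<in> Y. adj u z \<and> gd x z + 1 = gd x u} \<subseteq> {z. adj u z \<and> gd x z + 1 = gd x u}" for u
    by auto
  have le: "C u \<le> c (gd x u)" for u
    unfolding C_def card_prev[symmetric] by (rule card_mono[OF _ C_le]) simp
  have "gd x y \<le> w" using Y xy by (auto simp: tight_def)
  then have "(\<Sum>u\<in>sphere Y x (gd x y). (c (gd x y) - real (C u))) = 0"
    using \<delta>[of "gd x y"] by (simp add: \<delta>_def sum_subtractf)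
  moreover have "c (gd x y) - real (C u) \<ge> 0" if "u \<in> sphere Y x (gd x y)" for u
    using le[of u] that by (simp add: sphere_def)
  ultimately have "c (gd x y) - real (C u) = 0" if "u \<in> sphere Y x (gd x y)" for u
    using that sum_nonneg_eq_0_iff[of "sphere Y x (gd x y)" "\<lambda>u. c (gd x y) - real (C u)"] by auto
  then have "C y = c (gd x y)" using xy by (simp add: sphere_def)
  then have "{z \<in> Y. adj y z \<and> gd x z + 1 = gd x y} = {z. adj y z \<and> gd x z + 1 = gd x y}"
    unfolding C_def card_prev[symmetric] by (intro card_subset_eq[OF _ C_le]) simp_all
  then show ?thesis using z by blast
qed

lemma tight_convex:
  assumes Y: "tight Y w" and q: "q > 0" and xy: "x \<in> Y" "y \<in> Y" and z: "gd x z + gd z y = gd x y"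
  shows "z \<in> Y"
  using xy z
proof (induction "gd z y" arbitrary: y)
  case (Suc n)
  obtain u where u: "gd z u = n" "gd u y = 1" using gd_geodesic[of z y n 1] Suc by auto
  have "gd x u + 1 = gd x y"
    using gd_triangle[of x u z] gd_triangle[of x y u] u Suc by linarith
  moreover have "adj y u" using u gd_eq_1 adj_sym by auto
  ultimately have "u \<in> Y" "gd x z + gd z u = gd x u"
    using tight_convex_step[OF Y q Suc(3,4)] u Suc by auto
  then show ?case using Suc u by blast
qed simp

end

section \<open>The lattice of members\<close>

locale descendent_family =
  classical_scheme adj b c d q \<alpha> \<beta> E
  for adj :: "'x::finite \<Rightarrow> 'x \<Rightarrow> bool" and b c d q \<alpha> \<beta> E +
  fixes P :: "'x set set"
  assumes desc: "Y \<in> P \<Longrightarrow> descendent adj E Y"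
    and unique_member: "\<exists>!Y. Y \<in> P \<and> x \<in> Y \<and> y \<in> Y \<and> width adj Y = graph_dist adj x y"
    and Int_member: "Y1 \<in> P \<Longrightarrow> Y2 \<in> P \<Longrightarrow> Y1 \<inter> Y2 \<noteq> {} \<Longrightarrow> Y1 \<inter> Y2 \<in> P"
begin

abbreviation W :: "'x set \<Rightarrow> nat" where "W \<equiv> width adj"

lemma member_tight: "Y \<in> P \<Longrightarrow> tight Y (W Y)"
  using desc tight_descendent by blast

lemma member_nonempty: "Y \<in> P \<Longrightarrow> Y \<noteq> {}"
  using member_tight by (auto simp: tight_def)

lemma W_le_d: "Y \<in> P \<Longrightarrow> W Y \<le> d"
  using member_tight by (auto simp: tight_def)

lemma gd_le_W: "Y \<in> P \<Longrightarrow> x \<in> Y \<Longrightarrow> y \<in> Y \<Longrightarrow> gd x y \<le> W Y"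
  using member_tight by (auto simp: tight_def)

lemma W_attained: "Y \<in> P \<Longrightarrow> \<exists>x\<in>Y. \<exists>y\<in>Y. gd x y = W Y"
  using width_max_dist(2)[OF member_nonempty] .

lemma W_mono: assumes "Y \<in> P" "Z \<in> P" "Y \<subseteq> Z" shows "W Y \<le> W Z"
proof -
  obtain x y where "x \<in> Y" "y \<in> Y" "gd x y = W Y" using W_attained[OF assms(1)] by blast
  then show ?thesis using gd_le_W[OF assms(2), of x y] assms(3) by auto
qed

section \<open>Hulls of pairs of vertices\<close>

definition gen2 :: "'x \<Rightarrow> 'x \<Rightarrow> 'x set" where
  "gen2 x y = (THE Y. Y \<in> P \<and> x \<in> Y \<and> y \<in> Y \<and> W Y = gd x y)"

lemma gen2: "gen2 x y \<in> P" "x \<in> gen2 x y" "y \<in> gen2 x y" "W (gen2 x y) = gd x y"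
  using theI'[OF unique_member[of x y]] unfolding gen2_def by auto

lemma gen2_eqI: "Y \<in> P \<Longrightarrow> x \<in> Y \<Longrightarrow> y \<in> Y \<Longrightarrow> W Y = gd x y \<Longrightarrow> gen2 x y = Y"
  unfolding gen2_def by (rule the1_equality[OF unique_member]) simp

text \<open>The intersection of Y with the hull is a member containing x and y. Its width is
  squeezed between gd x y and the width of the hull, so by uniqueness it is the hull.\<close>

lemma gen2_least:
  assumes "Y \<in> P" "x \<in> Y" "y \<in> Y" shows "gen2 x y \<subseteq> Y"
proof -
  let ?Z = "Y \<inter> gen2 x y"
  have Z: "?Z \<in> P" using assms gen2 by (intro Int_member) auto
  have "W ?Z \<le> gd x y" using W_mono[OF Z gen2(1)[where x = x and y = y]] gen2(4) by simp
  moreover have "gd x y \<le> W ?Z" using Z assms gen2 by (intro gd_le_W) auto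
  ultimately have "gen2 x y = ?Z" using Z assms gen2 by (intro gen2_eqI) auto
  then show ?thesis by blast
qed

text \<open>A pair of vertices of Y at distance W Y also attains the width of Z, so both members are
  the unique one belonging to that pair.\<close>

lemma member_eqI: assumes "Y \<in> P" "Z \<in> P" "Y \<subseteq> Z" "W Z \<le> W Y" shows "Y = Z"
proof -
  obtain x y where xy: "x \<in> Y" "y \<in> Y" "gd x y = W Y" using W_attained assms by blast
  have "W Z = gd x y" using W_mono[OF assms(1-3)] assms(4) xy(3) by simp
  then have "gen2 x y = Z" using assms(3) xy by (intro gen2_eqI[OF assms(2)]) auto
  moreover have "gen2 x y = Y" using xy by (intro gen2_eqI[OF assms(1)]) auto
  ultimately show ?thesis by simp
qed

lemma W_strict_mono: "Y \<in> P \<Longrightarrow> Z \<in> P \<Longrightarrow> Y \<subset> Z \<Longrightarrow> W Y < W Z"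
  using member_eqI[of Y Z] by fastforce

lemma W_d: assumes "Y \<in> P" shows "W Y = d \<longleftrightarrow> Y = UNIV"
proof
  assume "W Y = d"
  then show "Y = UNIV" using tight_UNIV_unique member_tight[OF assms] by simp
next
  assume Y: "Y = UNIV"
  obtain x y where "gd x y = d" using ex_gd_diam diam_eq by auto
  then have "d \<le> W Y" using gd_le_W[OF assms, of x y] Y by simp
  then show "W Y = d" using W_le_d[OF assms] by simp
qed

lemma UNIV_member: "UNIV \<in> P"
proof -
  obtain x y where "gd x y = d" using ex_gd_diam diam_eq by auto
  then have "gen2 x y = UNIV" using W_d[OF gen2(1), of x y] gen2(4)[where x = x and y = y] by simp
  then show ?thesis using gen2(1)[where x = x and y = y] by simp
qed

lemma W_UNIV [simp]: "W UNIV = d"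
  using W_d UNIV_member by blast

lemma W_0: assumes "Y \<in> P" "x \<in> Y" shows "W Y = 0 \<longleftrightarrow> Y = {x}"
proof
  assume "W Y = 0"
  then have "y = x" if "y \<in> Y" for y using gd_le_W[of Y x y] assms that by simp
  then show "Y = {x}" using assms by blast
next
  assume "Y = {x}"
  then show "W Y = 0" using W_attained[OF assms(1)] by auto
qed

lemma singleton_member: "{x} \<in> P" and W_singleton [simp]: "W {x} = 0"
proof -
  have "gen2 x x = {x}" using W_0[OF gen2(1,2), of x x] gen2(4)[where x = x and y = x] by simp
  then show "{x} \<in> P" "W {x} = 0" using gen2(1,4)[where x = x and y = x] by simp_all
qed

section \<open>Lines through a vertex: the points of the local projective geometry\<close>

definition lines :: "'x \<Rightarrow> 'x set \<Rightarrow> 'x set set" where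
  "lines x Y = {L \<in> P. x \<in> L \<and> L \<subseteq> Y \<and> W L = 1}"

lemma line_eq_gen2: assumes "L \<in> P" "W L = 1" "x \<in> L" "y \<in> L" "x \<noteq> y" shows "L = gen2 x y"
proof -
  have "gd x y = 1" using gd_le_W[of L x y] assms by (simp add: le_Suc_eq)
  then show ?thesis using assms by (intro gen2_eqI[symmetric]) auto
qed

lemma line_gen2: "adj x y \<Longrightarrow> W (gen2 x y) = 1"
  using gen2(4) gd_eq_1 by simp

lemma line_valency: "L \<in> P \<Longrightarrow> W L = 1 \<Longrightarrow> x \<in> L \<Longrightarrow> real (card (sphere L x 1)) = \<beta>"
  using tight_valency[OF member_tight, of L x] by simp

text \<open>The neighbours of x in Y are partitioned by the lines joining them to x. Each line takes
  \<beta> of the [W Y]_q \<beta> neighbours.\<close>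

lemma card_lines: assumes Y: "Y \<in> P" "x \<in> Y" shows "real (card (lines x Y)) = qint q (W Y)"
proof -
  have "sphere Y x 1 = (\<Union>L\<in>lines x Y. sphere L x 1)"
  proof
    show "sphere Y x 1 \<subseteq> (\<Union>L\<in>lines x Y. sphere L x 1)"
    proof
      fix y assume y: "y \<in> sphere Y x 1"
      then have "gen2 x y \<in> lines x Y" "y \<in> sphere (gen2 x y) x 1"
        using gen2[where x = x and y = y] gen2_least[of Y x y] Y by (auto simp: sphere_def lines_def)
      then show "y \<in> (\<Union>L\<in>lines x Y. sphere L x 1)" by blast
    qed
  qed (auto simp: sphere_def lines_def)
  moreover have "card (\<Union>L\<in>lines x Y. sphere L x 1) = (\<Sum>L\<in>lines x Y. card (sphere L x 1))"
  proof (rule card_UN_disjoint)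
    show "\<forall>L\<in>lines x Y. \<forall>L'\<in>lines x Y. L \<noteq> L' \<longrightarrow> sphere L x 1 \<inter> sphere L' x 1 = {}"
    proof (intro ballI impI, rule ccontr)
      fix L L' assume L: "L \<in> lines x Y" "L' \<in> lines x Y" "L \<noteq> L'" "sphere L x 1 \<inter> sphere L' x 1 \<noteq> {}"
      then obtain y where y: "y \<in> L" "y \<in> L'" "gd x y = 1" by (auto simp: sphere_def)
      then have "x \<noteq> y" by auto
      with y show False using line_eq_gen2[of L x y] line_eq_gen2[of L' x y] L by (auto simp: lines_def)
    qed
  qed (auto simp: lines_def)
  ultimately have "real (card (sphere Y x 1)) = (\<Sum>L\<in>lines x Y. real (card (sphere L x 1)))" by simp
  also have "\<dots> = (\<Sum>L\<in>lines x Y. \<beta>)"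
    by (intro sum.cong refl line_valency) (auto simp: lines_def)
  finally show ?thesis using tight_valency[OF member_tight[OF Y(1)] Y(2)] \<beta>_nonzero by simp
qed

text \<open>In a member of width 2 the number of lines through a vertex is 1 + q. It is a natural
  number different from 0 and 1, as q is neither -1 nor 0.\<close>

lemma q_ge_1: "q \<ge> 1"
proof -
  obtain x y where "gd x y = 2" using ex_gd_eq[of 2] d_ge_2 diam_eq by auto
  then have "real (card (lines x (gen2 x y))) = qint q 2"
    using card_lines[OF gen2(1,2), of x y] gen2(4)[where x = x and y = y] by simp
  also have "qint q 2 = 1 + q" by (simp add: qint_Suc numeral_2_eq_2)
  finally have *: "real (card (lines x (gen2 x y))) = 1 + q" .
  then have "card (lines x (gen2 x y)) \<noteq> 0" "card (lines x (gen2 x y)) \<noteq> 1"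
    using q_not_minus_one q_nonzero by auto
  then have "card (lines x (gen2 x y)) \<ge> 2" by linarith
  then have "real (card (lines x (gen2 x y))) \<ge> real 2" by (rule of_nat_mono)
  then show ?thesis using * by simp
qed

lemma qint_less: assumes "m < n" shows "qint q m < qint q n"
proof -
  have "qint q (n - m) > 0" unfolding qint_def using q_ge_1 assms by (intro sum_pos) (auto simp: lessThan_empty_iff)
  then show ?thesis using qint_add[of q m "n - m"] q_ge_1 assms by simp
qed

lemma qint_le_iff: "qint q m \<le> qint q n \<longleftrightarrow> m \<le> n"
  using qint_less by (metis linorder_not_less order_less_imp_le order_refl nat_less_le)

lemma convex: "Y \<in> P \<Longrightarrow> x \<in> Y \<Longrightarrow> y \<in> Y \<Longrightarrow> gd x z + gd z y = gd x y \<Longrightarrow> z \<in> Y"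
  using tight_convex[OF member_tight, of Y x y z] q_ge_1 by simp

lemma \<beta>_pos: "\<beta> > 0"
proof -
  obtain x y where "gd x y = 1" using ex_gd_eq[of 1] d_ge_2 diam_eq by auto
  then have "real (card (sphere (gen2 x y) x 1)) = \<beta>"
    using gen2 by (intro line_valency) auto
  then show ?thesis using \<beta>_nonzero by linarith
qed

lemma boundary:
  assumes Y: "Y \<in> P" "x \<in> Y" and Z: "Z \<in> P" "x \<in> Z" and less: "W Y < W Z"
  obtains y where "y \<in> Z" "y \<notin> Y" "adj x y"
proof -
  have "real (card (sphere Y x 1)) < card (sphere Z x 1)"
    using tight_valency[OF member_tight] Y Z qint_less[OF less] \<beta>_pos by simp
  then have "\<not> sphere Z x 1 \<subseteq> sphere Y x 1"
    by (metis card_mono finite linorder_not_less of_nat_less_iff)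
  then show ?thesis using that gd_eq_1 by (auto simp: sphere_def)
qed

section \<open>Hulls of sets and the joining of a vertex to a member\<close>

definition gen :: "'x set \<Rightarrow> 'x set" where
  "gen A = \<Inter>{Z \<in> P. A \<subseteq> Z}"

lemma Inter_member:
  assumes "finite F" "F \<noteq> {}" "F \<subseteq> P" "x \<in> \<Inter>F" shows "\<Inter>F \<in> P"
  using assms
proof (induction F rule: finite_ne_induct)
  case (insert Y F)
  then show ?case using Int_member[of Y "\<Inter>F"] by auto
qed simp

lemma gen_member: assumes "A \<noteq> {}" shows "gen A \<in> P"
proof -
  obtain x where "x \<in> A" using assms by blast
  then show ?thesis unfolding gen_def using UNIV_member by (intro Inter_member[of _ x]) auto
qed

lemma gen_subset: "A \<subseteq> gen A"
  unfolding gen_def by blast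

lemma gen_least: "Z \<in> P \<Longrightarrow> A \<subseteq> Z \<Longrightarrow> gen A \<subseteq> Z"
  unfolding gen_def by blast

lemma gen_mono: "A \<subseteq> B \<Longrightarrow> gen A \<subseteq> gen B"
  unfolding gen_def by blast

lemma gen_eq: "Z \<in> P \<Longrightarrow> gen Z = Z"
  using gen_least gen_subset by blast

text \<open>\<open>tight_farthest\<close> gives z in Y at distance gd y x + W Y from y. Then x lies
  on a geodesic from y to z and is in the hull of y and z by convexity; moreover gd x z = W Y, so Y
  is the hull of x and z and lies in the hull of y and z.\<close>

lemma gen_insert:
  assumes Y: "Y \<in> P" and x: "x \<in> Y" and near: "\<And>u. u \<in> Y \<Longrightarrow> gd y x \<le> gd y u"
  shows "W (gen (insert y Y)) = W Y + gd y x" "\<exists>z\<in>Y. gd y z = W Y + gd y x \<and> gen (insert y Y) = gen2 y z"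
proof -
  obtain z where z: "z \<in> Y" "gd y z = gd y x + W Y"
    using tight_farthest[OF member_tight[OF Y] x near] by blast
  have "gd x z = W Y" using gd_triangle[of y z x] gd_le_W[OF Y x z(1)] z by simp
  then have "gen2 x z = Y" using Y x z by (intro gen2_eqI) auto
  moreover have "x \<in> gen2 y z"
    using gen2[where x = y and y = z] z \<open>gd x z = W Y\<close> by (intro convex[of _ y z x]) auto
  ultimately have "Y \<subseteq> gen2 y z" using gen2_least[of "gen2 y z" x z] gen2[where x = y and y = z] by simp
  then have "gen (insert y Y) \<subseteq> gen2 y z" using gen2[where x = y and y = z] by (intro gen_least) auto
  moreover have "gen2 y z \<subseteq> gen (insert y Y)"
    using z gen_subset[of "insert y Y"] by (intro gen2_least gen_member) auto
  ultimately have eq: "gen (insert y Y) = gen2 y z" by blast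
  then show "W (gen (insert y Y)) = W Y + gd y x" using z gen2(4)[where x = y and y = z] by simp
  show "\<exists>z\<in>Y. gd y z = W Y + gd y x \<and> gen (insert y Y) = gen2 y z"
    by (intro bexI[of _ z]) (simp_all add: z eq)
qed

lemma nearest: assumes "Y \<in> P" obtains x where "x \<in> Y" "\<And>u. u \<in> Y \<Longrightarrow> gd y x \<le> gd y u"
proof -
  let ?x = "arg_min_on (gd y) Y"
  have Y: "finite Y" "Y \<noteq> {}" using member_nonempty[OF assms] by auto
  show ?thesis using that[of ?x] arg_min_if_finite(1)[OF Y, of "gd y"] arg_min_least[OF Y, of _ "gd y"] by blast
qed

lemma gen_insert_adj:
  assumes "Y \<in> P" "x \<in> Y" "adj x y" "y \<notin> Y" shows "W (gen (insert y Y)) = W Y + 1"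
proof -
  have "gd y x = 1" using assms gd_eq_1 adj_sym by auto
  moreover have "1 \<le> gd y u" if "u \<in> Y" for u using that assms by (auto simp: Suc_le_eq)
  ultimately show ?thesis using gen_insert(1)[OF assms(1,2), of y] by simp
qed

text \<open>Lets a member grow inside a larger one with the width rising by exactly 1; the
  inductions on width below proceed by such steps.\<close>

lemma extend:
  assumes "Y \<in> P" "x \<in> Y" "Z \<in> P" "Y \<subset> Z"
  obtains y where "y \<in> Z" "y \<notin> Y" "adj x y" "gen (insert y Y) \<in> P" "Y \<subset> gen (insert y Y)"
    "gen (insert y Y) \<subseteq> Z" "W (gen (insert y Y)) = W Y + 1"
proof -
  have "x \<in> Z" using assms by blast
  then obtain y where y: "y \<in> Z" "y \<notin> Y" "adj x y"
    using boundary[OF assms(1,2,3)] W_strict_mono[OF assms(1,3,4)] by blast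
  have "gen (insert y Y) \<subseteq> Z" using y assms by (intro gen_least) auto
  then show ?thesis
    using that[OF y gen_member] y gen_subset[of "insert y Y"] gen_insert_adj[OF assms(1,2) y(3,2)] by blast
qed

text \<open>Enlarge B by a neighbour, lying in C but not in B, of a common vertex. The width of B
  grows by exactly 1, that of the intersection with C by at least 1, and the hull of the union is
  unchanged, so the inequality descends from the enlarged B.\<close>

lemma W_submodular:
  assumes "B \<in> P" "C \<in> P" "B \<inter> C \<noteq> {}"
  shows "W (gen (B \<union> C)) + W (B \<inter> C) \<le> W B + W C"
  using assms
proof (induction "W C - W (B \<inter> C)" arbitrary: B rule: less_induct)
  case less
  show ?case
  proof (cases "C \<subseteq> B")
    case True
    then have "B \<union> C = B" "B \<inter> C = C" by auto
    then show ?thesis using less by (simp add: gen_eq)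
  next
    case False
    have M: "B \<inter> C \<in> P" using less Int_member by auto
    obtain x where x: "x \<in> B \<inter> C" using less by blast
    have "B \<inter> C \<subset> C" using False by blast
    then obtain y where y: "y \<in> C" "y \<notin> B \<inter> C" "adj x y"
      and N: "W (gen (insert y (B \<inter> C))) = W (B \<inter> C) + 1" "gen (insert y (B \<inter> C)) \<in> P"
      using extend[OF M x less(3)] by metis
    let ?B = "gen (insert y B)"
    have B: "?B \<in> P" "W ?B = W B + 1"
      using gen_member gen_insert_adj[OF less(2), of x y] x y by auto
    have sub: "gen (insert y (B \<inter> C)) \<subseteq> ?B \<inter> C"
      using gen_least[OF less(3), of "insert y (B \<inter> C)"] gen_mono[of "insert y (B \<inter> C)" "insert y B"] y by blast
    moreover have ne: "?B \<inter> C \<noteq> {}" using gen_subset[of "insert y B"] y by blast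
    ultimately have "W (B \<inter> C) + 1 \<le> W (?B \<inter> C)"
      using W_mono[OF N(2) Int_member[OF B(1) less(3)]] N(1) by simp
    moreover have "W (?B \<inter> C) \<le> W C" using W_mono[OF Int_member[OF B(1) less(3)] less(3)] ne by blast
    moreover have "gen (?B \<union> C) = gen (B \<union> C)"
    proof
      show "gen (?B \<union> C) \<subseteq> gen (B \<union> C)"
      proof (rule gen_least)
        show "gen (B \<union> C) \<in> P" using x by (intro gen_member) auto
        show "?B \<union> C \<subseteq> gen (B \<union> C)"
          using gen_mono[of "insert y B" "B \<union> C"] gen_subset[of "B \<union> C"] y by blast
      qed
      show "gen (B \<union> C) \<subseteq> gen (?B \<union> C)"
        using gen_subset[of "insert y B"] by (intro gen_mono) auto
    qed
    moreover have "B \<inter> C \<subset> C" using y by blast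
    then have "W (B \<inter> C) < W C" by (rule W_strict_mono[OF M less(3)])
    ultimately have "W (gen (?B \<union> C)) + W (?B \<inter> C) \<le> W ?B + W C"
      by (intro less(1)[OF _ B(1) less(3) ne]) linarith
    then show ?thesis using \<open>W (B \<inter> C) + 1 \<le> W (?B \<inter> C)\<close> \<open>gen (?B \<union> C) = gen (B \<union> C)\<close> B(2) by simp
  qed
qed

lemma line_not_subset: assumes "L \<in> P" "W L = 1" "x \<in> L" "Y \<in> P" "x \<in> Y" "\<not> L \<subseteq> Y"
  obtains y where "y \<in> L" "y \<notin> Y" "adj x y" "L = gen2 x y"
proof -
  obtain y where y: "y \<in> L" "y \<notin> Y" using assms by blast
  have "x \<noteq> y" using y assms by auto
  then have L: "L = gen2 x y" using line_eq_gen2 assms y by blast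
  then have "adj x y" using gen2(4)[where x = x and y = y] assms gd_eq_1 by simp
  then show ?thesis using that y L by blast
qed

lemma gen_line:
  assumes "L \<in> P" "W L = 1" "x \<in> L" "Y \<in> P" "x \<in> Y" "\<not> L \<subseteq> Y"
  shows "W (gen (L \<union> Y)) = W Y + 1"
proof -
  obtain y where y: "y \<in> L" "y \<notin> Y" "adj x y" "L = gen2 x y" using line_not_subset[OF assms] .
  have "L \<subseteq> gen (insert y Y)"
    unfolding y(4) using gen_subset[of "insert y Y"] assms by (intro gen2_least gen_member) auto
  then have "gen (L \<union> Y) \<subseteq> gen (insert y Y)"
    using gen_subset[of "insert y Y"] by (intro gen_least gen_member) auto
  moreover have "gen (insert y Y) \<subseteq> gen (L \<union> Y)" using y by (intro gen_mono) auto
  ultimately have "gen (L \<union> Y) = gen (insert y Y)" by blast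
  then show ?thesis using gen_insert_adj[OF assms(4,5)] y by simp
qed

lemma gen_two_lines:
  assumes "L \<in> P" "W L = 1" "x \<in> L" "L' \<in> P" "W L' = 1" "x \<in> L'" "L \<noteq> L'"
  shows "W (gen (L \<union> L')) = 2"
proof -
  have "\<not> L \<subseteq> L'" using member_eqI[of L L'] assms by auto
  then show ?thesis using gen_line[of L x L'] assms by simp
qed

text \<open>The planes joining a line \<open>p \<not>\<subseteq> H\<close> of \<open>T\<close> to the lines of \<open>H\<close> pairwise meet in \<open>p\<close>, so together
  they contain \<open>1 + q [W H]\<^sub>q = [W T]\<^sub>q\<close> lines, that is, all lines of \<open>T\<close> through \<open>x\<close>.\<close>

lemma plane_meets_hyperplane:
  assumes T: "T \<in> P" "H \<in> P" "H \<subseteq> T" "W T = W H + 1" and x: "x \<in> H"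
    and p: "p \<in> lines x T" "\<not> p \<subseteq> H" and r: "r \<in> lines x T"
  shows "r = p \<or> (\<exists>h\<in>lines x H. r \<subseteq> gen (p \<union> h))"
proof -
  define f where "f h = lines x (gen (p \<union> h)) - {p}" for h
  have pP: "p \<in> P" "W p = 1" "x \<in> p" "p \<subseteq> T" using p by (auto simp: lines_def)
  have h: "h \<in> P" "W h = 1" "x \<in> h" "h \<subseteq> H" "h \<noteq> p" if "h \<in> lines x H" for h
    using that p by (auto simp: lines_def)
  have plane: "gen (p \<union> h) \<in> P" "W (gen (p \<union> h)) = 2" "p \<subseteq> gen (p \<union> h)" "h \<subseteq> gen (p \<union> h)"
    "gen (p \<union> h) \<subseteq> T" "x \<in> gen (p \<union> h)" if "h \<in> lines x H" for h
    using h[OF that] pP T gen_two_lines[of p x h] gen_subset[of "p \<union> h"] gen_least[of T "p \<union> h"]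
    by (auto intro!: gen_member)
  have plane_eq: "gen (p \<union> l) = gen (p \<union> h)" if "h \<in> lines x H" "l \<in> f h" for h l
  proof -
    have l: "l \<in> P" "W l = 1" "x \<in> l" "l \<noteq> p" "l \<subseteq> gen (p \<union> h)" using that by (auto simp: f_def lines_def)
    have "gen (p \<union> l) \<subseteq> gen (p \<union> h)" using l plane[OF that(1)] by (intro gen_least) auto
    moreover have "W (gen (p \<union> l)) = 2" using l pP by (intro gen_two_lines) auto
    moreover have "gen (p \<union> l) \<in> P" using pP by (intro gen_member) auto
    ultimately show ?thesis using plane[OF that(1)] by (intro member_eqI) auto
  qed
  have fcard: "real (card (f h)) = q" if "h \<in> lines x H" for h
  proof -
    have "p \<in> lines x (gen (p \<union> h))" using plane[OF that] pP by (simp add: lines_def)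
    then have "Suc (card (f h)) = card (lines x (gen (p \<union> h)))"
      unfolding f_def by (intro card_Suc_Diff1) auto
    then have "real (card (f h)) = real (card (lines x (gen (p \<union> h)))) - 1" by linarith
    then show ?thesis
      using card_lines[of "gen (p \<union> h)" x] plane[OF that] by (simp add: qint_Suc numeral_2_eq_2)
  qed
  \<comment> \<open>If two of the planes shared a line other than \<open>p\<close>, they would
    coincide, and this plane would be the hull of two lines of \<open>H\<close>. It would lie in
    \<open>H\<close>, although it contains \<open>p\<close>.\<close>
  have disj: "f h \<inter> f h' = {}" if hh: "h \<in> lines x H" "h' \<in> lines x H" "h \<noteq> h'" for h h'
  proof (rule ccontr)
    assume "f h \<inter> f h' \<noteq> {}"
    then have eq: "gen (p \<union> h) = gen (p \<union> h')" using plane_eq hh by blast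
    note a = h[OF hh(1)] and a' = h[OF hh(2)] and b = plane[OF hh(1)]
    have "h \<union> h' \<subseteq> gen (p \<union> h)" using b(4) plane(4)[OF hh(2)] eq by simp
    then have "gen (h \<union> h') \<subseteq> gen (p \<union> h)" by (rule gen_least[OF b(1)])
    moreover have "W (gen (h \<union> h')) = 2" by (rule gen_two_lines[OF a(1-3) a'(1-3) hh(3)])
    moreover have "gen (h \<union> h') \<in> P" using a(3) by (intro gen_member) auto
    ultimately have "gen (h \<union> h') = gen (p \<union> h)" using b(1,2) by (intro member_eqI) auto
    moreover have "gen (h \<union> h') \<subseteq> H" using a(4) a'(4) by (intro gen_least[OF T(2)]) auto
    ultimately show False using plane(3)[OF hh(1)] p by auto
  qed
  let ?U = "insert p (\<Union>h\<in>lines x H. f h)"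
  have "f h \<subseteq> lines x T" if "h \<in> lines x H" for h
    using plane(5)[OF that] unfolding f_def lines_def by blast
  then have "?U \<subseteq> lines x T" using p(1) by blast
  moreover have "card ?U = card (lines x T)"
  proof -
    have "card (\<Union>h\<in>lines x H. f h) = (\<Sum>h\<in>lines x H. card (f h))"
      using disj by (intro card_UN_disjoint) auto
    then have "real (card ?U) = 1 + (\<Sum>h\<in>lines x H. real (card (f h)))"
      by (subst card_insert_disjoint) (auto simp: f_def)
    also have "\<dots> = 1 + q * qint q (W H)" using fcard card_lines[OF T(2) x] by simp
    also have "\<dots> = qint q (W T)" using qint_add[of q 1 "W H"] T(4) by simp
    also have "\<dots> = real (card (lines x T))" using card_lines[OF T(1)] x T(3) by (simp add: subset_iff)
    finally show ?thesis by (simp only: of_nat_eq_iff)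
  qed
  ultimately have "?U = lines x T" by (intro card_subset_eq) simp_all
  then have "r \<in> ?U" using r by blast
  moreover have "r \<subseteq> gen (p \<union> h)" if "r \<in> f h" for h using that unfolding f_def lines_def by blast
  ultimately show ?thesis by blast
qed

text \<open>Let N be the hull of the section C \<inter> H and one neighbour y of x in C outside H,
  with p the line through x and y. For a line r of C through x, neither p nor inside H, the plane of
  p and r meets H in a line h, and h lies in C \<inter> H; hence r lies in the hull of p and h,
  inside N. So C has no more lines through x than N, and the line count bounds its width by W N = W
  (C \<inter> H) + 1.\<close>

lemma W_hyperplane_section:
  assumes T: "T \<in> P" "H \<in> P" "H \<subseteq> T" "W T = W H + 1" and C: "C \<in> P" "C \<subseteq> T" and x: "x \<in> H" "x \<in> C"
  shows "W C \<le> W (C \<inter> H) + 1"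
proof (cases "C \<subseteq> H")
  case True
  then show ?thesis by (simp add: inf.absorb1)
next
  case False
  have M: "C \<inter> H \<in> P" using x C T by (intro Int_member) auto
  obtain y where y: "y \<in> C" "y \<notin> C \<inter> H" "adj x y"
    and N: "gen (insert y (C \<inter> H)) \<in> P" "gen (insert y (C \<inter> H)) \<subseteq> C" "W (gen (insert y (C \<inter> H))) = W (C \<inter> H) + 1"
  proof -
    have "x \<in> C \<inter> H" "C \<inter> H \<subset> C" using x False by auto
    then show thesis using extend[OF M _ C(1)] that by metis
  qed
  define p where "p = gen2 x y"
  define N where "N = gen (insert y (C \<inter> H))"
  have yN: "y \<in> N" "C \<inter> H \<subseteq> N" using gen_subset[of "insert y (C \<inter> H)"] by (auto simp: N_def)
  have p: "p \<in> P" "W p = 1" "x \<in> p" "y \<in> p" "p \<subseteq> C" "p \<subseteq> N"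
    unfolding p_def using gen2(1-3)[where x = x and y = y] line_gen2[OF y(3)] gen2_least[OF C(1) x(2) y(1)]
      gen2_least[of N x y] N(1) yN x by (simp_all add: N_def subset_iff)
  have pT: "p \<in> lines x T" "\<not> p \<subseteq> H" using p C y by (auto simp: lines_def)
  have "lines x C \<subseteq> lines x N"
  proof
    fix r assume r: "r \<in> lines x C"
    then have rP: "r \<in> P" "W r = 1" "x \<in> r" "r \<subseteq> C" by (auto simp: lines_def)
    have "r \<subseteq> N"
    proof (cases "r = p \<or> r \<subseteq> H")
      case True
      then show ?thesis using p rP yN by auto
    next
      case False
      have "r \<in> lines x T" using rP C by (auto simp: lines_def)
      then obtain h where h: "h \<in> lines x H" "r \<subseteq> gen (p \<union> h)"
        using plane_meets_hyperplane[OF T x(1) pT] False by blast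
      then have hP: "h \<in> P" "W h = 1" "x \<in> h" "h \<subseteq> H" by (auto simp: lines_def)
      have "h \<noteq> p" using hP pT by auto
      have "gen (p \<union> r) \<subseteq> gen (p \<union> h)"
        using h gen_subset[of "p \<union> h"] hP by (intro gen_least gen_member) auto
      moreover have "W (gen (p \<union> r)) = 2" "W (gen (p \<union> h)) = 2"
        using p rP hP False \<open>h \<noteq> p\<close> by (auto intro!: gen_two_lines)
      moreover have "gen (p \<union> r) \<in> P" "gen (p \<union> h) \<in> P" using p by (auto intro!: gen_member)
      ultimately have "gen (p \<union> r) = gen (p \<union> h)" by (intro member_eqI) auto
      moreover have "gen (p \<union> r) \<subseteq> C" using p rP C by (intro gen_least) auto
      ultimately have "h \<subseteq> C \<inter> H" using gen_subset[of "p \<union> h"] hP by auto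
      then have "gen (p \<union> h) \<subseteq> N" using N p yN by (intro gen_least) (auto simp: N_def)
      then show ?thesis using h by blast
    qed
    then show "r \<in> lines x N" using rP by (auto simp: lines_def)
  qed
  then have "card (lines x C) \<le> card (lines x N)" by (intro card_mono) auto
  then have "qint q (W C) \<le> qint q (W N)"
    using card_lines[OF C(1) x(2)] card_lines[of N x] N p by (auto simp: N_def)
  then show ?thesis using N by (simp add: qint_le_iff N_def)
qed

text \<open>Grow B towards T one step at a time. In each step the old B is a hyperplane of the new
  one, so by \<open>W_hyperplane_section\<close> the intersection with C gains at most 1 while W B
  gains exactly 1.\<close>

lemma W_supermodular:
  assumes "B \<in> P" "C \<in> P" "T \<in> P" "B \<subseteq> T" "C \<subseteq> T" "x \<in> B" "x \<in> C"
  shows "W B + W C \<le> W T + W (B \<inter> C)"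
  using assms
proof (induction "W T - W B" arbitrary: B rule: less_induct)
  case less
  show ?case
  proof (cases "B = T")
    case True
    then have "B \<inter> C = C" using less by auto
    then show ?thesis using True by simp
  next
    case False
    then have "B \<subset> T" using less by blast
    then obtain y where B1: "gen (insert y B) \<in> P" "B \<subset> gen (insert y B)"
      "gen (insert y B) \<subseteq> T" "W (gen (insert y B)) = W B + 1"
      using extend[OF less(2) less(7) less(4)] by metis
    let ?B = "gen (insert y B)"
    have "W ?B \<le> W T" using W_mono B1 less by blast
    then have "W ?B + W C \<le> W T + W (?B \<inter> C)" using less B1 by (intro less(1)) auto
    moreover have "?B \<inter> C \<in> P" using B1 less by (intro Int_member) auto
    then have "W (?B \<inter> C) \<le> W (?B \<inter> C \<inter> B) + 1"
      using B1 less by (intro W_hyperplane_section[of ?B _ _ x]) auto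
    moreover have "?B \<inter> C \<inter> B = B \<inter> C" using B1 by auto
    ultimately show ?thesis using B1 by simp
  qed
qed

lemma W_modular:
  assumes "B \<in> P" "C \<in> P" "B \<inter> C \<noteq> {}"
  shows "W (gen (B \<union> C)) + W (B \<inter> C) = W B + W C"
proof -
  obtain x where "x \<in> B" "x \<in> C" using assms by blast
  moreover then have "gen (B \<union> C) \<in> P" by (intro gen_member) auto
  ultimately have "W B + W C \<le> W (gen (B \<union> C)) + W (B \<inter> C)"
    using assms gen_subset[of "B \<union> C"] by (intro W_supermodular) auto
  then show ?thesis using W_submodular[OF assms] by simp
qed

text \<open>One side contains the other, and both have the same intersection with B and the same
  hull together with B. By \<open>W_modular\<close> their widths agree, so they are equal.\<close>

lemma gen_modular_law:
  assumes A: "A \<in> P" and B: "B \<in> P" and C: "C \<in> P" "C \<subseteq> A" and ne: "B \<inter> C \<noteq> {}"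
  shows "A \<inter> gen (B \<union> C) = gen ((A \<inter> B) \<union> C)"
proof (rule sym, rule member_eqI)
  let ?N = "A \<inter> gen (B \<union> C)" and ?D = "gen ((A \<inter> B) \<union> C)"
  have hBC: "gen (B \<union> C) \<in> P" "B \<union> C \<subseteq> gen (B \<union> C)"
    using ne gen_subset by (auto intro!: gen_member)
  show N: "?N \<in> P" using ne C hBC A by (intro Int_member) auto
  show D: "?D \<in> P" using ne by (intro gen_member) auto
  show DN: "?D \<subseteq> ?N" using N C hBC by (intro gen_least) auto
  have D_sub: "(A \<inter> B) \<union> C \<subseteq> ?D" by (rule gen_subset)
  have NB: "?N \<inter> B = A \<inter> B" using hBC by auto
  have DB: "?D \<inter> B = A \<inter> B" using D_sub DN NB by blast
  have uN: "gen (?N \<union> B) = gen (B \<union> C)"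
    using hBC C by (intro equalityI gen_least gen_mono) auto
  have uD: "gen (?D \<union> B) = gen (B \<union> C)"
  proof
    show "gen (?D \<union> B) \<subseteq> gen (B \<union> C)" using DN hBC by (intro gen_least) auto
    show "gen (B \<union> C) \<subseteq> gen (?D \<union> B)" using D_sub by (intro gen_mono) auto
  qed
  have "W (gen (?N \<union> B)) + W (?N \<inter> B) = W ?N + W B"
    using NB ne C by (intro W_modular N B) auto
  moreover have "W (gen (?D \<union> B)) + W (?D \<inter> B) = W ?D + W B"
    using DB ne C by (intro W_modular D B) auto
  ultimately show "W ?N \<le> W ?D" unfolding NB DB uN uD by simp
qed

text \<open>Take a widest member H containing Y and avoiding u. If its width were below d - 1, there
  would be two different members of width W H + 1 above it, both containing u by maximality. Their
  intersection would then exceed H, so it would have the width of each of them and make them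
  equal.\<close>

lemma separating_hyperplane:
  assumes Y: "Y \<in> P" and u: "u \<notin> Y"
  obtains H where "H \<in> P" "Y \<subseteq> H" "u \<notin> H" "W H = d - 1"
proof -
  let ?S = "{H \<in> P. Y \<subseteq> H \<and> u \<notin> H}"
  have S: "finite ?S" "?S \<noteq> {}" using Y u by auto
  \<comment> \<open>Minimising d - W Z over this finite set maximises the width, since widths are at
    most d.\<close>
  define H where "H = arg_min_on (\<lambda>Z. d - W Z) ?S"
  have H: "H \<in> P" "Y \<subseteq> H" "u \<notin> H" using arg_min_if_finite(1)[OF S] unfolding H_def by auto
  have max: "u \<in> Z" if "Z \<in> P" "Y \<subseteq> Z" "W H < W Z" for Z
  proof (rule ccontr)
    assume "u \<notin> Z"
    then have "d - W H \<le> d - W Z" unfolding H_def using that by (intro arg_min_least[OF S]) auto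
    then show False using that(3) W_le_d[OF that(1)] by linarith
  qed
  obtain x where x: "x \<in> H" using member_nonempty H by blast
  have Hd: "W H < d" using W_d[OF H(1)] W_le_d[OF H(1)] H by auto
  have "W H = d - 1"
  proof (rule ccontr)
    assume "W H \<noteq> d - 1"
    then have less: "W H + 1 < d" using Hd by linarith
    obtain y1 where y1: "y1 \<notin> H" "adj x y1" using boundary[OF H(1) x UNIV_member] Hd by auto
    let ?H1 = "gen (insert y1 H)"
    have H1: "?H1 \<in> P" "insert y1 H \<subseteq> ?H1" "W ?H1 = W H + 1"
      using gen_member gen_subset gen_insert_adj[OF H(1) x y1(2,1)] by auto
    obtain y2 where y2: "y2 \<notin> ?H1" "adj x y2" using boundary[OF H1(1) _ UNIV_member, of x] H1 x less by auto
    let ?H2 = "gen (insert y2 H)"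
    have "y2 \<notin> H" using y2 H1 by auto
    then have H2: "?H2 \<in> P" "insert y2 H \<subseteq> ?H2" "W ?H2 = W H + 1"
      using gen_member gen_subset gen_insert_adj[OF H(1) x y2(2)] by auto
    have u12: "u \<in> ?H1 \<inter> ?H2" using max[of ?H1] max[of ?H2] H H1 H2 by auto
    then have I: "?H1 \<inter> ?H2 \<in> P" using H1 H2 by (intro Int_member) auto
    have "H \<subset> ?H1 \<inter> ?H2" using H1 H2 u12 H by auto
    then have "W H < W (?H1 \<inter> ?H2)" using W_strict_mono H I by blast
    then have le: "W ?H1 \<le> W (?H1 \<inter> ?H2)" "W ?H2 \<le> W (?H1 \<inter> ?H2)" using H1(3) H2(3) by simp_all
    have "?H1 \<inter> ?H2 = ?H1" by (rule member_eqI[OF I H1(1) _ le(1)]) simp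
    moreover have "?H1 \<inter> ?H2 = ?H2" by (rule member_eqI[OF I H2(1) _ le(2)]) simp
    ultimately show False using y2(1) H2(2) by blast
  qed
  then show ?thesis using that H by blast
qed

text \<open>The exchange axiom (QM4), with order reversed. At a closest pair x in A, y in B, joining
  x to B and joining y to A raise both widths by gd x y. So the join of x and B cannot contain A: it
  would contain the join of y and A, which is wider. It does meet A in x, and a vertex of A outside
  it can be separated from it by a hyperplane.\<close>

lemma exchange_hyperplane:
  assumes A: "A \<in> P" and B: "B \<in> P" and less: "W B < W A"
  obtains H where "H \<in> P" "B \<subseteq> H" "\<not> A \<subseteq> H" "A \<inter> H \<noteq> {}" "W H = d - 1"
proof -
  obtain B' where B': "B' \<in> P" "B \<subseteq> B'" "A \<inter> B' \<noteq> {}" "\<not> A \<subseteq> B'"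
  proof -
    have AB: "finite (A \<times> B)" "A \<times> B \<noteq> {}" using member_nonempty A B by auto
    define p where "p = arg_min_on (\<lambda>p. gd (fst p) (snd p)) (A \<times> B)"
    define x y where "x = fst p" and "y = snd p"
    have xy: "x \<in> A" "y \<in> B"
      using arg_min_if_finite(1)[OF AB, of "\<lambda>p. gd (fst p) (snd p)"] by (auto simp: x_def y_def p_def)
    have min: "gd x y \<le> gd u v" if "u \<in> A" "v \<in> B" for u v
      using arg_min_least[OF AB, of "(u, v)" "\<lambda>p. gd (fst p) (snd p)"] that
      by (simp add: x_def y_def p_def)
    let ?B = "gen (insert x B)" and ?A = "gen (insert y A)"
    have WB: "W ?B = W B + gd x y" using min xy by (intro gen_insert(1)[OF B]) auto
    have WA: "W ?A = W A + gd x y"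
      using gen_insert(1)[OF A xy(1), of y] min xy by (simp add: gd_sym[of y])
    have m: "?B \<in> P" "?A \<in> P" "insert x B \<subseteq> ?B" by (simp_all add: gen_member gen_subset)
    have "\<not> A \<subseteq> ?B"
    proof
      assume "A \<subseteq> ?B"
      then have "?A \<subseteq> ?B" using m xy by (intro gen_least) auto
      then show False using W_mono[OF m(2,1)] WA WB less by simp
    qed
    then show thesis using m xy by (intro that[of ?B]) auto
  qed
  obtain u where "u \<in> A" "u \<notin> B'" using B' by blast
  then obtain H where H: "H \<in> P" "B' \<subseteq> H" "u \<notin> H" "W H = d - 1"
    using separating_hyperplane[OF B'(1)] by blast
  show thesis using B' H \<open>u \<in> A\<close> by (intro that[of H]) auto
qed

text \<open>The neighbours of a vertex of Z that lie outside Z are partitioned by the members one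
  step above Z, which take q^(d-2) \<beta> each. In total there are ([d]_q - [d-2]_q) \<beta> =
  q^(d-2) (1 + q) \<beta> of them.\<close>

lemma card_covering_members:
  assumes Z: "Z \<in> P" "W Z + 2 = d"
  shows "real (card {H \<in> P. Z \<subseteq> H \<and> W H = W Z + 1}) = q + 1"
proof -
  obtain x where x: "x \<in> Z" using member_nonempty Z by blast
  let ?S = "{H \<in> P. Z \<subseteq> H \<and> W H = W Z + 1}"
  have step: "gen (insert y Z) = H" if "H \<in> ?S" "y \<in> H" "y \<notin> Z" "adj x y" for H y
  proof (rule member_eqI)
    show "gen (insert y Z) \<subseteq> H" using that by (intro gen_least) auto
    show "W H \<le> W (gen (insert y Z))" using gen_insert_adj[OF Z(1) x that(4,3)] that by simp
  qed (use that in \<open>auto intro: gen_member\<close>)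
  have "sphere UNIV x 1 - sphere Z x 1 = (\<Union>H\<in>?S. sphere H x 1 - sphere Z x 1)"
  proof
    show "sphere UNIV x 1 - sphere Z x 1 \<subseteq> (\<Union>H\<in>?S. sphere H x 1 - sphere Z x 1)"
    proof
      fix y assume "y \<in> sphere UNIV x 1 - sphere Z x 1"
      then have y: "gd x y = 1" "adj x y" "y \<notin> Z" using gd_eq_1 by (auto simp: sphere_def)
      have "gen (insert y Z) \<in> ?S" "y \<in> gen (insert y Z)"
        using gen_insert_adj[OF Z(1) x y(2,3)] gen_subset[of "insert y Z"] by (auto intro: gen_member)
      then show "y \<in> (\<Union>H\<in>?S. sphere H x 1 - sphere Z x 1)" using y unfolding sphere_def by blast
    qed
  qed (auto simp: sphere_def)
  moreover have "card (\<Union>H\<in>?S. sphere H x 1 - sphere Z x 1) = (\<Sum>H\<in>?S. card (sphere H x 1 - sphere Z x 1))"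
  proof (rule card_UN_disjoint)
    show "\<forall>H\<in>?S. \<forall>H'\<in>?S. H \<noteq> H' \<longrightarrow> (sphere H x 1 - sphere Z x 1) \<inter> (sphere H' x 1 - sphere Z x 1) = {}"
    proof (intro ballI impI, rule ccontr)
      fix H H' assume H: "H \<in> ?S" "H' \<in> ?S" "H \<noteq> H'"
        and "(sphere H x 1 - sphere Z x 1) \<inter> (sphere H' x 1 - sphere Z x 1) \<noteq> {}"
      then obtain y where "y \<in> H" "y \<in> H'" "y \<notin> Z" "adj x y" using gd_eq_1 by (auto simp: sphere_def)
      then show False using step[OF H(1)] step[OF H(2)] H(3) by blast
    qed
  qed auto
  moreover have diff: "real (card (sphere H x 1 - sphere Z x 1)) = (qint q (W H) - qint q (W Z)) * \<beta>"
    if "H \<in> P" "Z \<subseteq> H" for H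
  proof -
    have sub: "sphere Z x 1 \<subseteq> sphere H x 1" using that by (auto simp: sphere_def)
    then have "card (sphere Z x 1) \<le> card (sphere H x 1)" by (intro card_mono) auto
    then have "real (card (sphere H x 1 - sphere Z x 1)) = real (card (sphere H x 1)) - card (sphere Z x 1)"
      using sub by (simp add: card_Diff_subset of_nat_diff)
    then show ?thesis
      using tight_valency[OF member_tight] that Z x by (simp add: left_diff_distrib subsetD)
  qed
  ultimately have U: "card (sphere UNIV x 1 - sphere Z x 1) = (\<Sum>H\<in>?S. card (sphere H x 1 - sphere Z x 1))"
    and diff: "\<And>H. H \<in> P \<Longrightarrow> Z \<subseteq> H \<Longrightarrow>
      real (card (sphere H x 1 - sphere Z x 1)) = (qint q (W H) - qint q (W Z)) * \<beta>" by (simp_all only:)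
  have "(qint q d - qint q (W Z)) * \<beta> = real (card (sphere UNIV x 1 - sphere Z x 1))"
    using diff[OF UNIV_member] by simp
  also have "\<dots> = (\<Sum>H\<in>?S. real (card (sphere H x 1 - sphere Z x 1)))" unfolding U by simp
  also have "\<dots> = (\<Sum>H\<in>?S. (qint q (W H) - qint q (W Z)) * \<beta>)" by (intro sum.cong refl diff) auto
  also have "\<dots> = (\<Sum>H\<in>?S. q ^ W Z * \<beta>)" by (intro sum.cong refl) (simp add: qint_Suc)
  also have "\<dots> = (q ^ W Z * \<beta>) * card ?S" by simp
  also have "(qint q d - qint q (W Z)) * \<beta> = (q ^ W Z * \<beta>) * (q + 1)"
    unfolding Z(2)[symmetric] by (simp add: qint_Suc numeral_2_eq_2 algebra_simps)
  finally show ?thesis using q_ge_1 \<beta>_pos by simp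
qed

lemma card_line: assumes "L \<in> P" "W L = 1" shows "real (card L) = \<beta> + 1"
proof -
  obtain x where x: "x \<in> L" using member_nonempty assms by blast
  have "L = insert x (sphere L x 1)"
  proof -
    have "gd x y = 1" if "y \<in> L" "y \<noteq> x" for y
      using gd_le_W[OF assms(1) x that(1)] assms(2) that by (simp add: le_Suc_eq)
    then show ?thesis using x by (auto simp: sphere_def)
  qed
  moreover have "x \<notin> sphere L x 1" by (simp add: sphere_def)
  ultimately have "card L = Suc (card (sphere L x 1))"
    using card_insert_disjoint[of "sphere L x 1" x] by simp
  then show ?thesis using line_valency[OF assms x] by simp
qed

text \<open>A line has width 1, so its characteristic vector is itself orthogonal to E_d. For a
  vertex seeing it only at distances 1 and 2 this is one linear relation between the two sphere
  sizes; together with their sum \<beta> + 1 it fixes both.\<close>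

lemma card_adj_line_const:
  assumes "L \<in> P" "W L = 1" "\<And>z. z \<in> L \<Longrightarrow> gd v z = 1 \<or> gd v z = 2"
    and "L' \<in> P" "W L' = 1" "\<And>z. z \<in> L' \<Longrightarrow> gd v' z = 1 \<or> gd v' z = 2"
  shows "card (sphere L v 1) = card (sphere L' v' 1)"
proof -
  have *: "real (card (sphere K u 1)) * (\<Phi> 1 - \<Phi> 2) = - (\<beta> + 1) * \<Phi> 2"
    if K: "K \<in> P" "W K = 1" and u: "\<And>z. z \<in> K \<Longrightarrow> gd u z = 1 \<or> gd u z = 2" for K u
  proof -
    have "tight K 1" using member_tight K by metis
    from tight_spheres[OF this, of "{}" "{1, 2}" u]
    have 1: "\<Phi> 1 * card (sphere K u 1) + \<Phi> 2 * card (sphere K u 2) = 0" using u by simp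
    have "K = sphere K u 1 \<union> sphere K u 2" using u unfolding sphere_def by blast
    then have "card K = card (sphere K u 1 \<union> sphere K u 2)" by (rule arg_cong)
    also have "\<dots> = card (sphere K u 1) + card (sphere K u 2)"
      by (rule card_Un_disjoint) (auto simp: sphere_def)
    finally have 2: "real (card (sphere K u 2)) = \<beta> + 1 - card (sphere K u 1)" using card_line[OF K] by simp
    show ?thesis using 1 unfolding 2 by (simp add: algebra_simps)
  qed
  have "\<Phi> 2 \<noteq> 0" using d_ge_2 by (rule \<Phi>_nonzero)
  then have "\<Phi> 1 - \<Phi> 2 \<noteq> 0" using *[OF assms(1-3)] \<beta>_pos by auto
  then show ?thesis using *[OF assms(1-3)] *[OF assms(4-6)] by (metis mult_right_cancel of_nat_eq_iff)
qed

text \<open>Choose z0 on C at distance 2 from v. The c_2 = [2]_q (1 + \<alpha>) common neighbours of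
  v and z0 lie, by convexity, in the plane spanned by v and C, hence on the [2]_q lines of that
  plane through z0. All these lines, C among them, carry equally many neighbours of v by
  \<open>card_adj_line_const\<close>, so C carries 1 + \<alpha>.\<close>

lemma card_zig_zag:
  assumes C: "C \<in> P" "W C = 1" and v: "W (gen (insert v C)) = 2"
  shows "real (card {z \<in> C. adj v z}) = \<alpha> + 1"
proof -
  let ?G = "gen (insert v C)"
  have G: "?G \<in> P" "insert v C \<subseteq> ?G" by (simp_all add: gen_member gen_subset)
  obtain x where x: "x \<in> C" "\<And>u. u \<in> C \<Longrightarrow> gd v x \<le> gd v u" using nearest[OF C(1)] by blast
  obtain z0 where z0: "z0 \<in> C" "gd v z0 = W C + gd v x" "?G = gen2 v z0"
    using gen_insert(2)[OF C(1) x] by blast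
  have vx: "gd v x = 1" using gen_insert(1)[OF C(1) x] v C by simp
  have v2: "gd v z0 = 2" using z0 vx C by simp
  have v12: "gd v z = 1 \<or> gd v z = 2" if "L \<in> P" "L \<subseteq> ?G" "v \<notin> L" "z \<in> L" for L z
  proof -
    have "gd v z \<le> 2" using gd_le_W[OF G(1), of v z] G v that by auto
    moreover have "gd v z > 0" using that by auto
    ultimately show ?thesis by linarith
  qed
  have vG: "v \<in> ?G" and z0G: "z0 \<in> ?G" using G(2) z0(1) by auto
  have "v \<notin> C" using x(2)[of v] vx by auto
  define n where "n = card (sphere C v 1)"
  have n: "card (sphere L v 1) = n" if "L \<in> lines z0 ?G" for L
  proof -
    have L: "L \<in> P" "W L = 1" "z0 \<in> L" "L \<subseteq> ?G" using that by (auto simp: lines_def)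
    have "v \<notin> L" using gd_le_W[OF L(1) _ L(3), of v] v2 L(2) by auto
    then show ?thesis unfolding n_def
      using L C v12[OF L(1,4)] v12[OF C(1)] G \<open>v \<notin> C\<close> by (intro card_adj_line_const) auto
  qed
  have "{z. adj v z \<and> gd z0 z + 1 = gd z0 v} = (\<Union>L\<in>lines z0 ?G. sphere L v 1)"
  proof (intro equalityI subsetI)
    fix z assume z: "z \<in> {z. adj v z \<and> gd z0 z + 1 = gd z0 v}"
    have vz: "gd v z = 1" using z gd_eq_1 by simp
    have z0z: "gd z0 z = 1" using z v2 by (simp add: gd_sym)
    have "gd v z + gd z z0 = gd v z0" using vz z0z v2 gd_sym[of z z0] by simp
    then have "z \<in> ?G" by (rule convex[OF G(1) vG z0G])
    then have "gen2 z0 z \<in> lines z0 ?G"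
      using gen2[where x = z0 and y = z] gen2_least[OF G(1) z0G, of z] z0z unfolding lines_def by simp
    moreover have "z \<in> sphere (gen2 z0 z) v 1" using gen2 vz by (simp add: sphere_def)
    ultimately show "z \<in> (\<Union>L\<in>lines z0 ?G. sphere L v 1)" by blast
  next
    fix z assume "z \<in> (\<Union>L\<in>lines z0 ?G. sphere L v 1)"
    then obtain L where L: "L \<in> P" "W L = 1" "z0 \<in> L" "z \<in> L" "gd v z = 1" by (auto simp: lines_def sphere_def)
    have "gd z0 z \<le> 1" using gd_le_W[OF L(1,3,4)] L by simp
    moreover have "z \<noteq> z0" using L v2 by auto
    ultimately have "gd z0 z = 1" by (simp add: le_Suc_eq)
    then show "z \<in> {z. adj v z \<and> gd z0 z + 1 = gd z0 v}" using L(5) v2 gd_sym[of z0 v] gd_eq_1[of v z] by simp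
  qed
  moreover have "card (\<Union>L\<in>lines z0 ?G. sphere L v 1) = (\<Sum>L\<in>lines z0 ?G. card (sphere L v 1))"
  proof (rule card_UN_disjoint)
    show "\<forall>L\<in>lines z0 ?G. \<forall>L'\<in>lines z0 ?G. L \<noteq> L' \<longrightarrow> sphere L v 1 \<inter> sphere L' v 1 = {}"
    proof (intro ballI impI, rule ccontr)
      fix L L' assume L: "L \<in> lines z0 ?G" "L' \<in> lines z0 ?G" "L \<noteq> L'" "sphere L v 1 \<inter> sphere L' v 1 \<noteq> {}"
      then obtain z where z: "z \<in> L" "z \<in> L'" "gd v z = 1" by (auto simp: sphere_def)
      then have "z0 \<noteq> z" using v2 by auto
      then show False using line_eq_gen2[of L z0 z] line_eq_gen2[of L' z0 z] L z by (auto simp: lines_def)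
    qed
  qed (auto simp: lines_def)
  ultimately have "c (gd z0 v) = card (lines z0 ?G) * n" using card_prev[of v z0] n by simp
  then have "real (c 2) = qint q 2 * n"
    using card_lines[OF G(1), of z0] G z0 v v2 by (auto simp: gd_sym)
  moreover have "real (c 2) = qint q 2 * (1 + \<alpha>)" using c_eq[OF d_ge_2] by simp
  moreover have "qint q 2 \<noteq> 0" by (rule qint_nonzero) simp
  ultimately have "real n = \<alpha> + 1" by simp
  moreover have "{z \<in> C. adj v z} = sphere C v 1" using gd_eq_1 by (auto simp: sphere_def)
  ultimately show ?thesis by (simp add: n_def)
qed

end

section \<open>The quantum matroid\<close>

lemma reverse_inclusion_simps [simp]:
  "carrier (reverse_inclusion Q) = Q"
  "X \<sqsubseteq>\<^bsub>reverse_inclusion Q\<^esub> Y \<longleftrightarrow> Y \<subseteq> X"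
  "X .=\<^bsub>reverse_inclusion Q\<^esub> Y \<longleftrightarrow> X = Y"
  "X \<sqsubset>\<^bsub>reverse_inclusion Q\<^esub> Y \<longleftrightarrow> Y \<subset> X"
  "(reverse_inclusion Q)\<lparr>carrier := Q'\<rparr> = reverse_inclusion Q'"
  by (auto simp: reverse_inclusion_def lless_def)

lemma reverse_inclusion_partial_order: "partial_order (reverse_inclusion Q)"
  by unfold_locales (auto simp: reverse_inclusion_def)

lemma reverse_inclusion_least_iff:
  "least (reverse_inclusion Q) Y A \<longleftrightarrow> A \<subseteq> Q \<and> Y \<in> A \<and> (\<forall>Z\<in>A. Z \<subseteq> Y)"
  by (simp add: least_def)

lemma reverse_inclusion_greatest_iff:
  "greatest (reverse_inclusion Q) Y A \<longleftrightarrow> A \<subseteq> Q \<and> Y \<in> A \<and> (\<forall>Z\<in>A. Y \<subseteq> Z)"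
  by (simp add: greatest_def)

lemma reverse_inclusion_bottom:
  assumes "T \<in> Q" "\<And>Y. Y \<in> Q \<Longrightarrow> Y \<subseteq> T" shows "\<bottom>\<^bsub>reverse_inclusion Q\<^esub> = T"
  unfolding bottom_def reverse_inclusion_least_iff
  by (rule some_equality) (use assms in auto)

lemma reverse_inclusion_join:
  assumes "Y \<in> Q" "Z \<in> Q" "Y \<inter> Z \<in> Q"
  shows "least (reverse_inclusion Q) (Y \<inter> Z) (Upper (reverse_inclusion Q) {Y, Z})"
    "Y \<squnion>\<^bsub>reverse_inclusion Q\<^esub> Z = Y \<inter> Z"
proof -
  show l: "least (reverse_inclusion Q) (Y \<inter> Z) (Upper (reverse_inclusion Q) {Y, Z})"
    using assms by (auto simp: reverse_inclusion_least_iff Upper_def)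
  show "Y \<squnion>\<^bsub>reverse_inclusion Q\<^esub> Z = Y \<inter> Z"
    unfolding join_def sup_def
    by (rule some_equality, rule l) (use l in \<open>auto simp: reverse_inclusion_least_iff\<close>)
qed

lemma reverse_inclusion_meet:
  assumes "Y \<in> Q" "Z \<in> Q" "G \<in> Q" "Y \<union> Z \<subseteq> G" "\<And>H. H \<in> Q \<Longrightarrow> Y \<union> Z \<subseteq> H \<Longrightarrow> G \<subseteq> H"
  shows "greatest (reverse_inclusion Q) G (Lower (reverse_inclusion Q) {Y, Z})"
    "Y \<sqinter>\<^bsub>reverse_inclusion Q\<^esub> Z = G"
proof -
  show g: "greatest (reverse_inclusion Q) G (Lower (reverse_inclusion Q) {Y, Z})"
    using assms by (auto simp: reverse_inclusion_greatest_iff Lower_def)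
  show "Y \<sqinter>\<^bsub>reverse_inclusion Q\<^esub> Z = G"
    unfolding meet_def inf_def
    by (rule some_equality, rule g) (use g in \<open>auto simp: reverse_inclusion_greatest_iff\<close>)
qed

context descendent_family
begin

section \<open>Covering relation and rank\<close>

abbreviation L :: "'x set gorder" where "L \<equiv> reverse_inclusion P"

text \<open>\<open>extend\<close> finds a member inside X that is one step wider than Y, and
  minimality forces it to be X. Conversely, a member strictly in between would have a width strictly
  in between.\<close>

lemma covers_iff: "covers L Y X \<longleftrightarrow> X \<in> P \<and> Y \<in> P \<and> Y \<subseteq> X \<and> W X = W Y + 1"
proof
  assume "covers L Y X"
  then have XY: "X \<in> P" "Y \<in> P" "Y \<subset> X" and no: "\<And>Z. Z \<in> P \<Longrightarrow> Z \<subset> X \<Longrightarrow> \<not> Y \<subset> Z"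
    by (auto simp: covers_def)
  obtain x where "x \<in> Y" using member_nonempty XY by blast
  then obtain y where "gen (insert y Y) \<in> P" "Y \<subset> gen (insert y Y)"
    "gen (insert y Y) \<subseteq> X" "W (gen (insert y Y)) = W Y + 1"
    using extend[OF XY(2) _ XY(1,3)] by metis
  then show "X \<in> P \<and> Y \<in> P \<and> Y \<subseteq> X \<and> W X = W Y + 1"
    using no XY by (metis psubsetE psubsetI)
next
  assume XY: "X \<in> P \<and> Y \<in> P \<and> Y \<subseteq> X \<and> W X = W Y + 1"
  have "False" if "Z \<in> P" "Y \<subset> Z" "Z \<subset> X" for Z
    using W_strict_mono[of Y Z] W_strict_mono[of Z X] that XY by simp
  moreover have "Y \<noteq> X" using XY by auto
  ultimately show "covers L Y X" using XY by (auto simp: covers_def)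
qed

lemma rank_function_width: "rank_function L (\<lambda>Y. d - W Y)"
  unfolding rank_function_def
proof (intro conjI ballI impI allI)
  fix X assume X: "X \<in> carrier L" "\<forall>Y\<in>carrier L. Y \<sqsubseteq>\<^bsub>L\<^esub> X \<longrightarrow> Y = X"
  then have "X = UNIV" using UNIV_member by auto
  then show "d - W X = 0" by simp
next
  fix X Y assume "covers L Y X"
  then show "d - W Y = d - W X + 1" using W_le_d[of X] by (auto simp: covers_iff)
qed

text \<open>\<open>rank_of\<close> is a choice among rank functions, so all of them have to agree on
  the members: starting from the bottom element, every member is reached through a chain of covers
  provided by \<open>extend\<close>.\<close>

lemma rank_function_unique: assumes r: "rank_function L r" and Y: "Y \<in> P" shows "r Y = d - W Y"
  using Y
proof (induction "d - W Y" arbitrary: Y)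
  case 0
  then have "Y = UNIV" using W_d W_le_d by (metis diff_is_0_eq order_antisym)
  then have "r Y = 0" using r 0 unfolding rank_function_def by (simp add: top_unique)
  then show ?case using 0 by simp
next
  case (Suc n)
  then have "Y \<noteq> UNIV" by auto
  obtain x where "x \<in> Y" using member_nonempty Suc by blast
  moreover have "Y \<subset> UNIV" using \<open>Y \<noteq> UNIV\<close> by blast
  ultimately obtain Z where Z: "Z \<in> P" "Y \<subset> Z" "W Z = W Y + 1"
    using extend[OF Suc(3) _ UNIV_member] by metis
  then have "covers L Y Z" using Suc by (auto simp: covers_iff)
  then have "r Y = r Z + 1" using r by (simp add: rank_function_def)
  moreover have "n = d - W Z" using Suc(2) Z by simp
  ultimately show ?case using Suc(1)[OF _ Z(1)] Suc(2) by simp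
qed

lemma rank_of_eq: "Y \<in> P \<Longrightarrow> rank_of L Y = d - W Y"
  unfolding rank_of_def
  using rank_function_unique[OF someI[of "rank_function L", OF rank_function_width]] .

lemma poset_rank_eq: "poset_rank L = d"
  unfolding poset_rank_def
proof (rule Max_eqI)
  show "y \<le> d" if "y \<in> rank_of L ` carrier L" for y using that by (auto simp: rank_of_eq)
  show "d \<in> rank_of L ` carrier L"
    using singleton_member[of undefined] by (intro image_eqI[of _ _ "{undefined}"]) (simp_all add: rank_of_eq)
qed simp

section \<open>Intervals are modular atomic lattices\<close>

lemma interval_Int:
  assumes Z: "Z \<in> P" and Y: "Y1 \<in> {Y \<in> P. Z \<subseteq> Y}" "Y2 \<in> {Y \<in> P. Z \<subseteq> Y}"
  shows "Y1 \<inter> Y2 \<in> {Y \<in> P. Z \<subseteq> Y}"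
proof -
  have "Y1 \<inter> Y2 \<noteq> {}" using member_nonempty[OF Z] Y by blast
  then show ?thesis using Y Int_member[of Y1 Y2] by blast
qed

lemma interval_gen:
  assumes "Y1 \<in> {Y \<in> P. Z \<subseteq> Y}" shows "gen (Y1 \<union> Y2) \<in> {Y \<in> P. Z \<subseteq> Y}"
proof -
  have "Y1 \<union> Y2 \<noteq> {}" using member_nonempty[of Y1] assms by auto
  then show ?thesis using assms gen_member[of "Y1 \<union> Y2"] gen_subset[of "Y1 \<union> Y2"] by blast
qed

text \<open>\<open>Q\<close> is the interval from the bottom element to Z. All its members contain
  the nonempty set Z, so any two of them intersect; this makes joins exist and
  \<open>gen_modular_law\<close> applicable. Atoms are members of width d - 1, and atomicity is
  separation by hyperplanes.\<close>

lemma interval_lattice: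
  assumes Z: "Z \<in> P" defines "Q \<equiv> {Y \<in> P. Z \<subseteq> Y}"
  shows "modular_atomic_lattice (reverse_inclusion Q)"
proof -
  have Q: "Y \<in> Q \<longleftrightarrow> Y \<in> P \<and> Z \<subseteq> Y" for Y by (simp add: Q_def)
  note Int_Q = interval_Int[OF Z, folded Q_def] and gen_Q = interval_gen[of _ Z, folded Q_def]
  have join: "least (reverse_inclusion Q) (Y1 \<inter> Y2) (Upper (reverse_inclusion Q) {Y1, Y2})"
    "Y1 \<squnion>\<^bsub>reverse_inclusion Q\<^esub> Y2 = Y1 \<inter> Y2" if "Y1 \<in> Q" "Y2 \<in> Q" for Y1 Y2
    using reverse_inclusion_join[OF that Int_Q[OF that]] by auto
  have meet: "greatest (reverse_inclusion Q) (gen (Y1 \<union> Y2)) (Lower (reverse_inclusion Q) {Y1, Y2})"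
    "Y1 \<sqinter>\<^bsub>reverse_inclusion Q\<^esub> Y2 = gen (Y1 \<union> Y2)" if "Y1 \<in> Q" "Y2 \<in> Q" for Y1 Y2
    using reverse_inclusion_meet[OF that gen_Q[OF that(1)] gen_subset gen_least] Q by auto
  interpret partial_order "reverse_inclusion Q" by (rule reverse_inclusion_partial_order)
  have lat: "lattice (reverse_inclusion Q)"
    by unfold_locales (simp_all, (blast intro: join(1) meet(1))+)
  have modular: "X \<squnion>\<^bsub>reverse_inclusion Q\<^esub> (Y \<sqinter>\<^bsub>reverse_inclusion Q\<^esub> C) = (X \<squnion>\<^bsub>reverse_inclusion Q\<^esub> Y) \<sqinter>\<^bsub>reverse_inclusion Q\<^esub> C"
    if XYC: "X \<in> Q" "Y \<in> Q" "C \<in> Q" "C \<subseteq> X" for X Y C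
  proof -
    have "Y \<inter> C \<noteq> {}" using member_nonempty[OF Z] XYC Q by blast
    then have "X \<inter> gen (Y \<union> C) = gen ((X \<inter> Y) \<union> C)" using XYC Q by (intro gen_modular_law) auto
    then show ?thesis
      using XYC by (simp only: join(2) meet(2) gen_Q Int_Q)
  qed
  have UNIV_Q: "UNIV \<in> Q" using UNIV_member Q by simp
  have bot: "\<bottom>\<^bsub>reverse_inclusion Q\<^esub> = UNIV" using UNIV_Q by (intro reverse_inclusion_bottom) auto
  have at: "atom (reverse_inclusion Q) H" if "H \<in> Q" "W H = d - 1" for H
  proof -
    have "covers L H UNIV" using that Q UNIV_member d_ge_2 by (simp add: covers_iff)
    then show ?thesis using that UNIV_Q unfolding atom_def bot covers_def by (auto simp: Q)
  qed
  have "\<exists>S. S \<subseteq> {a. atom (reverse_inclusion Q) a} \<and> least (reverse_inclusion Q) Y (Upper (reverse_inclusion Q) S)"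
    if Y: "Y \<in> Q" for Y
  proof (intro exI[of _ "{H \<in> Q. Y \<subseteq> H \<and> W H = d - 1}"] conjI)
    show "{H \<in> Q. Y \<subseteq> H \<and> W H = d - 1} \<subseteq> {a. atom (reverse_inclusion Q) a}" using at by auto
    \<comment> \<open>The hyperplanes through \<open>Y\<close> intersect in \<open>Y\<close>, since
      each vertex outside \<open>Y\<close> is missed by one of them; a separating hyperplane
      contains \<open>Y\<close>, hence Z, and so belongs to \<open>Q\<close>.\<close>
    have "U \<subseteq> Y" if U: "U \<in> Q" "\<And>H. H \<in> Q \<Longrightarrow> Y \<subseteq> H \<Longrightarrow> W H = d - 1 \<Longrightarrow> U \<subseteq> H" for U
    proof
      fix u assume u: "u \<in> U"
      show "u \<in> Y"
      proof (rule ccontr)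
        assume "u \<notin> Y"
        moreover have "Y \<in> P" using Y Q by simp
        ultimately obtain H where "H \<in> P" "Y \<subseteq> H" "u \<notin> H" "W H = d - 1" using separating_hyperplane by metis
        moreover then have "H \<in> Q" using Y Q by blast
        ultimately show False using U(2)[of H] u by blast
      qed
    qed
    then show "least (reverse_inclusion Q) Y (Upper (reverse_inclusion Q) {H \<in> Q. Y \<subseteq> H \<and> W H = d - 1})"
      using Y by (auto simp: reverse_inclusion_least_iff Upper_def)
  qed
  then show ?thesis unfolding modular_atomic_lattice_def using lat modular by simp
qed

section \<open>The axioms and nontriviality\<close>

lemma bottom_L: "\<bottom>\<^bsub>L\<^esub> = UNIV"
  using UNIV_member by (intro reverse_inclusion_bottom) auto

lemma meet_L:
  assumes "Y \<in> P" "Z \<in> P"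
  shows "greatest L (gen (Y \<union> Z)) (Lower L {Y, Z})" "Y \<sqinter>\<^bsub>L\<^esub> Z = gen (Y \<union> Z)"
proof -
  have "Y \<union> Z \<noteq> {}" using member_nonempty assms by auto
  from reverse_inclusion_meet[OF assms gen_member[OF this] gen_subset gen_least]
  show "greatest L (gen (Y \<union> Z)) (Lower L {Y, Z})" "Y \<sqinter>\<^bsub>L\<^esub> Z = gen (Y \<union> Z)" by auto
qed

lemma quantum_matroid_L: "quantum_matroid L"
  unfolding quantum_matroid_def
proof (intro conjI ballI impI)
  interpret partial_order L by (rule reverse_inclusion_partial_order)
  show "partial_order L" by (rule reverse_inclusion_partial_order)
  show "lower_semilattice L" by unfold_locales (use meet_L(1) in auto)
  show "ranked L" unfolding ranked_def using rank_function_width by blast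
  show "carrier L \<noteq> {}" using UNIV_member by auto
next
  fix Z assume "Z \<in> carrier L"
  moreover have "\<lbrace>\<bottom>\<^bsub>L\<^esub>..Z\<rbrace>\<^bsub>L\<^esub> = {Y \<in> P. Z \<subseteq> Y}" by (simp add: at_least_at_most_def bottom_L)
  ultimately show "modular_atomic_lattice (L\<lparr>carrier := \<lbrace>\<bottom>\<^bsub>L\<^esub>..Z\<rbrace>\<^bsub>L\<^esub>\<rparr>)"
    using interval_lattice[of Z] by simp
next
  fix A B assume AB: "A \<in> carrier L" "B \<in> carrier L" "rank_of L A < rank_of L B"
  then have m: "A \<in> P" "B \<in> P" and "W B < W A" by (auto simp: rank_of_eq)
  then obtain H where H: "H \<in> P" "B \<subseteq> H" "\<not> A \<subseteq> H" "A \<inter> H \<noteq> {}" "W H = d - 1"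
    using exchange_hyperplane by metis
  have "atom L H" unfolding atom_def bottom_L covers_iff using H UNIV_member d_ge_2 by simp
  \<comment> \<open>The join with the atom exists precisely because the hyperplane was chosen to
    meet \<open>A\<close>.\<close>
  moreover have "least L (A \<inter> H) (Upper L {A, H})"
    using m H Int_member by (intro reverse_inclusion_join) auto
  ultimately show "\<exists>a. atom L a \<and> a \<sqsubseteq>\<^bsub>L\<^esub> B \<and> \<not> a \<sqsubseteq>\<^bsub>L\<^esub> A \<and> (\<exists>s. least L s (Upper L {A, a}))"
    using H by auto
qed simp

text \<open>Two distinct singletons have no common upper bound, because members are nonempty; so the
  poset is not even a lattice.\<close>

lemma nontrivial_quantum_matroid_L: "nontrivial_quantum_matroid L"
proof -
  have "\<not> lattice L"
  proof
    assume "lattice L"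
    then interpret lattice L .
    obtain x y where "gd x y = 1" using ex_gd_eq[of 1] d_ge_2 diam_eq by auto
    then have "x \<noteq> y" by auto
    obtain S where "least L S (Upper L {{x}, {y}})"
      using sup_of_two_exists[of "{x}" "{y}"] singleton_member by auto
    then have "S \<in> P" "S \<subseteq> {x}" "S \<subseteq> {y}"
      using singleton_member by (auto simp: reverse_inclusion_least_iff Upper_def)
    then show False using \<open>x \<noteq> y\<close> member_nonempty[of S] by auto
  qed
  then show ?thesis
    unfolding nontrivial_quantum_matroid_def modular_atomic_lattice_def
    using quantum_matroid_L poset_rank_eq d_ge_2 by simp
qed

section \<open>The three regularity parameters\<close>

lemma line_regular_L: "line_regular L q"
  unfolding line_regular_def
proof (intro ballI impI)
  fix Z assume "Z \<in> carrier L" "rank_of L Z = 2"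
  then have Z: "Z \<in> P" "W Z + 2 = d" using W_le_d[of Z] by (auto simp: rank_of_eq)
  have "{H. covers L Z H} = {H \<in> P. Z \<subseteq> H \<and> W H = W Z + 1}" using Z by (auto simp: covers_iff)
  then show "real (card {H. covers L Z H}) = q + 1" using card_covering_members[OF Z] by simp
qed

text \<open>Elements of rank d - 1 are lines and elements of rank d are single vertices, so the two
  remaining parameters are counts of vertices on a line.\<close>

lemma W_eq_1: "Y \<in> P \<Longrightarrow> rank_of L Y = poset_rank L - 1 \<Longrightarrow> W Y = 1"
  using W_le_d[of Y] d_ge_2 by (auto simp: rank_of_eq poset_rank_eq)

lemma covers_line_iff:
  assumes "C \<in> P" "W C = 1" shows "covers L Y C \<longleftrightarrow> (\<exists>z\<in>C. Y = {z})"
proof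
  assume "covers L Y C"
  then have Y: "Y \<in> P" "Y \<subseteq> C" "W Y = 0" using assms by (auto simp: covers_iff)
  obtain z where "z \<in> Y" using member_nonempty Y by blast
  then show "\<exists>z\<in>C. Y = {z}" using W_0[OF Y(1)] Y by blast
qed (use assms singleton_member in \<open>auto simp: covers_iff\<close>)

lemma dual_line_regular_L: "dual_line_regular L \<beta>"
  unfolding dual_line_regular_def
proof (intro ballI impI)
  fix C assume "C \<in> carrier L" "rank_of L C = poset_rank L - 1"
  then have C: "C \<in> P" "W C = 1" using W_eq_1 by auto
  have "{Y. covers L Y C} = (\<lambda>z. {z}) ` C" using covers_line_iff[OF C] by auto
  then show "real (card {Y. covers L Y C}) = \<beta> + 1"
    using card_line[OF C] by (simp add: card_image)
qed

text \<open>With V = {v}, the zig-zag pairs correspond to the vertices z of the line C adjacent to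
  v: the rank d element of the pair is {z}, and the rank d - 1 element is the line joining v and z.
  The count is then \<open>card_zig_zag\<close>.\<close>

lemma zig_zag_regular_L: "zig_zag_regular L \<alpha>"
  unfolding zig_zag_regular_def
proof (intro ballI impI)
  fix C V assume CV: "C \<in> carrier L" "V \<in> carrier L"
    and *: "rank_of L C = poset_rank L - 1 \<and> rank_of L V = poset_rank L \<and> covers L C (C \<sqinter>\<^bsub>L\<^esub> V)"
  have C: "C \<in> P" "W C = 1" using CV * W_eq_1 by auto
  have V: "V \<in> P" "W V = 0" using CV * W_le_d[of V] d_ge_2 by (auto simp: rank_of_eq poset_rank_eq)
  obtain v where v: "v \<in> V" using member_nonempty V by blast
  have Vv: "V = {v}" using W_0[OF V(1) v] V by simp
  \<comment> \<open>The meet is the hull of \<open>v\<close> and \<open>C\<close>, so the covering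
    condition says that this hull is a plane.\<close>
  have "covers L C (gen (insert v C))" using * meet_L(2)[OF C(1) V(1)] by (simp add: Vv)
  then have W2: "W (gen (insert v C)) = 2" using C by (simp add: covers_iff)
  have "v \<notin> C" using W2 C gen_eq by (auto simp: insert_absorb)
  have iff: "(covers L Y1 C \<and> covers L Y1 X1 \<and> covers L V X1) \<longleftrightarrow> (\<exists>z\<in>C. adj v z \<and> (X1, Y1) = (gen2 v z, {z}))" for X1 Y1
  proof
    assume c: "covers L Y1 C \<and> covers L Y1 X1 \<and> covers L V X1"
    then obtain z where z: "z \<in> C" "Y1 = {z}" using covers_line_iff[OF C] by blast
    have X1: "X1 \<in> P" "W X1 = 1" "v \<in> X1" "z \<in> X1" using c Vv V z by (auto simp: covers_iff)
    have "v \<noteq> z" using z \<open>v \<notin> C\<close> by auto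
    then have "X1 = gen2 v z" using line_eq_gen2[OF X1] by simp
    moreover have "gd v z = 1" using gen2(4)[where x = v and y = z] X1 calculation by simp
    ultimately show "\<exists>z\<in>C. adj v z \<and> (X1, Y1) = (gen2 v z, {z})" using z gd_eq_1 by auto
  next
    assume "\<exists>z\<in>C. adj v z \<and> (X1, Y1) = (gen2 v z, {z})"
    then obtain z where z: "z \<in> C" "adj v z" "X1 = gen2 v z" "Y1 = {z}" by auto
    then have X1: "X1 \<in> P" "W X1 = 1" "v \<in> X1" "z \<in> X1"
      using gen2[where x = v and y = z] line_gen2 by auto
    show "covers L Y1 C \<and> covers L Y1 X1 \<and> covers L V X1"
      unfolding covers_line_iff[OF C] covers_line_iff[OF X1(1,2)] using z X1 Vv by auto
  qed
  have "{(X1, Y1). covers L Y1 C \<and> covers L Y1 X1 \<and> covers L V X1} = (\<lambda>z. (gen2 v z, {z})) ` {z \<in> C. adj v z}"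
    unfolding iff by auto
  moreover have "inj_on (\<lambda>z. (gen2 v z, {z})) {z \<in> C. adj v z}" by (auto simp: inj_on_def)
  ultimately show "real (card {(X1, Y1). covers L Y1 C \<and> covers L Y1 X1 \<and> covers L V X1}) = \<alpha> + 1"
    using card_zig_zag[OF C W2] by (simp add: card_image)
qed

end

theorem mainTheorem7:
  fixes adj :: "'x::finite \<Rightarrow> 'x \<Rightarrow> bool"
    and d :: nat
    and q \<alpha> \<beta> :: real
    and E :: "nat \<Rightarrow> complex^'x^'x"
    and P :: "'x set set"
  assumes "distance_regular adj"
    and "graph_diameter adj = d"
    and "d \<ge> 3"
    and "classical_parameters adj d q \<alpha> \<beta>"
    and "standard_ordering adj q E"
    and "P \<noteq> {}"
    and "\<forall>Y\<in>P. descendent adj E Y"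
    and "\<forall>i\<le>d. \<forall>x y. graph_dist adj x y = i \<longrightarrow>
           (\<exists>!Y. Y \<in> P \<and> x \<in> Y \<and> y \<in> Y \<and> width adj Y = i)"
    and "\<forall>Y1\<in>P. \<forall>Y2\<in>P. Y1 \<inter> Y2 \<noteq> {} \<longrightarrow> Y1 \<inter> Y2 \<in> P"
  shows "nontrivial_quantum_matroid (reverse_inclusion P) \<and>
         regular_with_parameters (reverse_inclusion P) d q \<alpha> \<beta>"
proof -
  obtain b c where bc: "intersection_numbers adj b c"
    "\<forall>i\<le>d. real (b i) = (qint q d - qint q i) * (\<beta> - \<alpha> * qint q i) \<and>
            real (c i) = qint q i * (1 + \<alpha> * qint q (i - 1))"
    using assms(4) unfolding classical_parameters_def by blast
  interpret classical_scheme adj b c d q \<alpha> \<beta> E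
    by unfold_locales (use assms(1-3,5) bc in \<open>auto simp: distance_regular_def\<close>)
  interpret descendent_family adj b c d q \<alpha> \<beta> E P
    by unfold_locales (use assms(7-9) in auto)
  show ?thesis
    unfolding regular_with_parameters_def
    using nontrivial_quantum_matroid_L poset_rank_eq line_regular_L dual_line_regular_L zig_zag_regular_L
    by blast
qed

end
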